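(* Let $S$ be a Cohen-Macaulay domain that is positively graded over a field, and let $I$ be a proper homogeneous ideal of $S$ that is unmixed and generically a complete intersection, with $\operatorname{ht}(I)=c$. Let $m$ be a positive integer. If $t_0\ge 0$ is an integer such that $I^{(m)}=I^m:\mathbf F_c(I)^{t_0}$, then $$\alpha(I^{(m)})\ge m\,\alpha(I)-t_0\,\alpha(\mathbf F_c(I)).$$ In particular, one has (without any assumption involving $t_0$) $$\alpha(I^{(m)})\ge m\bigl(\alpha(I)-\alpha(\mathbf F_c(I))\bigr)+\alpha(\mathbf F_c(I)).$$
   Context: All rings are Noetherian, commutative, with identity. An ideal $I$ is unmixed of height $c$ if $\operatorname{ht}(p)=c$ for every $p\in\operatorname{Ass}_S(S/I)$. $I$ is generically a complete intersection if for every $p\in\operatorname{Ass}_S(S/I)$ the localization $I_p$ can be generated by an $S_p$-regular sequence. The $m$-th symbolic power of $I$ is $I^{(m)}=\bigcap_{p\in\operatorname{Ass}_S(S/I)}(I^mS_p\cap S)$, where $I^mS_p\cap S$ denotes the preimage in $S$ of $I^mS_p$ under $S\to S_p$. For a finitely generated $S$-module $M$ with free presentation $S^q\xrightarrow{\varphi}S^{\mu}\to M\to 0$, the $j$-th Fitting ideal is $\mathbf F_j(M)=I_{\mu-j}(\varphi)$, the ideal generated by the $(\mu-j)$-minors of $\varphi$ (with $\mathbf F_j(M)=S$ if $j\ge\mu$); it is independent of the presentation. $\mathbf F_c(I)$ is the $c$-th Fitting ideal of $I$ viewed as an $S$-module. Positively graded over a field $k$ means $S=\bigoplus_{i\ge0}S_i$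 with $S_0=k$. For a homogeneous ideal $L$, $\alpha(L)$ denotes its initial degree, i.e. the least degree of a nonzero homogeneous element of $L$ (with $\alpha(0)=+\infty$). *)

theory Defs
  imports
    "HOL-Algebra.Algebra"
    "HOL-Combinatorics.Permutations"
    "HOL-Library.Extended_Real"
begin

section \<open>Localization\<close>

definition loc_rel :: "('a, 'b) ring_scheme \<Rightarrow> 'a set \<Rightarrow> (('a \<times> 'a) \<times> ('a \<times> 'a)) set" where
  "loc_rel R U = {((a, s), (b, t)). a \<in> carrier R \<and> s \<in> U \<and> b \<in> carrier R \<and> t \<in> U \<and>
     (\<exists>u\<in>U. u \<otimes>\<^bsub>R\<^esub> (a \<otimes>\<^bsub>R\<^esub> t) = u \<otimes>\<^bsub>R\<^esub> (b \<otimes>\<^bsub>R\<^esub> s))}"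

definition loc_frac :: "('a, 'b) ring_scheme \<Rightarrow> 'a set \<Rightarrow> 'a \<Rightarrow> 'a \<Rightarrow> ('a \<times> 'a) set" where
  "loc_frac R U a s = loc_rel R U `` {(a, s)}"

definition localization :: "('a, 'b) ring_scheme \<Rightarrow> 'a set \<Rightarrow> ('a \<times> 'a) set ring" where
  "localization R U =
     \<lparr>carrier = (carrier R \<times> U) // loc_rel R U,
      monoid.mult = (\<lambda>P Q. \<Union>(a, s)\<in>P. \<Union>(b, t)\<in>Q. loc_frac R U (a \<otimes>\<^bsub>R\<^esub> b) (s \<otimes>\<^bsub>R\<^esub> t)),
      monoid.one = loc_frac R U \<one>\<^bsub>R\<^esub> \<one>\<^bsub>R\<^esub>,
      ring.zero = loc_frac R U \<zero>\<^bsub>R\<^esub> \<one>\<^bsub>R\<^esub>,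
      ring.add = (\<lambda>P Q. \<Union>(a, s)\<in>P. \<Union>(b, t)\<in>Q.
               loc_frac R U ((a \<otimes>\<^bsub>R\<^esub> t) \<oplus>\<^bsub>R\<^esub> (b \<otimes>\<^bsub>R\<^esub> s)) (s \<otimes>\<^bsub>R\<^esub> t))\<rparr>"

abbreviation local_at :: "('a, 'b) ring_scheme \<Rightarrow> 'a set \<Rightarrow> ('a \<times> 'a) set ring" where
  "local_at R p \<equiv> localization R (carrier R - p)"

definition to_local :: "('a, 'b) ring_scheme \<Rightarrow> 'a set \<Rightarrow> 'a \<Rightarrow> ('a \<times> 'a) set" where
  "to_local R p a = loc_frac R (carrier R - p) a \<one>\<^bsub>R\<^esub>"

definition extend_local :: "('a, 'b) ring_scheme \<Rightarrow> 'a set \<Rightarrow> 'a set \<Rightarrow> ('a \<times> 'a) set set" where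
  "extend_local R p I = Idl\<^bsub>local_at R p\<^esub> (to_local R p ` I)"

definition contract_local :: "('a, 'b) ring_scheme \<Rightarrow> 'a set \<Rightarrow> ('a \<times> 'a) set set \<Rightarrow> 'a set" where
  "contract_local R p J = {x \<in> carrier R. to_local R p x \<in> J}"

text \<open>The operations above are defined through representatives; the following facts show that
  they are well defined and give a commutative ring.\<close>

locale mult_closed = cring R for R (structure) +
  fixes U
  assumes U_carrier: "U \<subseteq> carrier R"
    and U_one: "\<one> \<in> U"
    and U_mult: "s \<in> U \<Longrightarrow> t \<in> U \<Longrightarrow> s \<otimes> t \<in> U"
begin

lemma U_in [simp]: "s \<in> U \<Longrightarrow> s \<in> carrier R"
  using U_carrier by blast

lemma equiv_loc_rel: "equiv (carrier R \<times> U) (loc_rel R U)"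
proof (rule equivI)
  show "loc_rel R U \<subseteq> (carrier R \<times> U) \<times> (carrier R \<times> U)"
    by (auto simp: loc_rel_def)
  show "refl_on (carrier R \<times> U) (loc_rel R U)"
    by (rule refl_onI) (use U_one in \<open>auto simp: loc_rel_def\<close>)
  show "sym (loc_rel R U)"
    by (rule symI) (auto simp: loc_rel_def, metis)
  show "trans (loc_rel R U)"
  proof (rule transI, clarify)
    fix a s b t c r
    assume 1: "((a, s), (b, t)) \<in> loc_rel R U" and 2: "((b, t), (c, r)) \<in> loc_rel R U"
    then have mem: "a \<in> carrier R" "b \<in> carrier R" "c \<in> carrier R" "s \<in> U" "t \<in> U" "r \<in> U"
      by (auto simp: loc_rel_def)
    obtain u where u: "u \<in> U" "u \<otimes> (a \<otimes> t) = u \<otimes> (b \<otimes> s)"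
      using 1 by (auto simp: loc_rel_def)
    obtain v where v: "v \<in> U" "v \<otimes> (b \<otimes> r) = v \<otimes> (c \<otimes> t)"
      using 2 by (auto simp: loc_rel_def)
    have "(u \<otimes> v \<otimes> t) \<otimes> (a \<otimes> r) = (v \<otimes> r) \<otimes> (u \<otimes> (a \<otimes> t))"
      using mem u(1) v(1) by (simp add: m_ac)
    also have "\<dots> = (u \<otimes> s) \<otimes> (v \<otimes> (b \<otimes> r))"
      using mem u v(1) by (simp add: m_ac)
    also have "\<dots> = (u \<otimes> v \<otimes> t) \<otimes> (c \<otimes> s)"
      using mem u(1) v by (simp add: m_ac)
    finally show "((a, s), (c, r)) \<in> loc_rel R U"
      unfolding loc_rel_def using mem u(1) v(1) U_mult by blast
  qed
qed

lemma loc_frac_eq_iff: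
  assumes "a \<in> carrier R" "s \<in> U" "b \<in> carrier R" "t \<in> U"
  shows "loc_frac R U a s = loc_frac R U b t \<longleftrightarrow> (\<exists>u\<in>U. u \<otimes> (a \<otimes> t) = u \<otimes> (b \<otimes> s))"
  unfolding loc_frac_def
  using eq_equiv_class_iff[OF equiv_loc_rel, of "(a, s)" "(b, t)"] assms
  by (auto simp: loc_rel_def)

lemma loc_frac_eqI:
  assumes "a \<in> carrier R" "s \<in> U" "b \<in> carrier R" "t \<in> U" "a \<otimes> t = b \<otimes> s"
  shows "loc_frac R U a s = loc_frac R U b t"
  using assms U_one by (auto simp: loc_frac_eq_iff)

lemma loc_frac_closed: "a \<in> carrier R \<Longrightarrow> s \<in> U \<Longrightarrow> loc_frac R U a s \<in> carrier (localization R U)"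
  by (auto simp: localization_def loc_frac_def intro: quotientI)

lemma carrier_localization_cases:
  assumes "P \<in> carrier (localization R U)"
  obtains a s where "a \<in> carrier R" "s \<in> U" "P = loc_frac R U a s"
  using assms by (auto simp: localization_def loc_frac_def elim!: quotientE)

lemma loc_frac_mult:
  assumes "a \<in> carrier R" "s \<in> U" "b \<in> carrier R" "t \<in> U"
  shows "loc_frac R U a s \<otimes>\<^bsub>localization R U\<^esub> loc_frac R U b t = loc_frac R U (a \<otimes> b) (s \<otimes> t)"
proof -
  have "(\<lambda>x y. case x of (a, s) \<Rightarrow> case y of (b, t) \<Rightarrow> loc_frac R U (a \<otimes> b) (s \<otimes> t))
          respects2 loc_rel R U"
  proof (rule congruent2I', clarify)
    fix a s a' s' b t b' t'
    assume 1: "((a, s), (a', s')) \<in> loc_rel R U" and 2: "((b, t), (b', t')) \<in> loc_rel R U"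
    then have mem: "a \<in> carrier R" "a' \<in> carrier R" "b \<in> carrier R" "b' \<in> carrier R"
        "s \<in> U" "s' \<in> U" "t \<in> U" "t' \<in> U"
      by (auto simp: loc_rel_def)
    obtain u where u: "u \<in> U" "u \<otimes> (a \<otimes> s') = u \<otimes> (a' \<otimes> s)"
      using 1 by (auto simp: loc_rel_def)
    obtain v where v: "v \<in> U" "v \<otimes> (b \<otimes> t') = v \<otimes> (b' \<otimes> t)"
      using 2 by (auto simp: loc_rel_def)
    have "(u \<otimes> v) \<otimes> ((a \<otimes> b) \<otimes> (s' \<otimes> t')) = (u \<otimes> (a \<otimes> s')) \<otimes> (v \<otimes> (b \<otimes> t'))"
      using mem u(1) v(1) by (simp add: m_ac)
    also have "\<dots> = (u \<otimes> v) \<otimes> ((a' \<otimes> b') \<otimes> (s \<otimes> t))"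
      unfolding u(2) v(2) using mem u(1) v(1) by (simp add: m_ac)
    finally show "loc_frac R U (a \<otimes> b) (s \<otimes> t) = loc_frac R U (a' \<otimes> b') (s' \<otimes> t')"
      using mem u(1) v(1) U_mult by (subst loc_frac_eq_iff) auto
  qed
  from UN_equiv_class2[OF equiv_loc_rel equiv_loc_rel this, of "(a, s)" "(b, t)"] assms
  show ?thesis
    by (simp add: localization_def loc_frac_def[of R U a s] loc_frac_def[of R U b t] split_def)
qed

lemma loc_frac_add:
  assumes "a \<in> carrier R" "s \<in> U" "b \<in> carrier R" "t \<in> U"
  shows "loc_frac R U a s \<oplus>\<^bsub>localization R U\<^esub> loc_frac R U b t
           = loc_frac R U ((a \<otimes> t) \<oplus> (b \<otimes> s)) (s \<otimes> t)"
proof -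
  have "(\<lambda>x y. case x of (a, s) \<Rightarrow> case y of (b, t) \<Rightarrow>
          loc_frac R U ((a \<otimes> t) \<oplus> (b \<otimes> s)) (s \<otimes> t)) respects2 loc_rel R U"
  proof (rule congruent2I', clarify)
    fix a s a' s' b t b' t'
    assume 1: "((a, s), (a', s')) \<in> loc_rel R U" and 2: "((b, t), (b', t')) \<in> loc_rel R U"
    then have mem: "a \<in> carrier R" "a' \<in> carrier R" "b \<in> carrier R" "b' \<in> carrier R"
        "s \<in> U" "s' \<in> U" "t \<in> U" "t' \<in> U"
      by (auto simp: loc_rel_def)
    obtain u where u: "u \<in> U" "u \<otimes> (a \<otimes> s') = u \<otimes> (a' \<otimes> s)"
      using 1 by (auto simp: loc_rel_def)
    obtain v where v: "v \<in> U" "v \<otimes> (b \<otimes> t') = v \<otimes> (b' \<otimes> t)"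
      using 2 by (auto simp: loc_rel_def)
    have "(u \<otimes> v) \<otimes> (((a \<otimes> t) \<oplus> (b \<otimes> s)) \<otimes> (s' \<otimes> t')) =
        (v \<otimes> t \<otimes> t') \<otimes> (u \<otimes> (a \<otimes> s')) \<oplus> (u \<otimes> s \<otimes> s') \<otimes> (v \<otimes> (b \<otimes> t'))"
      using mem u(1) v(1) by (simp add: m_ac l_distr r_distr)
    also have "\<dots> = (u \<otimes> v) \<otimes> (((a' \<otimes> t') \<oplus> (b' \<otimes> s')) \<otimes> (s \<otimes> t))"
      unfolding u(2) v(2) using mem u(1) v(1) by (simp add: m_ac l_distr r_distr)
    finally show "loc_frac R U ((a \<otimes> t) \<oplus> (b \<otimes> s)) (s \<otimes> t)
        = loc_frac R U ((a' \<otimes> t') \<oplus> (b' \<otimes> s')) (s' \<otimes> t')"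
      using mem u(1) v(1) U_mult by (subst loc_frac_eq_iff) auto
  qed
  from UN_equiv_class2[OF equiv_loc_rel equiv_loc_rel this, of "(a, s)" "(b, t)"] assms
  show ?thesis
    by (simp add: localization_def loc_frac_def[of R U a s] loc_frac_def[of R U b t] split_def)
qed

lemma localization_zero: "\<zero>\<^bsub>localization R U\<^esub> = loc_frac R U \<zero> \<one>"
  and localization_one: "\<one>\<^bsub>localization R U\<^esub> = loc_frac R U \<one> \<one>"
  by (simp_all add: localization_def)

lemma cring_localization: "cring (localization R U)"
proof (rule cringI)
  show "abelian_group (localization R U)"
  proof (rule abelian_groupI)
    fix P Q assume "P \<in> carrier (localization R U)" "Q \<in> carrier (localization R U)"
    then show "P \<oplus>\<^bsub>localization R U\<^esub> Q \<in> carrier (localization R U)"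
      by (elim carrier_localization_cases) (simp add: loc_frac_add loc_frac_closed U_mult)
  next
    show "\<zero>\<^bsub>localization R U\<^esub> \<in> carrier (localization R U)"
      by (simp add: localization_zero loc_frac_closed U_one)
  next
    fix P Q W assume "P \<in> carrier (localization R U)" "Q \<in> carrier (localization R U)"
      "W \<in> carrier (localization R U)"
    then show "P \<oplus>\<^bsub>localization R U\<^esub> Q \<oplus>\<^bsub>localization R U\<^esub> W
        = P \<oplus>\<^bsub>localization R U\<^esub> (Q \<oplus>\<^bsub>localization R U\<^esub> W)"
      by (elim carrier_localization_cases)
        (simp add: loc_frac_add U_mult, rule loc_frac_eqI, auto simp: U_mult l_distr r_distr m_ac a_ac)
  next
    fix P Q assume "P \<in> carrier (localization R U)" "Q \<in> carrier (localization R U)"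
    then show "P \<oplus>\<^bsub>localization R U\<^esub> Q = Q \<oplus>\<^bsub>localization R U\<^esub> P"
      by (elim carrier_localization_cases) (simp add: loc_frac_add U_mult m_ac a_ac)
  next
    fix P assume "P \<in> carrier (localization R U)"
    then show "\<zero>\<^bsub>localization R U\<^esub> \<oplus>\<^bsub>localization R U\<^esub> P = P"
      by (elim carrier_localization_cases) (simp add: localization_zero loc_frac_add U_one)
  next
    fix P assume "P \<in> carrier (localization R U)"
    then obtain a s where P: "a \<in> carrier R" "s \<in> U" "P = loc_frac R U a s"
      by (rule carrier_localization_cases)
    have "loc_frac R U (\<ominus> a) s \<oplus>\<^bsub>localization R U\<^esub> P = \<zero>\<^bsub>localization R U\<^esub>"
      using P by (simp add: loc_frac_add localization_zero U_one U_mult, intro loc_frac_eqI)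
        (auto simp: U_mult U_one l_minus l_neg)
    then show "\<exists>Q\<in>carrier (localization R U). Q \<oplus>\<^bsub>localization R U\<^esub> P = \<zero>\<^bsub>localization R U\<^esub>"
      using P loc_frac_closed[of "\<ominus> a" s] by auto
  qed
next
  show "comm_monoid (localization R U)"
  proof (rule comm_monoidI)
    fix P Q assume "P \<in> carrier (localization R U)" "Q \<in> carrier (localization R U)"
    then show "P \<otimes>\<^bsub>localization R U\<^esub> Q \<in> carrier (localization R U)"
      by (elim carrier_localization_cases) (simp add: loc_frac_mult loc_frac_closed U_mult)
  next
    show "\<one>\<^bsub>localization R U\<^esub> \<in> carrier (localization R U)"
      by (simp add: localization_one loc_frac_closed U_one)
  next
    fix P Q W assume "P \<in> carrier (localization R U)" "Q \<in> carrier (localization R U)"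
      "W \<in> carrier (localization R U)"
    then show "P \<otimes>\<^bsub>localization R U\<^esub> Q \<otimes>\<^bsub>localization R U\<^esub> W
        = P \<otimes>\<^bsub>localization R U\<^esub> (Q \<otimes>\<^bsub>localization R U\<^esub> W)"
      by (elim carrier_localization_cases) (simp add: loc_frac_mult U_mult m_ac)
  next
    fix P assume "P \<in> carrier (localization R U)"
    then show "\<one>\<^bsub>localization R U\<^esub> \<otimes>\<^bsub>localization R U\<^esub> P = P"
      by (elim carrier_localization_cases) (simp add: localization_one loc_frac_mult U_one)
  next
    fix P Q assume "P \<in> carrier (localization R U)" "Q \<in> carrier (localization R U)"
    then show "P \<otimes>\<^bsub>localization R U\<^esub> Q = Q \<otimes>\<^bsub>localization R U\<^esub> P"
      by (elim carrier_localization_cases) (simp add: loc_frac_mult U_mult m_ac)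
  qed
next
  fix P Q W assume "P \<in> carrier (localization R U)" "Q \<in> carrier (localization R U)"
    "W \<in> carrier (localization R U)"
  then show "(P \<oplus>\<^bsub>localization R U\<^esub> Q) \<otimes>\<^bsub>localization R U\<^esub> W
      = P \<otimes>\<^bsub>localization R U\<^esub> W \<oplus>\<^bsub>localization R U\<^esub> Q \<otimes>\<^bsub>localization R U\<^esub> W"
    by (elim carrier_localization_cases)
      (simp add: loc_frac_add loc_frac_mult U_mult, rule loc_frac_eqI, auto simp: U_mult l_distr r_distr m_ac)
qed

end

lemma (in primeideal) mult_closed_compl: "mult_closed R (carrier R - I)"
proof
  show "\<one> \<in> carrier R - I" using I_notcarr one_imp_carrier by auto
qed (use I_prime in auto)

lemma (in primeideal) cring_local_at: "cring (local_at R I)"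
  by (rule mult_closed.cring_localization[OF mult_closed_compl])


section \<open>Heights, regular sequences, Cohen-Macaulay rings\<close>

definition prime_chain :: "('a, 'b) ring_scheme \<Rightarrow> 'a set list \<Rightarrow> bool" where
  "prime_chain R ps \<longleftrightarrow> ps \<noteq> [] \<and> (\<forall>p\<in>set ps. primeideal p R) \<and> sorted_wrt (\<subset>) ps"

definition krull_dim :: "('a, 'b) ring_scheme \<Rightarrow> enat" where
  "krull_dim R = (SUP ps\<in>{ps. prime_chain R ps}. enat (length ps - 1))"

definition prime_height :: "('a, 'b) ring_scheme \<Rightarrow> 'a set \<Rightarrow> enat" where
  "prime_height R p = (SUP ps\<in>{ps. prime_chain R ps \<and> last ps = p}. enat (length ps - 1))"

definition height :: "('a, 'b) ring_scheme \<Rightarrow> 'a set \<Rightarrow> enat" where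
  "height R I = (INF p\<in>{p. primeideal p R \<and> I \<subseteq> p}. prime_height R p)"

definition regular_sequence :: "('a, 'b) ring_scheme \<Rightarrow> 'a list \<Rightarrow> bool" where
  "regular_sequence R xs \<longleftrightarrow> set xs \<subseteq> carrier R \<and>
     (\<forall>i<length xs. \<forall>r\<in>carrier R.
        xs ! i \<otimes>\<^bsub>R\<^esub> r \<in> Idl\<^bsub>R\<^esub> (set (take i xs)) \<longrightarrow> r \<in> Idl\<^bsub>R\<^esub> (set (take i xs))) \<and>
     Idl\<^bsub>R\<^esub> (set xs) \<noteq> carrier R"

definition depth :: "('a, 'b) ring_scheme \<Rightarrow> 'a set \<Rightarrow> enat" where
  "depth R J = (SUP xs\<in>{xs. regular_sequence R xs \<and> set xs \<subseteq> J}. enat (length xs))"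

definition cohen_macaulay :: "('a, 'b) ring_scheme \<Rightarrow> bool" where
  "cohen_macaulay R \<longleftrightarrow> cring R \<and> noetherian_ring R \<and>
     (\<forall>n. maximalideal n R \<longrightarrow> depth (local_at R n) (extend_local R n n) = krull_dim (local_at R n))"


section \<open>Associated primes, symbolic powers\<close>

definition colon_ideal :: "('a, 'b) ring_scheme \<Rightarrow> 'a set \<Rightarrow> 'a set \<Rightarrow> 'a set" where
  "colon_ideal R I J = {r \<in> carrier R. \<forall>y\<in>J. r \<otimes>\<^bsub>R\<^esub> y \<in> I}"

text \<open>The primes associated to the module \<open>R/I\<close>: the annihilator of the class of \<open>x\<close> is
  \<open>I : x\<close>.\<close>

definition Ass :: "('a, 'b) ring_scheme \<Rightarrow> 'a set \<Rightarrow> 'a set set" where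
  "Ass R I = {p. primeideal p R \<and> (\<exists>x\<in>carrier R. p = colon_ideal R I {x})}"

definition unmixed :: "('a, 'b) ring_scheme \<Rightarrow> 'a set \<Rightarrow> nat \<Rightarrow> bool" where
  "unmixed R I c \<longleftrightarrow> (\<forall>p\<in>Ass R I. prime_height R p = enat c)"

definition generically_complete_intersection :: "('a, 'b) ring_scheme \<Rightarrow> 'a set \<Rightarrow> bool" where
  "generically_complete_intersection R I \<longleftrightarrow>
     (\<forall>p\<in>Ass R I. \<exists>xs. regular_sequence (local_at R p) xs \<and>
        extend_local R p I = Idl\<^bsub>local_at R p\<^esub> (set xs))"

abbreviation ideal_power :: "('a, 'b) ring_scheme \<Rightarrow> 'a set \<Rightarrow> nat \<Rightarrow> 'a set" where
  "ideal_power R I n \<equiv> I [^]\<^bsub>ideals_set R\<^esub> n"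

definition symbolic_power :: "('a, 'b) ring_scheme \<Rightarrow> 'a set \<Rightarrow> nat \<Rightarrow> 'a set" where
  "symbolic_power R I m =
     carrier R \<inter> (\<Inter>p\<in>Ass R I. contract_local R p (extend_local R p (ideal_power R I m)))"


section \<open>Fitting ideals\<close>

definition matrix_det :: "('a, 'b) ring_scheme \<Rightarrow> nat \<Rightarrow> (nat \<Rightarrow> nat \<Rightarrow> 'a) \<Rightarrow> 'a" where
  "matrix_det R t N = (\<Oplus>\<^bsub>R\<^esub>\<pi>\<in>{\<pi>. \<pi> permutes {..<t}}.
     [sign \<pi>] \<cdot>\<^bsub>R\<^esub> (\<Otimes>\<^bsub>R\<^esub>i\<in>{..<t}. N i (\<pi> i)))"

text \<open>For a \<open>\<mu> \<times> q\<close> matrix \<open>\<phi>\<close>; \<open>r\<close> and \<open>s\<close> select the rows and columns of a minor.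
  The \<open>0 \<times> 0\<close> minor is \<open>\<one>\<close>, and there are no \<open>t\<close>-minors for \<open>t > min \<mu> q\<close>.\<close>

definition minors_ideal ::
  "('a, 'b) ring_scheme \<Rightarrow> nat \<Rightarrow> nat \<Rightarrow> (nat \<Rightarrow> nat \<Rightarrow> 'a) \<Rightarrow> nat \<Rightarrow> 'a set" where
  "minors_ideal R \<mu> q \<phi> t = Idl\<^bsub>R\<^esub> {matrix_det R t (\<lambda>i j. \<phi> (r i) (s j)) |r s.
     strict_mono_on {..<t} r \<and> r ` {..<t} \<subseteq> {..<\<mu>} \<and>
     strict_mono_on {..<t} s \<and> s ` {..<t} \<subseteq> {..<q}}"

text \<open>Exactness of \<open>R\<^sup>q \<rightarrow> R\<^sup>\<mu> \<rightarrow> M \<rightarrow> 0\<close>, where the first map is the matrix \<open>\<phi>\<close> acting on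
  column vectors and the second one sends the basis vectors to \<open>g 0, \<dots>, g (\<mu> - 1)\<close>.\<close>

definition free_presentation ::
  "('a, 'b) ring_scheme \<Rightarrow> ('a, 'm, 'c) module_scheme \<Rightarrow>
   nat \<Rightarrow> nat \<Rightarrow> (nat \<Rightarrow> nat \<Rightarrow> 'a) \<Rightarrow> (nat \<Rightarrow> 'm) \<Rightarrow> bool" where
  "free_presentation R M \<mu> q \<phi> g \<longleftrightarrow>
     (\<forall>i<\<mu>. \<forall>j<q. \<phi> i j \<in> carrier R) \<and> (\<forall>i<\<mu>. g i \<in> carrier M) \<and>
     (\<forall>x\<in>carrier M. \<exists>v\<in>{..<\<mu>} \<rightarrow> carrier R. x = (\<Oplus>\<^bsub>M\<^esub>i\<in>{..<\<mu>}. v i \<odot>\<^bsub>M\<^esub> g i)) \<and>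
     (\<forall>v\<in>{..<\<mu>} \<rightarrow> carrier R.
        (\<Oplus>\<^bsub>M\<^esub>i\<in>{..<\<mu>}. v i \<odot>\<^bsub>M\<^esub> g i) = \<zero>\<^bsub>M\<^esub> \<longleftrightarrow>
        (\<exists>w\<in>{..<q} \<rightarrow> carrier R. \<forall>i<\<mu>. v i = (\<Oplus>\<^bsub>R\<^esub>j\<in>{..<q}. \<phi> i j \<otimes>\<^bsub>R\<^esub> w j)))"

text \<open>The ideal does not depend on the presentation, so an arbitrary one is chosen. For \<open>j \<ge> \<mu>\<close>
  the truncated difference \<open>\<mu> - j\<close> is \<open>0\<close> and the value is \<open>R\<close>.\<close>

definition fitting_ideal ::
  "('a, 'b) ring_scheme \<Rightarrow> ('a, 'm, 'c) module_scheme \<Rightarrow> nat \<Rightarrow> 'a set" where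
  "fitting_ideal R M j =
     (SOME F. \<exists>\<mu> q \<phi> g. free_presentation R M \<mu> q \<phi> g \<and> F = minors_ideal R \<mu> q \<phi> (\<mu> - j))"

text \<open>The fields \<open>mult\<close> and \<open>one\<close> of a module record carry no meaning.\<close>

definition ideal_as_module :: "('a, 'b) ring_scheme \<Rightarrow> 'a set \<Rightarrow> ('a, 'a) module" where
  "ideal_as_module R I =
     \<lparr>carrier = I, monoid.mult = monoid.mult R, monoid.one = \<one>\<^bsub>R\<^esub>,
      ring.zero = \<zero>\<^bsub>R\<^esub>, ring.add = ring.add R, smult = monoid.mult R\<rparr>"

lemma (in cring) module_ideal_as_module:
  assumes "ideal I R"
  shows "module R (ideal_as_module R I)"
proof -
  interpret ideal I R by fact
  show ?thesis
  proof (rule moduleI)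
    show "abelian_group (ideal_as_module R I)"
    proof (rule abelian_groupI)
      fix x assume "x \<in> carrier (ideal_as_module R I)"
      then show "\<exists>y\<in>carrier (ideal_as_module R I).
          y \<oplus>\<^bsub>ideal_as_module R I\<^esub> x = \<zero>\<^bsub>ideal_as_module R I\<^esub>"
        by (intro bexI[of _ "\<ominus> x"]) (auto simp: ideal_as_module_def l_neg)
    qed (auto simp: ideal_as_module_def a_ac)
  qed (auto simp: ideal_as_module_def I_l_closed l_distr r_distr m_assoc is_cring)
qed


section \<open>Gradings\<close>

text \<open>The base field is the degree zero part \<open>A 0\<close>.\<close>

definition positively_graded :: "('a, 'b) ring_scheme \<Rightarrow> (nat \<Rightarrow> 'a set) \<Rightarrow> bool" where
  "positively_graded R A \<longleftrightarrow>
     (\<forall>i. additive_subgroup (A i) R) \<and>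
     (\<forall>i j. \<forall>x\<in>A i. \<forall>y\<in>A j. x \<otimes>\<^bsub>R\<^esub> y \<in> A (i + j)) \<and>
     (\<forall>x\<in>carrier R. \<exists>!f. (\<forall>i. f i \<in> A i) \<and> finite {i. f i \<noteq> \<zero>\<^bsub>R\<^esub>} \<and>
        x = (\<Oplus>\<^bsub>R\<^esub>i\<in>{i. f i \<noteq> \<zero>\<^bsub>R\<^esub>}. f i)) \<and>
     subfield (A 0) R"

definition homogeneous_ideal :: "('a, 'b) ring_scheme \<Rightarrow> (nat \<Rightarrow> 'a set) \<Rightarrow> 'a set \<Rightarrow> bool" where
  "homogeneous_ideal R A I \<longleftrightarrow> ideal I R \<and> I = Idl\<^bsub>R\<^esub> (I \<inter> (\<Union>i. A i))"

text \<open>The infimum over the empty set is \<open>\<infinity>\<close>, the value for \<open>L = 0\<close>.\<close>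

definition initial_degree ::
  "('a, 'b) ring_scheme \<Rightarrow> (nat \<Rightarrow> 'a set) \<Rightarrow> 'a set \<Rightarrow> ereal" where
  "initial_degree R A L = (INF d\<in>{d. \<exists>x\<in>L \<inter> A d. x \<noteq> \<zero>\<^bsub>R\<^esub>}. ereal (real d))"

end

theory Submission
  imports Defs
begin

text \<open>
  Order elements of \<open>S\<close> by the degree of their lowest nonzero component; in a domain orders add
  up under multiplication. Since \<open>I\<^sup>m\<close> has order at least \<open>m \<alpha>(I)\<close>, the first inequality follows
  from \<open>y\<^sup>t x \<in> I\<^sup>m\<close> for \<open>y \<in> F\<^sub>c(I)\<close> of least degree and \<open>x \<in> I\<^sup>(\<^sup>m\<^sup>)\<close>.

  For the second inequality it suffices to find \<open>z\<close> of order at most \<open>\<alpha>(F\<^sub>c(I))\<close> with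
  \<open>z\<^sup>m\<^sup>-\<^sup>1 I\<^sup>(\<^sup>m\<^sup>) \<subseteq> I\<^sup>m\<close>; \<open>z\<close> need not lie in \<open>F\<^sub>c(I)\<close>. Some minor \<open>M\<close> of a presentation has order at
  most \<open>\<alpha>(F\<^sub>c(I))\<close>, and by Cramer's rule it multiplies \<open>I\<close> into an ideal with at most \<open>c\<close> generators.
  Perturbing these generators by elements of high order turns them into a regular sequence, because
  \<open>S\<close> is Cohen-Macaulay, and changes \<open>M\<close> only in high order; this gives \<open>z\<close> with \<open>z I \<subseteq> J\<close>, where
  \<open>J \<subseteq> I\<close> is generated by a regular sequence. Freeness of \<open>J\<^sup>k/J\<^sup>kI\<close> over \<open>S/I\<close> then yields
  \<open>z\<^sup>k I\<^sup>(\<^sup>m\<^sup>) \<subseteq> J\<^sup>k I\<close> by induction on \<open>k < m\<close>. Finally \<open>\<alpha>(F\<^sub>c(I))\<close> is finite as \<open>I\<close> lies in the radical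
  of \<open>F\<^sub>c(I)\<close>.
\<close>

section \<open>Adjoined generators and regular sequences\<close>

text \<open>The presentation behind \<open>fitting_ideal\<close> is an arbitrary choice, so its
  minors need not be homogeneous, and all estimates use the filtration by order. An element has
  order at most \<open>d\<close> when it lies outside \<open>above (Suc d)\<close>; since that set
  is an ideal, one of the generating minors lies outside it as soon as some element of the Fitting
  ideal does, and changing the minor modulo \<open>above (Suc d)\<close> does no harm. The
  perturbation works over any field, because a prime containing some \<open>above N\<close> contains
  \<open>above 1\<close> and with it \<open>I\<close>, so has height at least \<open>c\<close>,
  while primes associated to a regular sequence shorter than \<open>c\<close> have height below
  \<open>c\<close>. That last bound is what the Cohen-Macaulay hypothesis supplies; as the
  hypothesis equates depth and dimension at maximal ideals, extracting it takes a comparison of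
  maximal regular sequences. The exponent \<open>m - 1\<close>, hence the constant in \<open>m
  (\<alpha>(I) - \<alpha>(F)) + \<alpha>(F) = m \<alpha>(I) - (m - 1) \<alpha>(F)\<close>, comes
  from \<open>I^(m)\<close> lying in \<open>I\<close> already: no factor \<open>z\<close> is spent
  on the start of the induction.\<close>

lemma (in ideal) I_minus_closed: "x \<in> I \<Longrightarrow> y \<in> I \<Longrightarrow> x \<ominus> y \<in> I"
  unfolding a_minus_def by (simp add: a_closed a_inv_closed)

text \<open>Closure under negation is multiplication by \<open>\<ominus> \<one>\<close>, and
  absorption on the other side is commutativity, so a subset carved out by a membership condition
  needs only the checks listed here.\<close>

lemma (in cring) ideal_closedI:
  assumes "K \<subseteq> carrier R" "\<zero> \<in> K" "\<And>x y. x \<in> K \<Longrightarrow> y \<in> K \<Longrightarrow> x \<oplus> y \<in> K"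
    and "\<And>x r. x \<in> K \<Longrightarrow> r \<in> carrier R \<Longrightarrow> r \<otimes> x \<in> K"
  shows "ideal K R"
proof (rule idealI[OF ring_axioms])
  show "subgroup K (add_monoid R)"
  proof (rule add.subgroupI)
    fix x assume x: "x \<in> K"
    then have "(\<ominus> \<one>) \<otimes> x \<in> K" using assms(4) by blast
    moreover have "(\<ominus> \<one>) \<otimes> x = \<ominus> x" using x assms(1) by (simp add: l_minus subset_iff)
    ultimately show "\<ominus> x \<in> K" by simp
  qed (use assms in auto)
qed (use assms m_comm in \<open>auto simp: subset_iff\<close>)

lemma (in cring) add_minus_cancel:
  assumes "a \<in> carrier R" "b \<in> carrier R"
  shows "a \<oplus> b \<ominus> a = b" "a \<oplus> b \<ominus> b = a" "(a \<ominus> b) \<oplus> b = a" "b \<oplus> (a \<ominus> b) = a"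
    "a \<ominus> (a \<ominus> b) = b"
proof -
  show 1: "a \<oplus> b \<ominus> b = a" using assms by (simp add: minus_eq a_assoc r_neg)
  show "a \<oplus> b \<ominus> a = b" using assms 1 by (simp add: minus_eq a_comm[of a b] a_assoc r_neg)
  show 2: "(a \<ominus> b) \<oplus> b = a" using assms by (simp add: minus_eq a_assoc l_neg)
  show "b \<oplus> (a \<ominus> b) = a" using assms 2 by (simp add: a_comm)
  show "a \<ominus> (a \<ominus> b) = b" using assms by (simp add: minus_eq minus_add a_assoc[symmetric] r_neg)
qed

context cring
begin

text \<open>The ideal \<open>K + Rx\<close>, given by its elements rather than as a generated ideal,
  so that membership unfolds at once into two coefficients. Iterating it along a list keeps a base
  ideal \<open>K\<close> throughout, which lets inductions enlarge \<open>K\<close> instead of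
  passing to the quotient \<open>R/K\<close>.\<close>

definition adjoin :: "'a set \<Rightarrow> 'a \<Rightarrow> 'a set" where
  "adjoin K x = {k \<oplus> r \<otimes> x |k r. k \<in> K \<and> r \<in> carrier R}"

primrec adjoins :: "'a set \<Rightarrow> 'a list \<Rightarrow> 'a set" where
  "adjoins K [] = K"
| "adjoins K (x # xs) = adjoins (adjoin K x) xs"

lemma adjoin_ideal:
  assumes "ideal K R" "x \<in> carrier R"
  shows "ideal (adjoin K x) R"
proof -
  interpret K: ideal K R by fact
  show ?thesis
  proof (rule ideal_closedI)
    show "adjoin K x \<subseteq> carrier R" using assms by (auto simp: adjoin_def)
    show "\<zero> \<in> adjoin K x"
      unfolding adjoin_def using assms K.zero_closed by (force intro: exI[of _ \<zero>])
  next
    fix y z assume "y \<in> adjoin K x" "z \<in> adjoin K x"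
    then obtain k r l s where *: "k \<in> K" "r \<in> carrier R" "y = k \<oplus> r \<otimes> x"
      "l \<in> K" "s \<in> carrier R" "z = l \<oplus> s \<otimes> x" by (auto simp: adjoin_def)
    have "y \<oplus> z = (k \<oplus> l) \<oplus> (r \<oplus> s) \<otimes> x"
      using * assms by (simp add: K.Icarr l_distr a_ac)
    then show "y \<oplus> z \<in> adjoin K x" using * K.a_closed unfolding adjoin_def by blast
  next
    fix y t assume "y \<in> adjoin K x" and t: "t \<in> carrier R"
    then obtain k r where *: "k \<in> K" "r \<in> carrier R" "y = k \<oplus> r \<otimes> x" by (auto simp: adjoin_def)
    have "t \<otimes> y = t \<otimes> k \<oplus> (t \<otimes> r) \<otimes> x"
      using * assms t by (simp add: K.Icarr r_distr m_assoc)
    then show "t \<otimes> y \<in> adjoin K x" using * t K.I_l_closed unfolding adjoin_def by blast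
  qed
qed

lemma adjoin_subset:
  assumes "ideal K R" "x \<in> carrier R"
  shows "K \<subseteq> adjoin K x"
proof
  fix k assume "k \<in> K"
  then have "k = k \<oplus> \<zero> \<otimes> x" using assms ideal.Icarr[OF assms(1)] by simp
  then show "k \<in> adjoin K x" using \<open>k \<in> K\<close> unfolding adjoin_def by blast
qed

lemma mem_adjoin:
  assumes "ideal K R" "x \<in> carrier R"
  shows "x \<in> adjoin K x"
proof -
  have "x = \<zero> \<oplus> \<one> \<otimes> x" using assms by simp
  moreover have "\<zero> \<in> K" using assms(1) by (simp add: additive_subgroup.zero_closed ideal.axioms(1))
  ultimately show ?thesis unfolding adjoin_def by blast
qed

lemma adjoin_minimal:
  assumes "ideal L R" "K \<subseteq> L" "x \<in> L"
  shows "adjoin K x \<subseteq> L"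
proof -
  interpret L: ideal L R by fact
  show ?thesis using assms by (auto simp: adjoin_def intro!: L.a_closed L.I_l_closed)
qed

lemma adjoins_ideal: "ideal K R \<Longrightarrow> set xs \<subseteq> carrier R \<Longrightarrow> ideal (adjoins K xs) R"
  by (induction xs arbitrary: K) (auto simp: adjoin_ideal)

lemma adjoins_subset: "ideal K R \<Longrightarrow> set xs \<subseteq> carrier R \<Longrightarrow> K \<subseteq> adjoins K xs"
proof (induction xs arbitrary: K)
  case (Cons x xs)
  then have "adjoin K x \<subseteq> adjoins (adjoin K x) xs" using adjoin_ideal by simp
  then show ?case using adjoin_subset[of K x] Cons.prems by auto
qed simp

lemma set_adjoins: "ideal K R \<Longrightarrow> set xs \<subseteq> carrier R \<Longrightarrow> set xs \<subseteq> adjoins K xs"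
proof (induction xs arbitrary: K)
  case (Cons x xs)
  then have "adjoin K x \<subseteq> adjoins (adjoin K x) xs" using adjoin_ideal adjoins_subset by simp
  then show ?case using mem_adjoin[of K x] adjoin_ideal Cons by auto
qed simp

lemma adjoins_minimal:
  "ideal L R \<Longrightarrow> K \<subseteq> L \<Longrightarrow> set xs \<subseteq> L \<Longrightarrow> adjoins K xs \<subseteq> L"
  by (induction xs arbitrary: K) (auto simp: adjoin_minimal)

lemma adjoins_append: "adjoins K (xs @ ys) = adjoins (adjoins K xs) ys"
  by (induction xs arbitrary: K) auto

text \<open>The right-hand side sees only the set of the list; every reordering of generators is
  reduced to this.\<close>

lemma adjoins_eq:
  assumes "ideal K R" "set xs \<subseteq> carrier R"
  shows "adjoins K xs = \<Inter>{L. ideal L R \<and> K \<subseteq> L \<and> set xs \<subseteq> L}"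
  using adjoins_ideal[OF assms] adjoins_subset[OF assms] set_adjoins[OF assms] adjoins_minimal
  by blast

lemma adjoins_cong_set:
  assumes "ideal K R" "set xs \<subseteq> carrier R" "set xs = set ys"
  shows "adjoins K xs = adjoins K ys"
  using assms by (simp add: adjoins_eq)

lemma adjoins_zero:
  assumes "set xs \<subseteq> carrier R"
  shows "adjoins {\<zero>} xs = Idl (set xs)"
proof
  show "adjoins {\<zero>} xs \<subseteq> Idl (set xs)"
    using assms genideal_ideal[OF assms] genideal_self[OF assms]
    by (intro adjoins_minimal) (auto simp: additive_subgroup.zero_closed ideal.axioms(1))
  show "Idl (set xs) \<subseteq> adjoins {\<zero>} xs"
    using assms by (intro genideal_minimal adjoins_ideal set_adjoins zeroideal)
qed

lemma adjoin_commute: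
  assumes "ideal K R" "x \<in> carrier R" "y \<in> carrier R"
  shows "adjoin (adjoin K x) y = adjoin (adjoin K y) x"
  using adjoins_cong_set[of K "[x, y]" "[y, x]"] assms by auto

lemma adjoins_adjoin:
  assumes "ideal K R" "set xs \<subseteq> carrier R" "x \<in> carrier R"
  shows "adjoins (adjoin K x) xs = adjoin (adjoins K xs) x"
  using adjoins_cong_set[of K "x # xs" "xs @ [x]"] assms by (auto simp: adjoins_append)

definition regular_on :: "'a set \<Rightarrow> 'a \<Rightarrow> bool" where
  "regular_on K x \<longleftrightarrow> (\<forall>r\<in>carrier R. x \<otimes> r \<in> K \<longrightarrow> r \<in> K)"

text \<open>A weakly regular sequence on \<open>R/K\<close>: the quotient by all of its members may
  vanish, unlike in \<open>regular_sequence\<close>. Where properness matters, it follows from the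
  sequence lying in a proper ideal.\<close>

primrec regular_mod :: "'a set \<Rightarrow> 'a list \<Rightarrow> bool" where
  "regular_mod K [] \<longleftrightarrow> True"
| "regular_mod K (x # xs) \<longleftrightarrow> regular_on K x \<and> regular_mod (adjoin K x) xs"

lemma regular_mod_append:
  "regular_mod K (xs @ ys) \<longleftrightarrow> regular_mod K xs \<and> regular_mod (adjoins K xs) ys"
  by (induction xs arbitrary: K) auto

lemma regular_sequence_imp_regular_mod:
  assumes "regular_sequence R xs"
  shows "regular_mod {\<zero>} xs"
proof -
  have xs: "set xs \<subseteq> carrier R" using assms by (simp add: regular_sequence_def)
  have "regular_mod {\<zero>} (take i xs)" if "i \<le> length xs" for i
    using that
  proof (induction i)
    case (Suc i)
    have sub: "set (take i xs) \<subseteq> carrier R" using xs by (auto dest: in_set_takeD)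
    have "regular_on (Idl (set (take i xs))) (xs ! i)"
      using assms Suc.prems unfolding regular_sequence_def regular_on_def by simp
    then show ?case
      using Suc by (simp add: take_Suc_conv_app_nth regular_mod_append adjoins_zero[OF sub])
  qed simp
  from this[of "length xs"] show ?thesis by simp
qed

text \<open>From \<open>x r = k + s c\<close> with \<open>k\<close> in \<open>K\<close>, regularity
  of \<open>c\<close> modulo \<open>K + Rx\<close> makes \<open>s\<close> a multiple
  \<open>t x\<close> modulo \<open>K\<close>; then \<open>x (r - t c)\<close> lies in
  \<open>K\<close>, and \<open>x\<close> cancels.\<close>

lemma regular_on_swap:
  assumes "ideal K R" "x \<in> carrier R" "c \<in> carrier R"
    and "regular_on K x" "regular_on (adjoin K x) c"
  shows "regular_on (adjoin K c) x"
  unfolding regular_on_def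
proof (intro ballI impI)
  interpret K: ideal K R by fact
  fix r assume r: "r \<in> carrier R" and "x \<otimes> r \<in> adjoin K c"
  then obtain k s where ks: "k \<in> K" "s \<in> carrier R" "x \<otimes> r = k \<oplus> s \<otimes> c"
    by (auto simp: adjoin_def)
  have k: "k \<in> carrier R" using ks K.Icarr by blast
  have "c \<otimes> s = \<ominus> k \<oplus> r \<otimes> x"
  proof -
    have "c \<otimes> s = (k \<oplus> s \<otimes> c) \<ominus> k" using k ks(2) assms(3) by (simp add: add_minus_cancel m_comm)
    also have "\<dots> = \<ominus> k \<oplus> r \<otimes> x" unfolding ks(3)[symmetric] using k r assms(2)
      by (simp add: minus_eq a_comm m_comm)
    finally show ?thesis .
  qed
  then have "c \<otimes> s \<in> adjoin K x" using K.a_inv_closed[OF ks(1)] r unfolding adjoin_def by blast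
  then have "s \<in> adjoin K x" using assms(5) ks(2) unfolding regular_on_def by blast
  then obtain l t where lt: "l \<in> K" "t \<in> carrier R" "s = l \<oplus> t \<otimes> x" by (auto simp: adjoin_def)
  have l: "l \<in> carrier R" using lt K.Icarr by blast
  have "x \<otimes> (r \<ominus> t \<otimes> c) = (k \<oplus> s \<otimes> c) \<ominus> x \<otimes> (t \<otimes> c)"
    unfolding ks(3)[symmetric] using assms r lt(2) by (simp add: minus_eq r_distr r_minus)
  also have "\<dots> = k \<oplus> l \<otimes> c \<oplus> x \<otimes> (t \<otimes> c) \<ominus> x \<otimes> (t \<otimes> c)"
    unfolding lt(3) using k l lt(2) assms by (simp add: l_distr m_assoc a_assoc m_lcomm)
  also have "\<dots> = k \<oplus> c \<otimes> l" using k l lt(2) assms by (simp add: add_minus_cancel m_comm)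
  also have "\<dots> \<in> K" using ks(1) lt(1) assms(3) by (simp add: K.I_l_closed)
  finally have *: "r \<ominus> t \<otimes> c \<in> K" using assms(4) r lt(2) assms(3) unfolding regular_on_def by simp
  have "r = (r \<ominus> t \<otimes> c) \<oplus> t \<otimes> c" using r lt(2) assms(3) by (simp add: add_minus_cancel)
  then show "r \<in> adjoin K c" using * lt(2) unfolding adjoin_def by blast
qed

text \<open>The element \<open>c\<close> travels to the front past one member of the list at a time,
  each time by \<open>regular_on_swap\<close>; this is why \<open>c\<close> has to be regular modulo
  every initial segment.\<close>

lemma regular_mod_move:
  assumes "ideal K R" "set xs \<subseteq> carrier R" "c \<in> carrier R" "regular_mod K xs"
    and "\<And>j. j \<le> length xs \<Longrightarrow> regular_on (adjoins K (take j xs)) c"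
  shows "regular_mod (adjoin K c) xs"
  using assms
proof (induction xs arbitrary: K)
  case (Cons x xs)
  have x: "x \<in> carrier R" using Cons.prems by simp
  have 1: "regular_on (adjoin K x) c" using Cons.prems(5)[of 1] by simp
  have "regular_on (adjoins (adjoin K x) (take j xs)) c" if "j \<le> length xs" for j
    using Cons.prems(5)[of "Suc j"] that by simp
  then have "regular_mod (adjoin (adjoin K x) c) xs"
    using Cons.IH[of "adjoin K x"] Cons.prems adjoin_ideal x by simp
  then show ?case
    using regular_on_swap[of K x c] Cons.prems 1 adjoin_commute[of K x c] by simp
qed simp

end

section \<open>Associated primes of Noetherian rings and prime avoidance\<close>

locale noetherian_cring = noetherian_ring + cring

lemma (in cring) prime_ideal_mult_iff:
  assumes "primeideal p R" "x \<in> carrier R" "y \<in> carrier R"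
  shows "x \<otimes> y \<in> p \<longleftrightarrow> x \<in> p \<or> y \<in> p"
proof -
  interpret p: primeideal p R by fact
  show ?thesis using p.I_prime assms p.I_l_closed p.I_r_closed by blast
qed

lemma (in cring) colon_ideal_ideal:
  assumes "ideal K R" "z \<in> carrier R"
  shows "ideal (colon_ideal R K {z}) R"
proof -
  interpret K: ideal K R by fact
  show ?thesis
    by (rule ideal_closedI) (use assms in \<open>auto simp: colon_ideal_def l_distr m_assoc K.I_l_closed\<close>)
qed

lemma in_colon_ideal_iff:
  "r \<in> colon_ideal R K {z} \<longleftrightarrow> r \<in> carrier R \<and> r \<otimes>\<^bsub>R\<^esub> z \<in> K"
  by (simp add: colon_ideal_def)

context noetherian_cring
begin

lemma maximal_ideal_in_family:
  assumes "\<And>K. K \<in> C \<Longrightarrow> ideal K R" "C \<noteq> {}"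
  shows "\<exists>M\<in>C. \<forall>N\<in>C. M \<subseteq> N \<longrightarrow> N = M"
proof (rule subset_Zorn_nonempty[OF assms(2)])
  fix F assume F: "F \<noteq> {}" "subset.chain C F"
  then have "subset.chain {K. ideal K R} F" using assms(1) by (auto simp: subset.chain_def)
  then have "\<Union> F \<in> F" using ideal_chain_is_trivial F(1) by blast
  then show "\<Union> F \<in> C" using F(2) by (auto simp: subset.chain_def)
qed

lemma exists_maximalideal:
  assumes "ideal K R" "K \<noteq> carrier R"
  obtains M where "maximalideal M R" "K \<subseteq> M"
proof -
  obtain M where M: "ideal M R" "K \<subseteq> M" "M \<noteq> carrier R"
    and max: "\<And>L. ideal L R \<Longrightarrow> K \<subseteq> L \<Longrightarrow> L \<noteq> carrier R \<Longrightarrow> M \<subseteq> L \<Longrightarrow> L = M"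
  proof -
    let ?C = "{L. ideal L R \<and> K \<subseteq> L \<and> L \<noteq> carrier R}"
    have "K \<in> ?C" using assms by simp
    then have "?C \<noteq> {}" by blast
    then have "\<exists>M\<in>?C. \<forall>L\<in>?C. M \<subseteq> L \<longrightarrow> L = M"
      by (intro maximal_ideal_in_family) auto
    then obtain M where "M \<in> ?C" "\<forall>L\<in>?C. M \<subseteq> L \<longrightarrow> L = M" by (rule bexE)
    then show thesis using that[of M] by auto
  qed
  have "maximalideal M R"
  proof (rule maximalidealI[OF M(1)])
    fix J assume J: "ideal J R" "M \<subseteq> J" "J \<subseteq> carrier R"
    then show "J = M \<or> J = carrier R" using max[of J] M by blast
  qed (use M in auto)
  then show ?thesis using that M by blast
qed

text \<open>A maximal member \<open>K : z\<close> among the proper annihilators above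
  \<open>K : x\<close> is prime: if \<open>a b\<close> kills \<open>z\<close> modulo
  \<open>K\<close> but \<open>b\<close> does not, then \<open>K : b z\<close> is again proper and
  contains \<open>K : z\<close>, so the two coincide, and \<open>a\<close> lies in the
  former.\<close>

lemma colon_ideal_subset_Ass:
  assumes K: "ideal K R" and x: "x \<in> carrier R" "x \<notin> K"
  obtains p where "p \<in> Ass R K" "colon_ideal R K {x} \<subseteq> p"
proof -
  interpret K: ideal K R by fact
  let ?C = "{colon_ideal R K {z} |z. z \<in> carrier R \<and> z \<notin> K \<and> colon_ideal R K {x} \<subseteq> colon_ideal R K {z}}"
  have "\<exists>M\<in>?C. \<forall>L\<in>?C. M \<subseteq> L \<longrightarrow> L = M"
    by (rule maximal_ideal_in_family) (use colon_ideal_ideal[OF K] x in auto)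
  then obtain M where "M \<in> ?C" and max: "\<forall>L\<in>?C. M \<subseteq> L \<longrightarrow> L = M" by (rule bexE)
  then obtain z where z: "z \<in> carrier R" "z \<notin> K" "M = colon_ideal R K {z}" "colon_ideal R K {x} \<subseteq> M"
    by auto
  have "primeideal M R"
  proof (rule primeidealI)
    show "ideal M R" using colon_ideal_ideal[OF K] z by simp
    show "cring R" by (rule cring_axioms)
    show "carrier R \<noteq> M"
      using z one_closed by (metis in_colon_ideal_iff l_one)
    fix a b assume ab: "a \<in> carrier R" "b \<in> carrier R" "a \<otimes> b \<in> M"
    show "a \<in> M \<or> b \<in> M"
    proof (cases "b \<otimes> z \<in> K")
      case True then show ?thesis using ab z by (simp add: in_colon_ideal_iff)
    next
      case False
      have sub: "M \<subseteq> colon_ideal R K {b \<otimes> z}"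
      proof
        fix r assume "r \<in> M"
        then have r: "r \<in> carrier R" "r \<otimes> z \<in> K" using z by (auto simp: in_colon_ideal_iff)
        have "r \<otimes> (b \<otimes> z) = b \<otimes> (r \<otimes> z)" using r ab z by (simp add: m_ac)
        then show "r \<in> colon_ideal R K {b \<otimes> z}"
          using r ab by (simp add: in_colon_ideal_iff K.I_l_closed)
      qed
      then have "colon_ideal R K {b \<otimes> z} \<in> ?C" using False z ab by blast
      then have "colon_ideal R K {b \<otimes> z} = M" using max sub by blast
      moreover have "a \<in> colon_ideal R K {b \<otimes> z}"
        using ab z by (simp add: in_colon_ideal_iff m_assoc)
      ultimately show ?thesis by blast
    qed
  qed
  then have "M \<in> Ass R K" using z unfolding Ass_def by blast
  then show ?thesis using that z by blast
qed

lemma Ass_nonempty: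
  assumes "ideal K R" "K \<noteq> carrier R"
  obtains p where "p \<in> Ass R K"
proof -
  have "\<one> \<notin> K" using assms ideal.one_imp_carrier by blast
  then show ?thesis using colon_ideal_subset_Ass[OF assms(1), of \<one>] that by auto
qed

lemma Ass_subset:
  assumes "ideal K R" "p \<in> Ass R K"
  shows "K \<subseteq> p"
proof -
  interpret K: ideal K R by fact
  show ?thesis using assms(2) by (auto simp: Ass_def colon_ideal_def K.Icarr intro: K.I_r_closed)
qed

lemma Ass_not_regular:
  assumes "ideal K R" "p \<in> Ass R K" "x \<in> p"
  shows "\<not> regular_on K x"
proof -
  obtain z where z: "z \<in> carrier R" "p = colon_ideal R K {z}" "primeideal p R"
    using assms(2) by (auto simp: Ass_def)
  have "x \<in> carrier R" "x \<otimes> z \<in> K" using assms(3) z by (auto simp: in_colon_ideal_iff)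
  moreover have "z \<notin> K"
  proof
    assume "z \<in> K"
    then have "\<one> \<in> p" using z(1,2) by (simp add: in_colon_ideal_iff)
    then show False
      using z(3) primeideal.I_notcarr[OF z(3)] ideal.one_imp_carrier[OF primeideal.axioms(1)[OF z(3)]]
      by blast
  qed
  ultimately show ?thesis using z(1) unfolding regular_on_def by blast
qed

lemma not_regular_imp_Ass:
  assumes "ideal K R" "x \<in> carrier R" "\<not> regular_on K x"
  obtains p where "p \<in> Ass R K" "x \<in> p"
proof -
  obtain r where r: "r \<in> carrier R" "x \<otimes> r \<in> K" "r \<notin> K" using assms(3) by (auto simp: regular_on_def)
  obtain p where p: "p \<in> Ass R K" "colon_ideal R K {r} \<subseteq> p"
    by (rule colon_ideal_subset_Ass[OF assms(1) r(1,3)])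
  have "x \<in> colon_ideal R K {r}" using assms(2) r(2) by (simp add: in_colon_ideal_iff)
  then show ?thesis using p by (intro that[of p]) auto
qed

text \<open>Noetherian induction along \<open>0 -> R/p -> R/L -> R/(L + Rz) -> 0\<close>, where
  \<open>p = L : z\<close> is associated to \<open>L\<close>: every associated prime of
  \<open>L\<close> is \<open>p\<close> or is associated to the larger ideal \<open>L + Rz\<close>,
  so no maximal counterexample \<open>L\<close> exists.\<close>

lemma finite_Ass:
  assumes "ideal K R"
  shows "finite (Ass R K)"
proof (rule ccontr)
  assume "infinite (Ass R K)"
  then have ne: "{L. ideal L R \<and> infinite (Ass R L)} \<noteq> {}" using assms by blast
  obtain L where L: "ideal L R" "infinite (Ass R L)"
    and max: "\<And>M. ideal M R \<Longrightarrow> infinite (Ass R M) \<Longrightarrow> L \<subseteq> M \<Longrightarrow> M = L"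
    using maximal_ideal_in_family[OF _ ne] by auto
  interpret L: ideal L R by fact
  obtain p where p: "p \<in> Ass R L" using L(2) by fastforce
  then obtain z where z: "z \<in> carrier R" "p = colon_ideal R L {z}" "primeideal p R"
    by (auto simp: Ass_def)
  interpret p: primeideal p R by fact
  have zL: "z \<notin> L"
  proof
    assume "z \<in> L"
    then have "\<one> \<in> p" using z(1,2) by (simp add: in_colon_ideal_iff)
    then show False using p.one_imp_carrier p.I_notcarr by blast
  qed
  have "Ass R L \<subseteq> insert p (Ass R (adjoin L z))"
  proof
    fix q assume q: "q \<in> Ass R L"
    then obtain w where w: "w \<in> carrier R" "q = colon_ideal R L {w}" "primeideal q R"
      by (auto simp: Ass_def)
    interpret q: primeideal q R by fact
    show "q \<in> insert p (Ass R (adjoin L z))"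
    proof (cases "colon_ideal R (adjoin L z) {w} \<subseteq> q")
      case True
      then have "q = colon_ideal R (adjoin L z) {w}"
        using adjoin_subset[OF L(1) z(1)] w(2) by (auto simp: in_colon_ideal_iff)
      then show ?thesis using w by (auto simp: Ass_def)
    next
      \<comment> \<open>Now a multiple \<open>r w\<close> with \<open>r\<close> outside
        \<open>q\<close> agrees modulo \<open>L\<close> with an element \<open>s z\<close> of the
        copy of \<open>R/p\<close>. Nonzero elements of \<open>R/q\<close> have annihilator
        \<open>q\<close> and nonzero elements of \<open>R/p\<close> have annihilator
        \<open>p\<close>; comparing the two descriptions of the same class gives
        \<open>q = p\<close>.\<close>
      case False
      then obtain r where r: "r \<in> carrier R" "r \<otimes> w \<in> adjoin L z" "r \<notin> q"
        using in_colon_ideal_iff by (metis subsetI)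
      then obtain l s where ls: "l \<in> L" "s \<in> carrier R" "r \<otimes> w = l \<oplus> s \<otimes> z" by (auto simp: adjoin_def)
      have eq: "t \<otimes> (r \<otimes> w) \<in> L \<longleftrightarrow> t \<otimes> (s \<otimes> z) \<in> L" if t: "t \<in> carrier R" for t
      proof -
        have "t \<otimes> (r \<otimes> w) = t \<otimes> l \<oplus> t \<otimes> (s \<otimes> z)"
          unfolding ls(3) using ls t z(1) L.Icarr by (simp add: r_distr)
        moreover have "t \<otimes> l \<in> L" using t ls L.I_l_closed by blast
        moreover have "t \<otimes> (s \<otimes> z) \<in> carrier R" using t ls z by simp
        moreover have "t \<otimes> l \<oplus> t \<otimes> (s \<otimes> z) \<ominus> t \<otimes> l = t \<otimes> (s \<otimes> z)"
          using ls t z(1) L.Icarr by (simp add: add_minus_cancel)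
        ultimately show ?thesis by (metis L.a_closed L.I_minus_closed)
      qed
      have 1: "t \<otimes> (r \<otimes> w) \<in> L \<longleftrightarrow> t \<in> q" if t: "t \<in> carrier R" for t
      proof -
        have "t \<otimes> (r \<otimes> w) \<in> L \<longleftrightarrow> t \<otimes> r \<in> colon_ideal R L {w}"
          using t r w by (simp add: in_colon_ideal_iff m_assoc)
        then show ?thesis using prime_ideal_mult_iff[OF w(3) t r(1)] r(3) w(2) by simp
      qed
      have sp: "s \<notin> p"
      proof
        assume "s \<in> p"
        then have "\<one> \<otimes> (s \<otimes> z) \<in> L" using z ls by (simp add: in_colon_ideal_iff)
        then have "\<one> \<in> q" using eq 1 by blast
        then show False using q.one_imp_carrier q.I_notcarr by blast
      qed
      have 2: "t \<otimes> (s \<otimes> z) \<in> L \<longleftrightarrow> t \<in> p" if t: "t \<in> carrier R" for t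
      proof -
        have "t \<otimes> (s \<otimes> z) \<in> L \<longleftrightarrow> t \<otimes> s \<in> colon_ideal R L {z}"
          using t ls(2) z(1) by (simp add: in_colon_ideal_iff m_assoc)
        then show ?thesis using prime_ideal_mult_iff[OF z(3) t ls(2)] sp z(2) by simp
      qed
      have "t \<in> q \<longleftrightarrow> t \<in> p" for t
        using eq[of t] 1[of t] 2[of t] p.Icarr[of t] q.Icarr[of t] by metis
      then have "q = p" by blast
      then show ?thesis by simp
    qed
  qed
  moreover have "finite (Ass R (adjoin L z))"
    using max[of "adjoin L z"] adjoin_ideal[OF L(1) z(1)] adjoin_subset[OF L(1) z(1)]
      mem_adjoin[OF L(1) z(1)] zL by blast
  ultimately show False using L(2) finite_subset by blast
qed

end

text \<open>Multiply an element of \<open>K\<close> outside \<open>p\<close> by one element of each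
  \<open>q\<close> outside \<open>p\<close>; primality keeps the product outside
  \<open>p\<close>.\<close>

lemma (in cring) inter_primes_avoid:
  assumes "finite Q" "\<And>q. q \<in> Q \<Longrightarrow> ideal q R" "\<And>q. q \<in> Q \<Longrightarrow> \<not> q \<subseteq> p"
    and "ideal K R" "\<not> K \<subseteq> p" and p: "primeideal p R"
  obtains e where "e \<in> K" "\<And>q. q \<in> Q \<Longrightarrow> e \<in> q" "e \<notin> p"
proof -
  have "\<exists>e. e \<in> K \<and> (\<forall>q\<in>Q. e \<in> q) \<and> e \<notin> p"
    using assms(1-3)
  proof (induction Q rule: finite_induct)
    case empty then show ?case using assms(5) by auto
  next
    case (insert q Q)
    then obtain e where e: "e \<in> K" "\<forall>q\<in>Q. e \<in> q" "e \<notin> p" by auto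
    obtain f where f: "f \<in> q" "f \<notin> p" using insert.prems by blast
    have carr: "e \<in> carrier R" "f \<in> carrier R"
      using ideal.Icarr[OF assms(4) e(1)] ideal.Icarr[OF insert.prems(1)[of q] f(1)] by auto
    have "e \<otimes> f \<in> K" using ideal.I_r_closed[OF assms(4)] e carr by blast
    moreover have "e \<otimes> f \<in> q'" if "q' \<in> insert q Q" for q'
      using that e(2) f(1) carr ideal.I_r_closed[OF insert.prems(1)[OF that]]
        ideal.I_l_closed[OF insert.prems(1)[OF that]] by (cases "q' = q") auto
    moreover have "e \<otimes> f \<notin> p" using prime_ideal_mult_iff[OF p] carr e f by blast
    ultimately show ?case by (intro exI[of _ "e \<otimes> f"]) simp
  qed
  then show ?thesis using that by blast
qed

text \<open>Prime avoidance on a coset, by removing a minimal member \<open>p\<close> of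
  \<open>P\<close>. A \<open>k\<close> that works for the other primes may fail at \<open>p\<close>;
  it is then corrected by an element of \<open>K\<close> in all the other primes but not in
  \<open>p\<close>, which exists since minimality keeps each of them from lying inside
  \<open>p\<close>. With \<open>f = \<zero>\<close> this is the usual prime avoidance.\<close>

lemma (in cring) coset_prime_avoidance:
  assumes "finite P" "\<And>p. p \<in> P \<Longrightarrow> primeideal p R" "ideal K R" "f \<in> carrier R"
    and "\<And>p. p \<in> P \<Longrightarrow> f \<in> p \<Longrightarrow> \<not> K \<subseteq> p"
  obtains k where "k \<in> K" "\<And>p. p \<in> P \<Longrightarrow> f \<oplus> k \<notin> p"
proof -
  interpret K: ideal K R by fact
  have "\<exists>k\<in>K. \<forall>p\<in>P. f \<oplus> k \<notin> p"
    using assms(1,2,5)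
  proof (induction P rule: finite_psubset_induct)
    case (psubset P)
    show ?case
    proof (cases "P = {}")
      case False
      then obtain p where p: "p \<in> P" "\<And>q. q \<in> P \<Longrightarrow> q \<subseteq> p \<Longrightarrow> q = p"
        using finite_has_minimal[OF psubset.hyps] by metis
      interpret p: primeideal p R using psubset.prems p by blast
      have "P - {p} \<subset> P" using p by blast
      then obtain k where k: "k \<in> K" "\<forall>q\<in>P - {p}. f \<oplus> k \<notin> q"
        using psubset.IH[of "P - {p}"] psubset.prems by auto
      have kc: "k \<in> carrier R" using k K.Icarr by blast
      show ?thesis
      proof (cases "f \<oplus> k \<in> p")
        case False then show ?thesis using k by blast
      next
        case True
        have "\<not> K \<subseteq> p"
        proof
          assume "K \<subseteq> p"
          then have "(f \<oplus> k) \<ominus> k \<in> p" using True k p.I_minus_closed by blast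
          moreover have "(f \<oplus> k) \<ominus> k = f" using assms(4) kc by (simp add: add_minus_cancel)
          ultimately show False using psubset.prems(2)[OF p(1)] \<open>K \<subseteq> p\<close> by simp
        qed
        moreover have "finite (P - {p})" using psubset.hyps by blast
        moreover have "ideal q R" if "q \<in> P - {p}" for q
          using psubset.prems(1)[of q] that primeideal.axioms(1) by blast
        moreover have "\<not> q \<subseteq> p" if "q \<in> P - {p}" for q
          using p(2)[of q] that by blast
        ultimately obtain e where e: "e \<in> K" "\<And>q. q \<in> P - {p} \<Longrightarrow> e \<in> q" "e \<notin> p"
          using inter_primes_avoid[of "P - {p}" p K] assms(3) p.primeideal by metis
        have ec: "e \<in> carrier R" using e K.Icarr by blast
        have "f \<oplus> (k \<oplus> e) \<notin> q" if q: "q \<in> P" for q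
        proof
          assume *: "f \<oplus> (k \<oplus> e) \<in> q"
          interpret q: primeideal q R using psubset.prems q by blast
          show False
          proof (cases "q = p")
            case True
            have "f \<oplus> (k \<oplus> e) \<ominus> (f \<oplus> k) \<in> p" using * True \<open>f \<oplus> k \<in> p\<close> p.I_minus_closed by blast
            moreover have "f \<oplus> (k \<oplus> e) \<ominus> (f \<oplus> k) = e"
              using assms(4) kc ec by (simp add: add_minus_cancel a_assoc[symmetric])
            ultimately show False using e by simp
          next
            case False
            then have "f \<oplus> (k \<oplus> e) \<ominus> e \<in> q" using * e q q.I_minus_closed by blast
            moreover have "f \<oplus> (k \<oplus> e) \<ominus> e = f \<oplus> k"
              using assms(4) kc ec by (simp add: add_minus_cancel a_assoc[symmetric])
            ultimately show False using k q False by simp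
          qed
        qed
        moreover have "k \<oplus> e \<in> K" using k e by simp
        ultimately show ?thesis by blast
      qed
    next
      case True then show ?thesis using K.zero_closed by blast
    qed
  qed
  then show ?thesis using that by blast
qed

section \<open>Exchange of regular sequences\<close>

lemma (in cring) diff_eq_diff:
  assumes "a \<in> carrier R" "b \<in> carrier R" "c \<in> carrier R" "d \<in> carrier R" "a \<oplus> b = c \<oplus> d"
  shows "b \<ominus> d = c \<ominus> a"
proof -
  have "b \<ominus> d = (a \<oplus> b) \<ominus> a \<ominus> d" using assms(1-2) by (simp add: add_minus_cancel)
  also have "\<dots> = (c \<oplus> d) \<ominus> a \<ominus> d" using assms(5) by simp
  also have "\<dots> = (c \<ominus> a) \<oplus> d \<ominus> d" using assms(1,3,4) by (simp add: minus_eq a_ac)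
  also have "\<dots> = c \<ominus> a" using assms(1,3,4) by (simp add: add_minus_cancel)
  finally show ?thesis .
qed

context cring
begin

lemma regular_onD: "regular_on K x \<Longrightarrow> x \<otimes> r \<in> K \<Longrightarrow> r \<in> carrier R \<Longrightarrow> r \<in> K"
  by (simp add: regular_on_def)

lemma regular_mod_nth:
  "regular_mod K xs \<Longrightarrow> j < length xs \<Longrightarrow> regular_on (adjoins K (take j xs)) (xs ! j)"
proof (induction xs arbitrary: K j)
  case (Cons x xs)
  then show ?case by (cases j) auto
qed simp

lemma regular_mod_take: "regular_mod K xs \<Longrightarrow> regular_mod K (take j xs)"
  by (metis append_take_drop_id regular_mod_append)

text \<open>The ideal \<open>n\<close> has grade zero on \<open>R/K\<close>.\<close>

definition killed :: "'a set \<Rightarrow> 'a set \<Rightarrow> bool" where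
  "killed n K \<longleftrightarrow> (\<exists>z\<in>carrier R. z \<notin> K \<and> (\<forall>e\<in>n. e \<otimes> z \<in> K))"

lemma killed_not_regular:
  assumes "killed n K" "e \<in> n"
  shows "\<not> regular_on K e"
  using assms by (auto simp: killed_def regular_on_def)

text \<open>An elementary form of \<open>Hom(R/n, R/(K + Ra)) = Ext^1(R/n, R/K) = Hom(R/n, R/(K +
  Rb))\<close>. For \<open>z\<close> annihilated by \<open>n\<close> modulo \<open>K + Ra\<close>,
  the element \<open>w\<close> with \<open>b z = w a\<close> modulo \<open>K\<close> is annihilated
  by \<open>n\<close> modulo \<open>K + Rb\<close>; regularity of \<open>b\<close> keeps it out of
  \<open>K + Rb\<close>, regularity of \<open>a\<close> yields the annihilation.\<close>

lemma killed_swap: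
  assumes K: "ideal K R" and n: "ideal n R" and ab: "a \<in> n" "b \<in> n"
    and reg: "regular_on K a" "regular_on K b" and kill: "killed n (adjoin K a)"
  shows "killed n (adjoin K b)"
proof -
  interpret K: ideal K R by fact
  interpret n: ideal n R by fact
  have carr: "a \<in> carrier R" "b \<in> carrier R" using ab n.Icarr by auto
  obtain z where z: "z \<in> carrier R" "z \<notin> adjoin K a" "\<And>e. e \<in> n \<Longrightarrow> e \<otimes> z \<in> adjoin K a"
    using kill by (auto simp: killed_def)
  obtain k w where kw: "k \<in> K" "w \<in> carrier R" "b \<otimes> z = k \<oplus> w \<otimes> a"
    using z(3)[OF ab(2)] by (auto simp: adjoin_def)
  have k: "k \<in> carrier R" using kw K.Icarr by blast
  have "w \<notin> adjoin K b"
  proof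
    assume "w \<in> adjoin K b"
    then obtain l v where lv: "l \<in> K" "v \<in> carrier R" "w = l \<oplus> v \<otimes> b" by (auto simp: adjoin_def)
    have l: "l \<in> carrier R" using lv K.Icarr by blast
    have "b \<otimes> (z \<ominus> v \<otimes> a) = b \<otimes> z \<ominus> b \<otimes> (v \<otimes> a)"
      using carr z lv by (simp add: minus_eq r_distr r_minus)
    also have "\<dots> = (k \<oplus> l \<otimes> a) \<oplus> b \<otimes> (v \<otimes> a) \<ominus> b \<otimes> (v \<otimes> a)"
      unfolding kw(3) lv(3) using carr k l lv(2) by (simp add: l_distr m_assoc m_lcomm a_assoc)
    also have "\<dots> = k \<oplus> l \<otimes> a" using carr k l lv(2) by (simp add: add_minus_cancel)
    also have "\<dots> \<in> K" using kw(1) lv(1) carr by (simp add: K.I_r_closed)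
    finally have "z \<ominus> v \<otimes> a \<in> K" by (rule regular_onD[OF reg(2)]) (use z(1) lv(2) carr in simp)
    moreover have "z = (z \<ominus> v \<otimes> a) \<oplus> v \<otimes> a" using z(1) lv(2) carr by (simp add: add_minus_cancel)
    ultimately have "z \<in> adjoin K a" using lv(2) unfolding adjoin_def by blast
    with z(2) show False by blast
  qed
  moreover have "e \<otimes> w \<in> adjoin K b" if e: "e \<in> n" for e
  proof -
    have ec: "e \<in> carrier R" using e n.Icarr by blast
    obtain l s where ls: "l \<in> K" "s \<in> carrier R" "e \<otimes> z = l \<oplus> s \<otimes> a"
      using z(3)[OF e] by (auto simp: adjoin_def)
    have l: "l \<in> carrier R" using ls K.Icarr by blast
    have "e \<otimes> k \<oplus> a \<otimes> (e \<otimes> w) = e \<otimes> (k \<oplus> w \<otimes> a)"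
      using ec k carr kw(2) by (simp add: r_distr m_ac)
    also have "\<dots> = b \<otimes> (e \<otimes> z)" unfolding kw(3)[symmetric] using ec carr z by (simp add: m_lcomm)
    also have "\<dots> = b \<otimes> l \<oplus> a \<otimes> (b \<otimes> s)" unfolding ls(3) using carr l ls(2) by (simp add: r_distr m_ac)
    finally have "a \<otimes> (e \<otimes> w) \<ominus> a \<otimes> (b \<otimes> s) = b \<otimes> l \<ominus> e \<otimes> k"
      using ec k carr kw(2) l ls(2) by (intro diff_eq_diff) auto
    moreover have "a \<otimes> (e \<otimes> w) \<ominus> a \<otimes> (b \<otimes> s) = a \<otimes> (e \<otimes> w \<ominus> b \<otimes> s)"
      using ec carr kw(2) ls(2) by (simp add: minus_eq r_distr r_minus)
    moreover have "b \<otimes> l \<ominus> e \<otimes> k \<in> K"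
      using K.I_minus_closed K.I_l_closed ls(1) kw(1) carr ec by simp
    ultimately have "a \<otimes> (e \<otimes> w \<ominus> b \<otimes> s) \<in> K" by simp
    then have "e \<otimes> w \<ominus> b \<otimes> s \<in> K"
      by (rule regular_onD[OF reg(1)]) (use ec kw(2) carr ls(2) in simp)
    moreover have "e \<otimes> w = (e \<otimes> w \<ominus> b \<otimes> s) \<oplus> s \<otimes> b"
      using ec kw(2) carr ls(2) by (simp add: add_minus_cancel m_comm)
    ultimately show ?thesis using ls(2) unfolding adjoin_def by blast
  qed
  ultimately show ?thesis unfolding killed_def using kw(2) by blast
qed

end

context noetherian_cring
begin

text \<open>No associated prime of a member of \<open>F\<close> contains \<open>n\<close>, as
  \<open>n\<close> has an element regular on that member; avoiding all of these finitely many primes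
  at once gives \<open>c\<close>.\<close>

lemma common_regular_element:
  assumes "finite F" "\<And>K. K \<in> F \<Longrightarrow> ideal K R" "ideal n R"
    and reg: "\<And>K. K \<in> F \<Longrightarrow> \<exists>e\<in>n. regular_on K e"
  obtains c where "c \<in> n" "\<And>K. K \<in> F \<Longrightarrow> regular_on K c"
proof -
  interpret n: ideal n R by fact
  have "finite (\<Union>K\<in>F. Ass R K)" using assms(1,2) finite_Ass by auto
  moreover have "primeideal p R" if "p \<in> (\<Union>K\<in>F. Ass R K)" for p using that by (auto simp: Ass_def)
  moreover have "\<not> n \<subseteq> p" if p: "p \<in> (\<Union>K\<in>F. Ass R K)" for p
  proof -
    obtain K where K: "K \<in> F" "p \<in> Ass R K" using p by auto
    then obtain e where "e \<in> n" "regular_on K e" using reg by auto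
    then show ?thesis using Ass_not_regular[OF assms(2)[OF K(1)] K(2)] by auto
  qed
  ultimately obtain c where c: "c \<in> n" "\<And>p. p \<in> (\<Union>K\<in>F. Ass R K) \<Longrightarrow> \<zero> \<oplus> c \<notin> p"
    using coset_prime_avoidance[of "\<Union>K\<in>F. Ass R K" n \<zero>] assms(3) zero_closed by metis
  have cc: "c \<in> carrier R" using c n.Icarr by blast
  have "regular_on K c" if K: "K \<in> F" for K
  proof (rule ccontr)
    assume "\<not> regular_on K c"
    then obtain p where "p \<in> Ass R K" "c \<in> p"
      using not_regular_imp_Ass[OF assms(2)[OF K] cc] by blast
    then show False using c(2)[of p] K cc by auto
  qed
  then show ?thesis using that c by blast
qed

text \<open>If \<open>n\<close> consists of zero divisors on \<open>R/K\<close>, prime avoidance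
  puts it inside a single associated prime \<open>K : z\<close>, and \<open>z\<close> is annihilated
  by all of \<open>n\<close>.\<close>

lemma killedI:
  assumes "ideal K R" "ideal n R" "\<And>e. e \<in> n \<Longrightarrow> \<not> regular_on K e"
  shows "killed n K"
proof -
  have "\<exists>p\<in>Ass R K. n \<subseteq> p"
  proof (rule ccontr)
    assume *: "\<not> ?thesis"
    obtain c where c: "c \<in> n" "\<And>p. p \<in> Ass R K \<Longrightarrow> \<zero> \<oplus> c \<notin> p"
      using coset_prime_avoidance[of "Ass R K" n \<zero>] * finite_Ass[OF assms(1)] assms(2) zero_closed
      by (metis (no_types, lifting) Ass_def mem_Collect_eq)
    have cc: "c \<in> carrier R" using c ideal.Icarr[OF assms(2)] by blast
    obtain p where "p \<in> Ass R K" "c \<in> p"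
      using not_regular_imp_Ass[OF assms(1) cc assms(3)[OF c(1)]] by blast
    then show False using c(2)[of p] cc by auto
  qed
  then obtain p where p: "p \<in> Ass R K" "n \<subseteq> p" by blast
  then obtain z where z: "z \<in> carrier R" "p = colon_ideal R K {z}" "primeideal p R"
    by (auto simp: Ass_def)
  have "z \<notin> K"
  proof
    assume "z \<in> K"
    then have "\<one> \<in> p" using z by (simp add: in_colon_ideal_iff)
    then show False using primeideal.I_notcarr[OF z(3)]
        ideal.one_imp_carrier[OF primeideal.axioms(1)[OF z(3)]] by blast
  qed
  moreover have "\<forall>e\<in>n. e \<otimes> z \<in> K" using p(2) z(2) by (auto simp: in_colon_ideal_iff)
  ultimately show ?thesis using z(1) unfolding killed_def by blast
qed

text \<open>Invariance of the length of maximal regular sequences. The last members \<open>a\<close>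
  and \<open>b\<close> are linked by an element \<open>c\<close> that is regular modulo every
  initial segment of both lists: exchange \<open>a\<close> for \<open>c\<close>, move
  \<open>c\<close> to the front, compare the shorter lists modulo \<open>K + Rc\<close> by
  induction, and exchange \<open>c\<close> for \<open>b\<close>.\<close>

lemma killed_exchange:
  assumes "ideal K R" "ideal n R" "set as \<subseteq> n" "set bs \<subseteq> n" "length as = length bs"
    and "regular_mod K as" "regular_mod K bs" "killed n (adjoins K as)"
  shows "killed n (adjoins K bs)"
  using assms
proof (induction as arbitrary: bs K rule: rev_induct)
  case Nil then show ?case by simp
next
  case (snoc a as)
  interpret n: ideal n R by fact
  obtain b bs' where bs: "bs = bs' @ [b]" using snoc.prems(5)
    by (metis append_butlast_last_id length_greater_0_conv length_append_singleton zero_less_Suc)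
  have len: "length as = length bs'" using snoc.prems(5) bs by simp
  have sub: "set as \<subseteq> n" "set bs' \<subseteq> n" "a \<in> n" "b \<in> n" using snoc.prems bs by auto
  have carr: "set as \<subseteq> carrier R" "set bs' \<subseteq> carrier R" "a \<in> carrier R" "b \<in> carrier R"
    using sub n.Icarr by auto
  have tk: "set (take j xs) \<subseteq> carrier R" if "set xs \<subseteq> carrier R" for j and xs :: "'a list"
    using that by (auto dest: in_set_takeD)
  note K = snoc.prems(1)
  have rega: "regular_mod K as" "regular_on (adjoins K as) a"
    using snoc.prems(6) by (simp_all add: regular_mod_append)
  have regb: "regular_mod K bs'" "regular_on (adjoins K bs') b"
    using snoc.prems(7) by (simp_all add: regular_mod_append bs)
  let ?F = "(\<lambda>j. adjoins K (take j as)) ` {..length as} \<union> (\<lambda>j. adjoins K (take j bs')) ` {..length as}"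
  \<comment> \<open>The next member of the regular sequence itself shows that \<open>n\<close>
    contains an element regular modulo each initial segment.\<close>
  have ex: "\<exists>e\<in>n. regular_on (adjoins K (take j xs)) e"
    if "j \<le> length xs" "regular_mod K (xs @ [x])" "set xs \<subseteq> n" "x \<in> n" for j xs x
  proof -
    have "regular_on (adjoins K (take j (xs @ [x]))) ((xs @ [x]) ! j)"
      using regular_mod_nth[OF that(2)] that(1) by simp
    moreover have "(xs @ [x]) ! j \<in> n" using that by (cases "j = length xs") (auto simp: nth_append)
    ultimately show ?thesis using that(1) by auto
  qed
  obtain c where c: "c \<in> n" "\<And>L. L \<in> ?F \<Longrightarrow> regular_on L c"
  proof (rule common_regular_element[of ?F n])
    show "finite ?F" by simp
    show "ideal L R" if "L \<in> ?F" for L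
      using that adjoins_ideal[OF K tk[OF carr(1)]] adjoins_ideal[OF K tk[OF carr(2)]] by auto
    show "ideal n R" by fact
    show "\<exists>e\<in>n. regular_on L e" if L: "L \<in> ?F" for L
    proof -
      obtain j where "j \<le> length as" "L = adjoins K (take j as) \<or> L = adjoins K (take j bs')"
        using L by auto
      then show ?thesis
        using ex[OF _ snoc.prems(6) sub(1,3), of j] ex[of j bs' b] snoc.prems(7) bs sub len by auto
    qed
  qed (rule that)
  have cc: "c \<in> carrier R" using c n.Icarr by blast
  have rc: "regular_on (adjoins K (take j as)) c" "regular_on (adjoins K (take j bs')) c"
    if "j \<le> length as" for j using c(2) that by auto
  have rc': "regular_on (adjoins K as) c" "regular_on (adjoins K bs') c"
    using rc[of "length as"] len by simp_all
  have ida: "ideal (adjoins K as) R" "ideal (adjoins K bs') R"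
    using adjoins_ideal K carr by auto
  have "killed n (adjoin (adjoins K as) c)"
    using killed_swap[OF ida(1) \<open>ideal n R\<close> sub(3) c(1) rega(2) rc'(1)] snoc.prems(8)
    by (simp add: adjoins_append)
  then have 1: "killed n (adjoins (adjoin K c) as)" using adjoins_adjoin K carr cc by simp
  have "killed n (adjoins (adjoin K c) bs')"
  proof (rule snoc.IH)
    show "ideal (adjoin K c) R" using adjoin_ideal K cc by simp
    show "regular_mod (adjoin K c) as"
      by (rule regular_mod_move[OF K carr(1) cc rega(1) rc(1)])
    show "regular_mod (adjoin K c) bs'"
      by (rule regular_mod_move[OF K carr(2) cc regb(1) rc(2)]) (simp add: len)
  qed (use 1 sub len \<open>ideal n R\<close> in auto)
  then have "killed n (adjoin (adjoins K bs') c)" using adjoins_adjoin K carr cc by simp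
  then show ?case
    using killed_swap[OF ida(2) \<open>ideal n R\<close> c(1) sub(4) rc'(2) regb(2)] bs
    by (simp add: adjoins_append)
qed

text \<open>Were every element of \<open>n\<close> a zero divisor modulo \<open>as\<close>, exchange
  would make the same true modulo the first \<open>length as\<close> members of \<open>bs\<close>,
  whose next member is regular.\<close>

lemma regular_mod_extend_one:
  assumes "ideal K R" "ideal n R" "set as \<subseteq> n" "set bs \<subseteq> n" "length as < length bs"
    and "regular_mod K as" "regular_mod K bs"
  shows "\<exists>e\<in>n. regular_on (adjoins K as) e"
proof (rule ccontr)
  assume *: "\<not> ?thesis"
  interpret n: ideal n R by fact
  have "set as \<subseteq> carrier R" using assms(3) n.Icarr by auto
  then have "killed n (adjoins K as)" using killedI[OF adjoins_ideal[OF assms(1)] assms(2)] * by blast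
  then have "killed n (adjoins K (take (length as) bs))"
    using killed_exchange[OF assms(1,2,3), of "take (length as) bs"] assms(4-7) regular_mod_take
    by (auto dest: in_set_takeD)
  moreover have "bs ! length as \<in> n" using assms(4,5) nth_mem by blast
  ultimately show False
    using killed_not_regular regular_mod_nth[OF assms(7,5)] by blast
qed

lemma regular_mod_extend:
  assumes "ideal K R" "ideal n R" "set as \<subseteq> n" "set bs \<subseteq> n" "length as \<le> length bs"
    and "regular_mod K as" "regular_mod K bs"
  shows "\<exists>cs. set cs \<subseteq> n \<and> regular_mod K (as @ cs) \<and> length (as @ cs) = length bs"
  using assms(3,5,6)
proof (induction "length bs - length as" arbitrary: as)
  case 0
  then show ?case by (intro exI[of _ "[]"]) auto
next
  case (Suc k)
  have "length as < length bs" using Suc.hyps(2) by simp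
  then obtain e where e: "e \<in> n" "regular_on (adjoins K as) e"
    using regular_mod_extend_one[OF assms(1,2) Suc.prems(1) assms(4) _ Suc.prems(3) assms(7)] by auto
  have "\<exists>cs. set cs \<subseteq> n \<and> regular_mod K ((as @ [e]) @ cs) \<and> length ((as @ [e]) @ cs) = length bs"
  proof (rule Suc.hyps(1))
    show "k = length bs - length (as @ [e])" "length (as @ [e]) \<le> length bs" using Suc.hyps(2) by auto
    show "set (as @ [e]) \<subseteq> n" using Suc.prems(1) e(1) by simp
    show "regular_mod K (as @ [e])" using Suc.prems(3) e(2) by (simp add: regular_mod_append)
  qed
  then obtain cs where "set cs \<subseteq> n" "regular_mod K ((as @ [e]) @ cs)"
    "length ((as @ [e]) @ cs) = length bs" by blast
  then show ?case using e by (intro exI[of _ "e # cs"]) auto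
qed

text \<open>Also excludes that depth and dimension are both infinite in the definition of
  Cohen-Macaulayness.\<close>

lemma regular_mod_bounded:
  assumes n: "ideal n R" "n \<noteq> carrier R"
  obtains N where "\<And>bs. set bs \<subseteq> n \<Longrightarrow> regular_mod {\<zero>} bs \<Longrightarrow> length bs \<le> N"
proof -
  interpret n: ideal n R by fact
  \<comment> \<open>A regular sequence whose ideal is maximal among these cannot be lengthened
    inside \<open>n\<close>: a further regular element would already lie in the ideal and make it
    the whole ring. By exchange its length bounds all others.\<close>
  let ?C = "{adjoins {\<zero>} as |as. set as \<subseteq> n \<and> regular_mod {\<zero>} as}"
  have carr: "set as \<subseteq> carrier R" if "set as \<subseteq> n" for as using that n.Icarr by auto
  have "\<exists>M\<in>?C. \<forall>L\<in>?C. M \<subseteq> L \<longrightarrow> L = M"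
  proof (rule maximal_ideal_in_family)
    show "ideal K R" if "K \<in> ?C" for K using that adjoins_ideal[OF zeroideal] carr by auto
    show "?C \<noteq> {}" by (auto intro: exI[of _ "[]"])
  qed
  then obtain as where as: "set as \<subseteq> n" "regular_mod {\<zero>} as"
    and max: "\<forall>L\<in>?C. adjoins {\<zero>} as \<subseteq> L \<longrightarrow> L = adjoins {\<zero>} as" by auto
  let ?M = "adjoins {\<zero>} as"
  have M: "ideal ?M R" "?M \<subseteq> n"
    using adjoins_ideal[OF zeroideal carr[OF as(1)]] adjoins_minimal[OF n(1) _ as(1)] n.zero_closed
    by auto
  have "length bs \<le> length as" if bs: "set bs \<subseteq> n" "regular_mod {\<zero>} bs" for bs
  proof (rule ccontr)
    assume "\<not> ?thesis"
    then obtain e where e: "e \<in> n" "regular_on ?M e"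
      using regular_mod_extend_one[OF zeroideal n(1) as(1) bs(1) _ as(2) bs(2)] by auto
    have ec: "e \<in> carrier R" using e n.Icarr by blast
    have "adjoins {\<zero>} (as @ [e]) \<in> ?C"
      using as e by (intro CollectI exI[of _ "as @ [e]"]) (auto simp: regular_mod_append)
    moreover have "?M \<subseteq> adjoins {\<zero>} (as @ [e])" using adjoin_subset[OF M(1) ec] by (simp add: adjoins_append)
    ultimately have "adjoin ?M e = ?M" using max by (simp add: adjoins_append)
    then have "e \<in> ?M" using mem_adjoin[OF M(1) ec] by simp
    then have "e \<otimes> \<one> \<in> ?M" using ec by simp
    then have "\<one> \<in> ?M" using regular_onD[OF e(2)] by blast
    then show False using M(2) n(2) n.one_imp_carrier by blast
  qed
  then show ?thesis using that by blast
qed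

section \<open>Depth, chains of primes and heights of associated primes\<close>

text \<open>Nakayama's lemma for \<open>N = K + b N\<close>, with Noetherianity in place of
  determinants: for \<open>K + Ru\<close> maximal among the extensions of \<open>K\<close> by one
  element of \<open>N\<close> outside \<open>K\<close>, writing \<open>u = k + b v\<close> gives
  \<open>K + Ru = K + Rv\<close>, hence \<open>v = l + r u\<close>, and the unit
  \<open>1 - r b\<close> multiplies \<open>v\<close> into \<open>K\<close>.\<close>

lemma nakayama_step:
  assumes K: "ideal K R" and N: "ideal N R" "K \<subseteq> N" and b: "b \<in> n" "ideal n R"
    and jac: "\<And>x. x \<in> n \<Longrightarrow> \<one> \<ominus> x \<in> Units R"
    and step: "\<And>u. u \<in> N \<Longrightarrow> \<exists>k\<in>K. \<exists>v\<in>N. u = k \<oplus> b \<otimes> v"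
  shows "N \<subseteq> K"
proof (rule ccontr)
  assume "\<not> N \<subseteq> K"
  interpret K: ideal K R by fact
  interpret N: ideal N R by fact
  interpret n: ideal n R by fact
  have bc: "b \<in> carrier R" using b n.Icarr by blast
  let ?C = "{adjoin K u |u. u \<in> N \<and> u \<notin> K}"
  have "\<exists>M\<in>?C. \<forall>L\<in>?C. M \<subseteq> L \<longrightarrow> L = M"
    by (rule maximal_ideal_in_family) (use adjoin_ideal[OF K] N.Icarr \<open>\<not> N \<subseteq> K\<close> in auto)
  then obtain u where u: "u \<in> N" "u \<notin> K" and max: "\<forall>L\<in>?C. adjoin K u \<subseteq> L \<longrightarrow> L = adjoin K u"
    by auto
  obtain k v where kv: "k \<in> K" "v \<in> N" "u = k \<oplus> b \<otimes> v" using step[OF u(1)] by auto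
  have carr: "u \<in> carrier R" "v \<in> carrier R" "k \<in> carrier R" using u kv N.Icarr K.Icarr by auto
  have "v \<notin> K"
  proof
    assume "v \<in> K"
    then have "u \<in> K" unfolding kv(3) using kv(1) bc by (simp add: K.I_l_closed)
    with u show False by blast
  qed
  then have "adjoin K v \<in> ?C" using kv by blast
  moreover have "adjoin K u \<subseteq> adjoin K v"
    using adjoin_minimal[OF adjoin_ideal[OF K carr(2)] adjoin_subset[OF K carr(2)]] kv bc
    unfolding adjoin_def by blast
  ultimately have "adjoin K v = adjoin K u" using max by blast
  then have "v \<in> adjoin K u" using mem_adjoin[OF K carr(2)] by simp
  then obtain l r where lr: "l \<in> K" "r \<in> carrier R" "v = l \<oplus> r \<otimes> u" by (auto simp: adjoin_def)
  have l: "l \<in> carrier R" using lr K.Icarr by blast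
  have rb: "r \<otimes> b \<in> n" using lr b by (simp add: n.I_l_closed)
  have "\<zero> \<oplus> v = (l \<oplus> r \<otimes> k) \<oplus> (r \<otimes> b) \<otimes> v"
  proof -
    have "l \<oplus> r \<otimes> u = (l \<oplus> r \<otimes> k) \<oplus> (r \<otimes> b) \<otimes> v"
      unfolding kv(3) using l lr(2) carr bc by (simp add: r_distr a_assoc m_assoc)
    then show ?thesis using lr(3) carr by simp
  qed
  then have "v \<ominus> (r \<otimes> b) \<otimes> v = (l \<oplus> r \<otimes> k) \<ominus> \<zero>"
    using l lr(2) carr bc by (intro diff_eq_diff) auto
  also have "\<dots> \<in> K" using lr kv K.zero_closed K.I_minus_closed K.I_l_closed by simp
  finally have "v \<ominus> (r \<otimes> b) \<otimes> v \<in> K" .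
  moreover have "v \<ominus> (r \<otimes> b) \<otimes> v = (\<one> \<ominus> r \<otimes> b) \<otimes> v"
    using lr(2) carr bc by (simp add: minus_eq l_distr l_minus)
  ultimately have *: "(\<one> \<ominus> r \<otimes> b) \<otimes> v \<in> K" by simp
  have unit: "\<one> \<ominus> r \<otimes> b \<in> Units R" by (rule jac[OF rb])
  then have "inv (\<one> \<ominus> r \<otimes> b) \<otimes> ((\<one> \<ominus> r \<otimes> b) \<otimes> v) \<in> K" using * K.I_l_closed by simp
  moreover have "inv (\<one> \<ominus> r \<otimes> b) \<otimes> ((\<one> \<ominus> r \<otimes> b) \<otimes> v) = v"
    using unit carr lr(2) bc by (simp add: m_assoc[symmetric])
  ultimately show False using \<open>v \<notin> K\<close> by simp
qed

text \<open>The inequality \<open>depth R/K <= dim R/q\<close>, with the chain of primes made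
  explicit. Each \<open>b\<close> of the sequence leads from \<open>q\<close> to a strictly larger
  prime associated to \<open>K + Rb\<close>, strict because \<open>b\<close> is regular on
  \<open>R/K\<close> and so lies outside \<open>q\<close>.\<close>

lemma Ass_chain_of_regular_mod:
  assumes "ideal K R" "q \<in> Ass R K" "ideal n R" "set bs \<subseteq> n" "regular_mod K bs"
    and jac: "\<And>x. x \<in> n \<Longrightarrow> \<one> \<ominus> x \<in> Units R"
  shows "\<exists>ps. length ps = length bs \<and> sorted_wrt (\<subset>) (q # ps) \<and> (\<forall>p\<in>set ps. primeideal p R)"
  using assms(1,2,4,5)
proof (induction bs arbitrary: K q)
  case Nil then show ?case by simp
next
  case (Cons b bs)
  note K = Cons.prems(1)
  interpret K: ideal K R by fact
  interpret n: ideal n R by fact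
  have b: "b \<in> n" "b \<in> carrier R" "regular_on K b" using Cons.prems n.Icarr by auto
  obtain z where z: "z \<in> carrier R" "q = colon_ideal R K {z}" "primeideal q R"
    using Cons.prems(2) by (auto simp: Ass_def)
  interpret q: primeideal q R by fact
  \<comment> \<open>\<open>N/K\<close> is the submodule of \<open>R/K\<close> annihilated by
    \<open>q\<close>; it is nonzero as \<open>q = K : z\<close>. If it vanished modulo
    \<open>b\<close>, then \<open>N = K + b N\<close> because \<open>b\<close> is regular, and
    Nakayama would give \<open>N = K\<close>. So some \<open>u\<close> in \<open>N\<close> survives
    modulo \<open>K + Rb\<close>, where its annihilator contains both \<open>q\<close> and
    \<open>b\<close>.\<close>
  define N where "N = {u \<in> carrier R. \<forall>r\<in>q. r \<otimes> u \<in> K}"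
  have N: "ideal N R"
  proof (rule ideal_closedI)
    fix x r assume x: "x \<in> N" and r: "r \<in> carrier R"
    have "s \<otimes> (r \<otimes> x) \<in> K" if "s \<in> q" for s
    proof -
      have "s \<otimes> (r \<otimes> x) = r \<otimes> (s \<otimes> x)" using x r q.Icarr[OF that] by (simp add: N_def m_lcomm)
      then show ?thesis using x r that by (simp add: N_def K.I_l_closed)
    qed
    then show "r \<otimes> x \<in> N" using x r by (simp add: N_def)
  qed (auto simp: N_def r_distr q.Icarr)
  have KN: "K \<subseteq> N" using q.Icarr by (auto simp: N_def K.Icarr K.I_l_closed)
  have zN: "z \<in> N" "z \<notin> K"
  proof -
    show "z \<in> N" using z by (auto simp: N_def in_colon_ideal_iff)
    show "z \<notin> K"
    proof
      assume "z \<in> K"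
      then have "\<one> \<in> q" using z by (simp add: in_colon_ideal_iff)
      then show False using q.one_imp_carrier q.I_notcarr by blast
    qed
  qed
  have "\<not> N \<subseteq> adjoin K b"
  proof
    assume sub: "N \<subseteq> adjoin K b"
    have "N \<subseteq> K"
    proof (rule nakayama_step[OF K N KN b(1) assms(3) jac])
      fix u assume u: "u \<in> N"
      then obtain k r where kr: "k \<in> K" "r \<in> carrier R" "u = k \<oplus> r \<otimes> b"
        using sub by (auto simp: adjoin_def)
      have k: "k \<in> carrier R" using kr K.Icarr by blast
      have "r \<in> N"
      proof -
        have "s \<otimes> r \<in> K" if s: "s \<in> q" for s
        proof -
          have sc: "s \<in> carrier R" using s q.Icarr by blast
          have "s \<otimes> u = s \<otimes> k \<oplus> b \<otimes> (s \<otimes> r)"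
            unfolding kr(3) using sc k kr(2) b(2) by (simp add: r_distr m_ac)
          moreover have "s \<otimes> u \<in> K" using u s by (simp add: N_def)
          moreover have "s \<otimes> k \<in> K" using sc kr(1) by (simp add: K.I_l_closed)
          ultimately have "(s \<otimes> k \<oplus> b \<otimes> (s \<otimes> r)) \<ominus> s \<otimes> k \<in> K" using K.I_minus_closed by metis
          then have "b \<otimes> (s \<otimes> r) \<in> K" using sc k kr(2) b(2) by (simp add: add_minus_cancel)
          then show ?thesis using regular_onD[OF b(3)] sc kr(2) by blast
        qed
        then show ?thesis using kr(2) by (simp add: N_def)
      qed
      moreover have "u = k \<oplus> b \<otimes> r" using kr b(2) by (simp add: m_comm)
      ultimately show "\<exists>k\<in>K. \<exists>v\<in>N. u = k \<oplus> b \<otimes> v" using kr(1) by blast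
    qed auto
    then show False using zN by blast
  qed
  then obtain u where u: "u \<in> N" "u \<notin> adjoin K b" by blast
  have uc: "u \<in> carrier R" using u by (simp add: N_def)
  have idb: "ideal (adjoin K b) R" by (rule adjoin_ideal[OF K b(2)])
  obtain q' where q': "q' \<in> Ass R (adjoin K b)" "colon_ideal R (adjoin K b) {u} \<subseteq> q'"
    by (rule colon_ideal_subset_Ass[OF idb uc u(2)])
  have "q \<subseteq> colon_ideal R (adjoin K b) {u}"
  proof
    fix r assume r: "r \<in> q"
    then have "r \<otimes> u \<in> adjoin K b" using u adjoin_subset[OF K b(2)] by (auto simp: N_def)
    then show "r \<in> colon_ideal R (adjoin K b) {u}" using q.Icarr[OF r] by (simp add: in_colon_ideal_iff)
  qed
  moreover have "b \<in> colon_ideal R (adjoin K b) {u}"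
    using ideal.I_r_closed[OF idb mem_adjoin[OF K b(2)] uc] b(2) by (simp add: in_colon_ideal_iff)
  moreover have "b \<notin> q" using Ass_not_regular[OF K Cons.prems(2)] b(3) by blast
  ultimately have qq: "q \<subset> q'" using q'(2) by blast
  obtain ps where ps: "length ps = length bs" "sorted_wrt (\<subset>) (q' # ps)" "\<forall>p\<in>set ps. primeideal p R"
    using Cons.IH[OF idb q'(1)] Cons.prems by auto
  have "sorted_wrt (\<subset>) (q # q' # ps)" using ps(2) qq by auto
  moreover have "primeideal q' R" using q'(1) by (simp add: Ass_def)
  ultimately show ?case using ps by (intro exI[of _ "q' # ps"]) auto
qed

text \<open>After \<open>as\<close> has been extended to a regular sequence of length
  \<open>depth R n\<close>, a chain of primes ending in \<open>q\<close> is continued above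
  \<open>q\<close> by \<open>Ass_chain_of_regular_mod\<close>. The joined chain is no longer than
  the dimension, which equals that depth, so the part below \<open>q\<close> has at most
  \<open>length as\<close> steps.\<close>

lemma height_Ass_le_of_depth_eq_dim:
  assumes n: "ideal n R" "n \<noteq> carrier R" and jac: "\<And>x. x \<in> n \<Longrightarrow> \<one> \<ominus> x \<in> Units R"
    and depth: "depth R n = krull_dim R"
    and as: "set as \<subseteq> n" "regular_mod {\<zero>} as" and q: "q \<in> Ass R (adjoins {\<zero>} as)"
    and ps: "prime_chain R ps" "last ps = q"
  shows "length ps - 1 \<le> length as"
proof -
  interpret n: ideal n R by fact
  have carr: "set as \<subseteq> carrier R" using as n.Icarr by auto
  obtain N where N: "\<And>bs. set bs \<subseteq> n \<Longrightarrow> regular_mod {\<zero>} bs \<Longrightarrow> length bs \<le> N"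
    using regular_mod_bounded[OF n] by blast
  let ?X = "{xs. regular_sequence R xs \<and> set xs \<subseteq> n}"
  let ?L = "length ` ?X"
  have "?L \<subseteq> {..N}" using N regular_sequence_imp_regular_mod by auto
  then have fin: "finite ?L" by (rule finite_subset) simp
  \<comment> \<open>The empty sequence counts because \<open>n\<close> is proper, so that the ring
    is nonzero; together with the bound \<open>N\<close> this makes the supremum defining the depth
    a maximum.\<close>
  have "[] \<in> ?X"
  proof -
    have "{\<zero>} \<noteq> carrier R"
    proof
      assume *: "{\<zero>} = carrier R"
      have "n = {\<zero>}" using n.a_subset n.zero_closed unfolding *[symmetric] by auto
      then show False using n(2) * by simp
    qed
    then show ?thesis using adjoins_zero[of "[]"] by (simp add: regular_sequence_def)
  qed
  then have ne: "?L \<noteq> {}" by blast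
  then have "Max ?L \<in> ?L" using fin Max_in by blast
  then obtain bs where bs: "regular_sequence R bs" "set bs \<subseteq> n" "length bs = Max ?L" by auto
  have "depth R n \<le> enat (length bs)"
    unfolding depth_def bs(3) using fin by (intro SUP_least) auto
  then have kd: "krull_dim R \<le> enat (length bs)" using depth by simp
  have bound: "length cs - 1 \<le> length bs" if "prime_chain R cs" for cs
  proof -
    have "enat (length cs - 1) \<le> krull_dim R"
      unfolding krull_dim_def using that by (intro SUP_upper) simp
    then show ?thesis using kd by (metis enat_ord_simps(1) order_trans)
  qed
  have bsr: "regular_mod {\<zero>} bs" by (rule regular_sequence_imp_regular_mod[OF bs(1)])
  show ?thesis
  proof (cases "length as \<le> length bs")
    case False
    then show ?thesis using bound[OF ps(1)] by simp
  next
    case True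
    then obtain cs where cs: "set cs \<subseteq> n" "regular_mod {\<zero>} (as @ cs)" "length (as @ cs) = length bs"
      using regular_mod_extend[OF zeroideal n(1) as(1) bs(2) _ as(2) bsr] by blast
    obtain qs where qs: "length qs = length cs" "sorted_wrt (\<subset>) (q # qs)" "\<forall>p\<in>set qs. primeideal p R"
      using Ass_chain_of_regular_mod[OF adjoins_ideal[OF zeroideal carr] q n(1) cs(1) _ jac] cs(2)
      by (auto simp: regular_mod_append)
    have ne: "ps \<noteq> []" using ps(1) by (simp add: prime_chain_def)
    have sps: "sorted_wrt (\<subset>) ps" using ps(1) by (simp add: prime_chain_def)
    have "x \<subseteq> q" if "x \<in> set ps" for x
    proof -
      have "sorted_wrt (\<subset>) (butlast ps @ [q])" using sps ne ps(2) append_butlast_last_id by metis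
      moreover have "x = q \<or> x \<in> set (butlast ps)" using that ne ps(2)
        by (metis append_butlast_last_id in_set_conv_decomp rotate1.simps(2) set_ConsD set_rotate1)
      ultimately show ?thesis by (auto simp: sorted_wrt_append)
    qed
    then have "\<forall>x\<in>set ps. \<forall>y\<in>set qs. x \<subset> y"
      using qs(2) subset_psubset_trans[of _ q] by simp
    then have "sorted_wrt (\<subset>) (ps @ qs)" using sps qs(2) by (simp add: sorted_wrt_append)
    then have "prime_chain R (ps @ qs)" using ps(1) qs(3) by (auto simp: prime_chain_def)
    from bound[OF this] show ?thesis using qs(1) cs(3) ne by (cases ps) auto
  qed
qed

end

section \<open>Localization and Cohen-Macaulay rings\<close>

context mult_closed
begin

text \<open>The extension of \<open>K\<close> as a concrete set of fractions;
  \<open>Idl_localization\<close> identifies it with the generated ideal in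
  \<open>extend_local\<close>.\<close>

definition loc_ext :: "'a set \<Rightarrow> ('a \<times> 'a) set set" where
  "loc_ext K = {loc_frac R U a s |a s. a \<in> K \<and> s \<in> U}"

text \<open>The given representative of the fraction may have its numerator outside
  \<open>K\<close>, hence the multiplier \<open>u\<close>.\<close>

lemma loc_frac_mem_loc_ext:
  assumes K: "ideal K R" and a: "a \<in> carrier R" "s \<in> U"
  shows "loc_frac R U a s \<in> loc_ext K \<longleftrightarrow> (\<exists>u\<in>U. u \<otimes> a \<in> K)"
proof
  interpret K: ideal K R by fact
  assume "loc_frac R U a s \<in> loc_ext K"
  then obtain b t where bt: "b \<in> K" "t \<in> U" "loc_frac R U a s = loc_frac R U b t"
    by (auto simp: loc_ext_def)
  have b: "b \<in> carrier R" using bt K.Icarr by blast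
  obtain u where u: "u \<in> U" "u \<otimes> (a \<otimes> t) = u \<otimes> (b \<otimes> s)"
    using bt(3) loc_frac_eq_iff[OF a b bt(2)] by blast
  have "(u \<otimes> t) \<otimes> a = u \<otimes> (a \<otimes> t)" using u(1) bt(2) a by (simp add: m_ac)
  also have "\<dots> \<in> K" unfolding u(2) using u(1) bt(1) a by (simp add: K.I_l_closed K.I_r_closed)
  finally show "\<exists>u\<in>U. u \<otimes> a \<in> K" using U_mult[OF u(1) bt(2)] by blast
next
  assume "\<exists>u\<in>U. u \<otimes> a \<in> K"
  then obtain u where u: "u \<in> U" "u \<otimes> a \<in> K" by blast
  have "loc_frac R U a s = loc_frac R U (u \<otimes> a) (u \<otimes> s)"
    using u(1) a by (intro loc_frac_eqI) (auto simp: m_ac U_mult)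
  then show "loc_frac R U a s \<in> loc_ext K" unfolding loc_ext_def using u a U_mult by blast
qed

lemma loc_ext_ideal:
  assumes K: "ideal K R"
  shows "ideal (loc_ext K) (localization R U)"
proof -
  interpret K: ideal K R by fact
  interpret L: cring "localization R U" by (rule cring_localization)
  show ?thesis
  proof (rule L.ideal_closedI)
    show "loc_ext K \<subseteq> carrier (localization R U)"
      using loc_frac_closed K.Icarr by (auto simp: loc_ext_def)
    show "\<zero>\<^bsub>localization R U\<^esub> \<in> loc_ext K"
      unfolding localization_zero loc_ext_def using K.zero_closed U_one by blast
  next
    fix x y assume "x \<in> loc_ext K" "y \<in> loc_ext K"
    then obtain a s b t where *: "a \<in> K" "s \<in> U" "x = loc_frac R U a s" "b \<in> K" "t \<in> U"
      "y = loc_frac R U b t" by (auto simp: loc_ext_def)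
    have "x \<oplus>\<^bsub>localization R U\<^esub> y = loc_frac R U (a \<otimes> t \<oplus> b \<otimes> s) (s \<otimes> t)"
      using * K.Icarr by (simp add: loc_frac_add)
    moreover have "a \<otimes> t \<oplus> b \<otimes> s \<in> K" using * by (simp add: K.I_r_closed)
    ultimately show "x \<oplus>\<^bsub>localization R U\<^esub> y \<in> loc_ext K"
      unfolding loc_ext_def using U_mult * by blast
  next
    fix x r assume "x \<in> loc_ext K" "r \<in> carrier (localization R U)"
    then obtain a s b t where *: "a \<in> K" "s \<in> U" "x = loc_frac R U a s" "b \<in> carrier R" "t \<in> U"
      "r = loc_frac R U b t" by (auto simp: loc_ext_def elim!: carrier_localization_cases)
    have "r \<otimes>\<^bsub>localization R U\<^esub> x = loc_frac R U (b \<otimes> a) (t \<otimes> s)"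
      using * K.Icarr by (simp add: loc_frac_mult)
    moreover have "b \<otimes> a \<in> K" using * by (simp add: K.I_l_closed)
    ultimately show "r \<otimes>\<^bsub>localization R U\<^esub> x \<in> loc_ext K"
      unfolding loc_ext_def using U_mult * by blast
  qed
qed

lemma loc_frac_split:
  assumes "a \<in> carrier R" "s \<in> U"
  shows "loc_frac R U a s = loc_frac R U \<one> s \<otimes>\<^bsub>localization R U\<^esub> loc_frac R U a \<one>"
  using assms U_one by (simp add: loc_frac_mult)

lemma Idl_localization:
  assumes K: "ideal K R"
  shows "Idl\<^bsub>localization R U\<^esub> ((\<lambda>a. loc_frac R U a \<one>) ` K) = loc_ext K"
proof
  interpret K: ideal K R by fact
  interpret L: cring "localization R U" by (rule cring_localization)
  have sub: "(\<lambda>a. loc_frac R U a \<one>) ` K \<subseteq> carrier (localization R U)"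
    using loc_frac_closed K.Icarr U_one by auto
  show "Idl\<^bsub>localization R U\<^esub> ((\<lambda>a. loc_frac R U a \<one>) ` K) \<subseteq> loc_ext K"
    by (rule L.genideal_minimal[OF loc_ext_ideal[OF K]]) (use U_one in \<open>auto simp: loc_ext_def\<close>)
  show "loc_ext K \<subseteq> Idl\<^bsub>localization R U\<^esub> ((\<lambda>a. loc_frac R U a \<one>) ` K)"
  proof
    fix x assume "x \<in> loc_ext K"
    then obtain a s where as: "a \<in> K" "s \<in> U" "x = loc_frac R U a s" by (auto simp: loc_ext_def)
    have "loc_frac R U a \<one> \<in> Idl\<^bsub>localization R U\<^esub> ((\<lambda>a. loc_frac R U a \<one>) ` K)"
      using L.genideal_self[OF sub] as(1) by auto
    moreover have "loc_frac R U \<one> s \<in> carrier (localization R U)" using as by (simp add: loc_frac_closed)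
    ultimately show "x \<in> Idl\<^bsub>localization R U\<^esub> ((\<lambda>a. loc_frac R U a \<one>) ` K)"
      unfolding as(3) loc_frac_split[OF K.Icarr[OF as(1)] as(2)]
      using ideal.I_l_closed[OF L.genideal_ideal[OF sub]] by blast
  qed
qed

text \<open>An ideal \<open>J\<close> of the localization is recovered from its contraction
  \<open>K\<close>, and the images of finitely many generators of \<open>K\<close> generate
  \<open>J\<close>.\<close>

lemma noetherian_localization:
  assumes "noetherian_ring R"
  shows "noetherian_cring (localization R U)"
proof -
  interpret noetherian_ring R by fact
  interpret L: cring "localization R U" by (rule cring_localization)
  have "noetherian_ring (localization R U)"
  proof (rule L.noetherian_ringI)
    fix J assume J: "ideal J (localization R U)"
    interpret J: ideal J "localization R U" by fact
    define K where "K = {a \<in> carrier R. loc_frac R U a \<one> \<in> J}"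
    have K: "ideal K R"
    proof (rule ideal_closedI)
      show "\<zero> \<in> K" using J.zero_closed by (simp add: K_def localization_zero)
    next
      fix x y assume "x \<in> K" "y \<in> K"
      then show "x \<oplus> y \<in> K" using J.a_closed[of "loc_frac R U x \<one>" "loc_frac R U y \<one>"] U_one
        by (simp add: K_def loc_frac_add)
    next
      fix x r assume "x \<in> K" "r \<in> carrier R"
      then show "r \<otimes> x \<in> K"
        using J.I_l_closed[of "loc_frac R U x \<one>" "loc_frac R U r \<one>"] U_one
        by (simp add: K_def loc_frac_mult loc_frac_closed)
    qed (simp add: K_def)
    obtain A where A: "A \<subseteq> carrier R" "finite A" "K = Idl A" using finetely_gen[OF K] by blast
    let ?B = "(\<lambda>a. loc_frac R U a \<one>) ` A"
    have B: "?B \<subseteq> carrier (localization R U)" using A loc_frac_closed U_one by auto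
    have AK: "A \<subseteq> K" using A genideal_self by blast
    have "Idl\<^bsub>localization R U\<^esub> ?B \<subseteq> J"
      by (rule L.genideal_minimal[OF J]) (use AK in \<open>auto simp: K_def\<close>)
    moreover have "J \<subseteq> Idl\<^bsub>localization R U\<^esub> ?B"
    proof
      fix x assume x: "x \<in> J"
      then obtain a s where as: "a \<in> carrier R" "s \<in> U" "x = loc_frac R U a s"
        using J.Icarr carrier_localization_cases by metis
      let ?M = "{a \<in> carrier R. loc_frac R U a \<one> \<in> Idl\<^bsub>localization R U\<^esub> ?B}"
      interpret M: ideal "Idl\<^bsub>localization R U\<^esub> ?B" "localization R U"
        by (rule L.genideal_ideal[OF B])
      have "ideal ?M R"
      proof (rule ideal_closedI)
        show "\<zero> \<in> ?M" using M.zero_closed by (simp add: localization_zero)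
      next
        fix x y assume "x \<in> ?M" "y \<in> ?M"
        then show "x \<oplus> y \<in> ?M" using M.a_closed[of "loc_frac R U x \<one>" "loc_frac R U y \<one>"] U_one
          by (simp add: loc_frac_add)
      next
        fix x r assume "x \<in> ?M" "r \<in> carrier R"
        then show "r \<otimes> x \<in> ?M"
          using M.I_l_closed[of "loc_frac R U x \<one>" "loc_frac R U r \<one>"] U_one
          by (simp add: loc_frac_mult loc_frac_closed)
      qed simp
      then have "K \<subseteq> ?M"
        unfolding A(3) using A(1) L.genideal_self[OF B] by (intro genideal_minimal) auto
      moreover have "a \<in> K"
      proof -
        have "loc_frac R U s \<one> \<otimes>\<^bsub>localization R U\<^esub> x \<in> J"
          using x as U_one by (intro J.I_l_closed) (auto simp: loc_frac_closed)
        moreover have "loc_frac R U s \<one> \<otimes>\<^bsub>localization R U\<^esub> x = loc_frac R U (s \<otimes> a) s"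
          using as U_one by (simp add: loc_frac_mult)
        moreover have "\<dots> = loc_frac R U a \<one>"
          using as U_one by (intro loc_frac_eqI) (auto simp: m_comm)
        ultimately show ?thesis using as by (simp add: K_def)
      qed
      ultimately have "loc_frac R U a \<one> \<in> Idl\<^bsub>localization R U\<^esub> ?B" by blast
      moreover have "loc_frac R U \<one> s \<in> carrier (localization R U)" using as by (simp add: loc_frac_closed)
      ultimately show "x \<in> Idl\<^bsub>localization R U\<^esub> ?B"
        unfolding as(3) loc_frac_split[OF as(1,2)] by (rule M.I_l_closed)
    qed
    ultimately have "J = Idl\<^bsub>localization R U\<^esub> ?B" by blast
    then show "\<exists>A\<subseteq>carrier (localization R U). finite A \<and> J = Idl\<^bsub>localization R U\<^esub> A"
      using B A(2) by blast
  qed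
  then show ?thesis using L.cring_axioms by (simp add: noetherian_cring_def)
qed

lemma loc_ext_adjoin:
  assumes K: "ideal K R" and x: "x \<in> carrier R"
  shows "loc_ext (adjoin K x) = cring.adjoin (localization R U) (loc_ext K) (loc_frac R U x \<one>)"
proof
  interpret K: ideal K R by fact
  interpret L: cring "localization R U" by (rule cring_localization)
  have fx: "loc_frac R U x \<one> \<in> carrier (localization R U)" using x U_one by (simp add: loc_frac_closed)
  interpret A: ideal "L.adjoin (loc_ext K) (loc_frac R U x \<one>)" "localization R U"
    by (rule L.adjoin_ideal[OF loc_ext_ideal[OF K] fx])
  show "loc_ext (adjoin K x) \<subseteq> L.adjoin (loc_ext K) (loc_frac R U x \<one>)"
  proof
    fix y assume "y \<in> loc_ext (adjoin K x)"
    then obtain k r s where *: "k \<in> K" "r \<in> carrier R" "s \<in> U" "y = loc_frac R U (k \<oplus> r \<otimes> x) s"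
      by (auto simp: loc_ext_def adjoin_def)
    have k: "k \<in> carrier R" using * K.Icarr by blast
    have "y = loc_frac R U k s \<oplus>\<^bsub>localization R U\<^esub>
        loc_frac R U r s \<otimes>\<^bsub>localization R U\<^esub> loc_frac R U x \<one>"
      unfolding *(4) using * k x U_one U_mult
      by (simp add: loc_frac_add loc_frac_mult)
        (intro loc_frac_eqI, auto simp: U_mult l_distr r_distr m_ac)
    then show "y \<in> L.adjoin (loc_ext K) (loc_frac R U x \<one>)"
      unfolding L.adjoin_def loc_ext_def using * loc_frac_closed by blast
  qed
  show "L.adjoin (loc_ext K) (loc_frac R U x \<one>) \<subseteq> loc_ext (adjoin K x)"
  proof (rule L.adjoin_minimal)
    show "ideal (loc_ext (adjoin K x)) (localization R U)"
      by (rule loc_ext_ideal[OF adjoin_ideal[OF K x]])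
    show "loc_ext K \<subseteq> loc_ext (adjoin K x)" unfolding loc_ext_def using adjoin_subset[OF K x] by blast
    show "loc_frac R U x \<one> \<in> loc_ext (adjoin K x)"
      unfolding loc_ext_def using mem_adjoin[OF K x] U_one by blast
  qed
qed

lemma loc_ext_zero: "loc_ext {\<zero>} = {\<zero>\<^bsub>localization R U\<^esub>}"
proof -
  have *: "loc_frac R U \<zero> s = loc_frac R U \<zero> \<one>" if "s \<in> U" for s
    using that U_one by (intro loc_frac_eqI) auto
  have "loc_ext {\<zero>} \<subseteq> {\<zero>\<^bsub>localization R U\<^esub>}"
    unfolding localization_zero loc_ext_def using * by blast
  moreover have "\<zero>\<^bsub>localization R U\<^esub> \<in> loc_ext {\<zero>}"
    unfolding localization_zero loc_ext_def using U_one by blast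
  ultimately show ?thesis by blast
qed

text \<open>Flatness of localization, on elements: if \<open>u\<close> carries \<open>x r\<close>
  into \<open>K\<close>, it carries \<open>r\<close> there as well, since \<open>x\<close> cancels
  from \<open>x (u r)\<close>.\<close>

lemma regular_on_loc_ext:
  assumes K: "ideal K R" and x: "x \<in> carrier R" and reg: "regular_on K x"
  shows "cring.regular_on (localization R U) (loc_ext K) (loc_frac R U x \<one>)"
proof -
  interpret K: ideal K R by fact
  interpret L: cring "localization R U" by (rule cring_localization)
  show ?thesis unfolding L.regular_on_def
  proof (intro ballI impI)
    fix y assume "y \<in> carrier (localization R U)"
      and xy: "loc_frac R U x \<one> \<otimes>\<^bsub>localization R U\<^esub> y \<in> loc_ext K"
    then obtain r s where rs: "r \<in> carrier R" "s \<in> U" "y = loc_frac R U r s"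
      using carrier_localization_cases by metis
    have "loc_frac R U (x \<otimes> r) s \<in> loc_ext K" using xy rs x U_one by (simp add: loc_frac_mult)
    then obtain u where u: "u \<in> U" "u \<otimes> (x \<otimes> r) \<in> K"
      using loc_frac_mem_loc_ext[OF K _ rs(2), of "x \<otimes> r"] x rs by auto
    have "u \<otimes> (x \<otimes> r) = x \<otimes> (u \<otimes> r)" using u(1) x rs by (simp add: m_lcomm)
    then have "u \<otimes> r \<in> K" using u reg rs unfolding regular_on_def by simp
    then show "y \<in> loc_ext K" using loc_frac_mem_loc_ext[OF K rs(1,2)] rs(3) u(1) by blast
  qed
qed

lemma regular_mod_loc_ext:
  assumes "ideal K R" "set xs \<subseteq> carrier R" "regular_mod K xs"
  shows "cring.regular_mod (localization R U) (loc_ext K) (map (\<lambda>x. loc_frac R U x \<one>) xs)"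
proof -
  interpret L: cring "localization R U" by (rule cring_localization)
  show ?thesis using assms
    by (induction xs arbitrary: K)
      (auto simp: regular_on_loc_ext loc_ext_adjoin[symmetric] adjoin_ideal)
qed

lemma loc_ext_adjoins:
  assumes "ideal K R" "set xs \<subseteq> carrier R"
  shows "loc_ext (adjoins K xs) =
    cring.adjoins (localization R U) (loc_ext K) (map (\<lambda>x. loc_frac R U x \<one>) xs)"
proof -
  interpret L: cring "localization R U" by (rule cring_localization)
  show ?thesis using assms
    by (induction xs arbitrary: K) (auto simp: loc_ext_adjoin[symmetric] adjoin_ideal)
qed

lemma loc_ext_prime_iff:
  assumes p: "primeideal p R" "p \<inter> U = {}" and a: "a \<in> carrier R" "s \<in> U"
  shows "loc_frac R U a s \<in> loc_ext p \<longleftrightarrow> a \<in> p"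
proof -
  have "(\<exists>u\<in>U. u \<otimes> a \<in> p) \<longleftrightarrow> a \<in> p"
    using prime_ideal_mult_iff[OF p(1) _ a(1)] p(2) U_one U_in by blast
  then show ?thesis using loc_frac_mem_loc_ext[OF primeideal.axioms(1)[OF p(1)] a] by simp
qed

lemma loc_ext_prime:
  assumes p: "primeideal p R" "p \<inter> U = {}"
  shows "primeideal (loc_ext p) (localization R U)"
proof (rule primeidealI)
  interpret p: primeideal p R by fact
  show "ideal (loc_ext p) (localization R U)" by (rule loc_ext_ideal[OF p.is_ideal])
  show "cring (localization R U)" by (rule cring_localization)
  have "\<one> \<notin> p" using p.one_imp_carrier p.I_notcarr by blast
  then have "loc_frac R U \<one> \<one> \<notin> loc_ext p" using loc_ext_prime_iff[OF p] U_one by simp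
  then show "carrier (localization R U) \<noteq> loc_ext p"
    using loc_frac_closed[OF one_closed U_one] by blast
  fix x y assume "x \<in> carrier (localization R U)" "y \<in> carrier (localization R U)"
    and xy: "x \<otimes>\<^bsub>localization R U\<^esub> y \<in> loc_ext p"
  then obtain a s b t where *: "a \<in> carrier R" "s \<in> U" "x = loc_frac R U a s"
    "b \<in> carrier R" "t \<in> U" "y = loc_frac R U b t" using carrier_localization_cases by metis
  have "loc_frac R U (a \<otimes> b) (s \<otimes> t) \<in> loc_ext p" using xy * by (simp add: loc_frac_mult)
  then have "a \<otimes> b \<in> p" using loc_ext_prime_iff[OF p, of "a \<otimes> b" "s \<otimes> t"] * U_mult by simp
  then show "x \<in> loc_ext p \<or> y \<in> loc_ext p"
    using prime_ideal_mult_iff[OF p(1)] * loc_ext_prime_iff[OF p] by simp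
qed

lemma loc_ext_prime_strict_mono:
  assumes p: "primeideal p R" "p \<inter> U = {}" and q: "primeideal q R" "q \<inter> U = {}" and "p \<subset> q"
  shows "loc_ext p \<subset> loc_ext q"
proof -
  obtain a where a: "a \<in> q" "a \<notin> p" using assms(5) by blast
  have ac: "a \<in> carrier R" using a(1) ideal.Icarr[OF primeideal.axioms(1)[OF q(1)]] by blast
  have "loc_frac R U a \<one> \<in> loc_ext q" "loc_frac R U a \<one> \<notin> loc_ext p"
    using a ac loc_ext_prime_iff[OF p ac U_one] loc_ext_prime_iff[OF q ac U_one] by auto
  moreover have "loc_ext p \<subseteq> loc_ext q" unfolding loc_ext_def using assms(5) by blast
  ultimately show ?thesis by blast
qed

text \<open>The witness \<open>z\<close> of \<open>q = K : z\<close> serves again: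
  \<open>a/s\<close> multiplies \<open>z/1\<close> into the extension of \<open>K\<close> exactly if
  some \<open>u\<close> in \<open>U\<close> has \<open>u a z\<close> in \<open>K\<close>, that is,
  \<open>u a\<close> in \<open>q\<close>.\<close>

lemma loc_ext_Ass:
  assumes K: "ideal K R" and q: "q \<in> Ass R K" "q \<inter> U = {}"
  shows "loc_ext q \<in> Ass (localization R U) (loc_ext K)"
proof -
  interpret K: ideal K R by fact
  obtain z where z: "z \<in> carrier R" "q = colon_ideal R K {z}" "primeideal q R"
    using q(1) by (auto simp: Ass_def)
  have "loc_ext q = colon_ideal (localization R U) (loc_ext K) {loc_frac R U z \<one>}"
  proof (rule Set.set_eqI)
    fix x
    show "x \<in> loc_ext q \<longleftrightarrow> x \<in> colon_ideal (localization R U) (loc_ext K) {loc_frac R U z \<one>}"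
    proof (cases "x \<in> carrier (localization R U)")
      case True
      then obtain a s where as: "a \<in> carrier R" "s \<in> U" "x = loc_frac R U a s"
        using carrier_localization_cases by metis
      have "x \<in> colon_ideal (localization R U) (loc_ext K) {loc_frac R U z \<one>}
          \<longleftrightarrow> loc_frac R U (a \<otimes> z) s \<in> loc_ext K"
        using True as z U_one by (simp add: in_colon_ideal_iff loc_frac_mult)
      also have "\<dots> \<longleftrightarrow> (\<exists>u\<in>U. u \<otimes> (a \<otimes> z) \<in> K)"
        using loc_frac_mem_loc_ext[OF K _ as(2)] as(1) z(1) by simp
      also have "\<dots> \<longleftrightarrow> (\<exists>u\<in>U. u \<otimes> a \<in> q)"
        using as(1) z by (auto simp: in_colon_ideal_iff m_assoc)
      also have "\<dots> \<longleftrightarrow> x \<in> loc_ext q"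
        using loc_frac_mem_loc_ext[OF primeideal.axioms(1)[OF z(3)] as(1,2)] as(3) by simp
      finally show ?thesis by simp
    next
      case False
      then show ?thesis
        using ideal.Icarr[OF loc_ext_ideal[OF primeideal.axioms(1)[OF z(3)]]]
        by (auto simp: in_colon_ideal_iff)
    qed
  qed
  moreover have "loc_frac R U z \<one> \<in> carrier (localization R U)" using z U_one by (simp add: loc_frac_closed)
  ultimately show ?thesis using loc_ext_prime[OF z(3) q(2)] unfolding Ass_def by blast
qed

end

section \<open>Associated primes of regular sequences in Cohen-Macaulay rings\<close>

text \<open>Cohen-Macaulayness speaks of localizations at maximal ideals, so \<open>q\<close> is
  localized at a maximal ideal \<open>n\<close> above it. Regular sequences, associated primes and
  strict chains of primes inside \<open>n\<close> survive there, and the local bound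
  applies.\<close>

lemma cohen_macaulay_height_Ass_le:
  assumes cm: "cohen_macaulay R"
    and as: "set as \<subseteq> carrier R" "cring.regular_mod R {\<zero>\<^bsub>R\<^esub>} as"
    and q: "q \<in> Ass R (cring.adjoins R {\<zero>\<^bsub>R\<^esub>} as)"
  shows "prime_height R q \<le> enat (length as)"
proof -
  interpret R: noetherian_cring R
    using cm by (simp add: cohen_macaulay_def noetherian_cring_def)
  let ?J = "R.adjoins {\<zero>\<^bsub>R\<^esub>} as"
  have J: "ideal ?J R" by (rule R.adjoins_ideal[OF R.zeroideal as(1)])
  have qp: "primeideal q R" using q by (simp add: Ass_def)
  obtain n where n: "maximalideal n R" "q \<subseteq> n"
    using R.exists_maximalideal[OF primeideal.axioms(1)[OF qp]] primeideal.I_notcarr[OF qp] by metis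
  have np: "primeideal n R" by (rule R.maximalideal_prime[OF n(1)])
  interpret n: primeideal n R by fact
  let ?U = "carrier R - n"
  interpret U: mult_closed R ?U by (rule n.mult_closed_compl)
  interpret L: noetherian_cring "local_at R n"
    by (rule U.noetherian_localization[OF R.noetherian_ring_axioms])
  let ?n = "U.loc_ext n"
  have nI: "ideal ?n (local_at R n)" by (rule U.loc_ext_ideal[OF n.is_ideal])
  have nP: "primeideal ?n (local_at R n)" by (rule U.loc_ext_prime[OF np]) blast
  have ext: "extend_local R n n = ?n"
    unfolding extend_local_def to_local_def using U.Idl_localization[OF n.is_ideal] by simp
  \<comment> \<open>In the local ring \<open>1 - x\<close> is outside the maximal ideal, so its
    numerator may serve as a denominator.\<close>
  have jac: "\<one>\<^bsub>local_at R n\<^esub> \<ominus>\<^bsub>local_at R n\<^esub> x \<in> Units (local_at R n)" if x: "x \<in> ?n" for x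
  proof -
    have xc: "x \<in> carrier (local_at R n)" using ideal.Icarr[OF nI x] .
    let ?y = "\<one>\<^bsub>local_at R n\<^esub> \<ominus>\<^bsub>local_at R n\<^esub> x"
    have yc: "?y \<in> carrier (local_at R n)" using xc by simp
    have "?y \<notin> ?n"
    proof
      assume "?y \<in> ?n"
      then have "?y \<oplus>\<^bsub>local_at R n\<^esub> x \<in> ?n"
        using x by (rule additive_subgroup.a_closed[OF ideal.axioms(1)[OF nI]])
      then have "\<one>\<^bsub>local_at R n\<^esub> \<in> ?n" using xc by (simp only: L.add_minus_cancel L.one_closed)
      then show False
        using ideal.one_imp_carrier[OF nI] primeideal.I_notcarr[OF nP] by blast
    qed
    moreover obtain a s where as: "a \<in> carrier R" "s \<in> ?U" "?y = loc_frac R ?U a s"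
      using U.carrier_localization_cases[OF yc] by metis
    ultimately have aU: "a \<in> ?U" using U.loc_ext_prime_iff[OF np _ as(1,2)] by auto
    have sc: "s \<in> carrier R" using as by blast
    have ic: "loc_frac R ?U s a \<in> carrier (local_at R n)" by (rule U.loc_frac_closed[OF sc aU])
    have "loc_frac R ?U s a \<otimes>\<^bsub>local_at R n\<^esub> loc_frac R ?U a s = loc_frac R ?U (s \<otimes>\<^bsub>R\<^esub> a) (a \<otimes>\<^bsub>R\<^esub> s)"
      by (rule U.loc_frac_mult[OF sc aU as(1,2)])
    also have "\<dots> = loc_frac R ?U \<one>\<^bsub>R\<^esub> \<one>\<^bsub>R\<^esub>"
      using sc as aU U.U_mult[OF aU as(2)] U.U_one by (intro U.loc_frac_eqI) (auto simp: R.m_comm)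
    finally have inv: "loc_frac R ?U s a \<otimes>\<^bsub>local_at R n\<^esub> ?y = \<one>\<^bsub>local_at R n\<^esub>"
      using as(3) U.localization_one by simp
    then have "?y \<otimes>\<^bsub>local_at R n\<^esub> loc_frac R ?U s a = \<one>\<^bsub>local_at R n\<^esub>"
      using L.m_comm[OF yc ic] by simp
    with inv show ?thesis using yc ic unfolding Units_def by blast
  qed
  have depth: "depth (local_at R n) ?n = krull_dim (local_at R n)"
    using cm n(1) unfolding cohen_macaulay_def ext[symmetric] by blast
  have Jq: "?J \<subseteq> q" by (rule R.Ass_subset[OF J q])
  let ?as = "map (\<lambda>x. loc_frac R ?U x \<one>\<^bsub>R\<^esub>) as"
  have asn: "set as \<subseteq> n" using R.set_adjoins[OF R.zeroideal as(1)] Jq n(2) by blast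
  have 1: "set ?as \<subseteq> ?n" unfolding U.loc_ext_def using asn U.U_one by auto
  have 2: "L.regular_mod {\<zero>\<^bsub>local_at R n\<^esub>} ?as"
    using U.regular_mod_loc_ext[OF R.zeroideal as] by (simp add: U.loc_ext_zero)
  have qU: "p \<inter> ?U = {}" if "p \<subseteq> q" for p using that n(2) by blast
  have 3: "U.loc_ext q \<in> Ass (local_at R n) (L.adjoins {\<zero>\<^bsub>local_at R n\<^esub>} ?as)"
    using U.loc_ext_Ass[OF J q qU] U.loc_ext_adjoins[OF R.zeroideal as(1)] by (simp add: U.loc_ext_zero)
  have "length ps - 1 \<le> length as" if ps: "prime_chain R ps" "last ps = q" for ps
  proof -
    have ne: "ps \<noteq> []" and sps: "sorted_wrt (\<subset>) ps" and pr: "\<forall>p\<in>set ps. primeideal p R"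
      using ps(1) by (simp_all add: prime_chain_def)
    have sub: "x \<subseteq> q" if "x \<in> set ps" for x
    proof -
      obtain i where i: "i < length ps" "x = ps ! i" using \<open>x \<in> set ps\<close> by (metis in_set_conv_nth)
      have "last ps = ps ! (length ps - 1)" using ne by (rule last_conv_nth)
      moreover have "i = length ps - 1 \<or> ps ! i \<subset> ps ! (length ps - 1)"
        using sorted_wrt_nth_less[OF sps, of i "length ps - 1"] i(1) by linarith
      ultimately show ?thesis using i ps(2) by auto
    qed
    have "sorted_wrt (\<subset>) (map U.loc_ext ps)"
      unfolding sorted_wrt_map
    proof (rule sorted_wrt_mono_rel[OF _ sps])
      fix x y assume "x \<in> set ps" "y \<in> set ps" "x \<subset> y"
      then show "U.loc_ext x \<subset> U.loc_ext y"
        using U.loc_ext_prime_strict_mono pr qU sub by metis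
    qed
    moreover have "\<forall>p\<in>set (map U.loc_ext ps). primeideal p (local_at R n)"
      using U.loc_ext_prime pr qU sub by auto
    ultimately have "prime_chain (local_at R n) (map U.loc_ext ps)" using ne by (simp add: prime_chain_def)
    moreover have "last (map U.loc_ext ps) = U.loc_ext q" using ne ps(2) by (simp add: last_map)
    ultimately have "length (map U.loc_ext ps) - 1 \<le> length ?as"
      using primeideal.I_notcarr[OF nP]
      by (intro L.height_Ass_le_of_depth_eq_dim[OF nI _ jac depth 1 2 3]) auto
    then show ?thesis by simp
  qed
  then show ?thesis unfolding prime_height_def by (intro SUP_least) auto
qed

section \<open>Powers of ideals generated by regular sequences\<close>

context cring
begin

text \<open>The product \<open>J^k M\<close>. The second argument is kept because the freeness
  argument compares \<open>J^k\<close>, the case \<open>M = carrier R\<close>, with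
  \<open>J^k I\<close>; taking \<open>M = J\<close> gives \<open>J^(k+1)\<close>.\<close>

primrec pow_times :: "'a set \<Rightarrow> 'a set \<Rightarrow> nat \<Rightarrow> 'a set" where
  "pow_times J M 0 = M"
| "pow_times J M (Suc k) = J \<cdot> pow_times J M k"

lemma ideal_prod_subsetI:
  assumes "ideal C R" "\<And>x y. x \<in> A \<Longrightarrow> y \<in> B \<Longrightarrow> x \<otimes> y \<in> C"
  shows "A \<cdot> B \<subseteq> C"
proof
  interpret C: ideal C R by fact
  fix z assume "z \<in> A \<cdot> B"
  then show "z \<in> C" by induction (use assms(2) in auto)
qed

lemma pow_times_ideal: "ideal J R \<Longrightarrow> ideal M R \<Longrightarrow> ideal (pow_times J M k) R"
  by (induction k) (auto intro: ideal_prod_is_ideal)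

lemma pow_times_Suc': "pow_times J (J \<cdot> M) k = pow_times J M (Suc k)"
  by (induction k) auto

lemma pow_times_carrier_Suc:
  assumes "ideal J R"
  shows "pow_times J (carrier R) (Suc k) = pow_times J J k"
  using pow_times_Suc'[of J "carrier R" k] ideal_prod_one[OF assms] by simp

lemma pow_times_carrier:
  assumes "ideal J R"
  shows "pow_times J (carrier R) k = ideal_power R J k"
proof (induction k)
  case 0 then show ?case by (simp add: ideals_set_def)
next
  case (Suc k)
  have "ideal (pow_times J (carrier R) k) R" using pow_times_ideal assms oneideal by blast
  then show ?case using Suc ideal_prod_commute[OF assms]
    by (simp add: nat_pow_def) (simp add: ideals_set_def)
qed

lemma pow_times_mono:
  assumes "ideal J R" "ideal M R" "J' \<subseteq> J" "M' \<subseteq> M"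
  shows "pow_times J' M' k \<subseteq> pow_times J M k"
proof (induction k)
  case (Suc k)
  have "J' \<cdot> pow_times J' M' k \<subseteq> J \<cdot> pow_times J M k"
    by (rule ideal_prod_subsetI[OF ideal_prod_is_ideal[OF assms(1) pow_times_ideal[OF assms(1,2)]]])
      (use Suc assms(3) in \<open>auto intro: ideal_prod.prod\<close>)
  then show ?case by simp
qed (use assms in simp)

lemma pow_times_subset:
  assumes "ideal J R" "ideal M R"
  shows "pow_times J M (Suc k) \<subseteq> pow_times J M k"
  using ideal_prod_inter[OF assms(1) pow_times_ideal[OF assms], of k] by auto

lemma pow_times_antimono:
  assumes "ideal J R" "ideal M R" "j \<le> k"
  shows "pow_times J M k \<subseteq> pow_times J M j"
  using assms(3)
proof (induction rule: dec_induct)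
  case (step n)
  then show ?case using pow_times_subset[OF assms(1,2), of n] by blast
qed simp

lemma pow_times_mult:
  assumes "ideal J R" "ideal M R" "ideal M' R" "y \<in> carrier R"
    and "\<And>f. f \<in> M \<Longrightarrow> y \<otimes> f \<in> M'" "v \<in> pow_times J M k"
  shows "y \<otimes> v \<in> pow_times J M' k"
  using assms(6)
proof (induction k arbitrary: v)
  case (Suc k)
  interpret C: ideal "pow_times J M' (Suc k)" R by (rule pow_times_ideal[OF assms(1,3)])
  interpret J: ideal J R by fact
  interpret B: ideal "pow_times J M k" R by (rule pow_times_ideal[OF assms(1,2)])
  have "J \<cdot> pow_times J M k \<subseteq> {v \<in> carrier R. y \<otimes> v \<in> pow_times J M' (Suc k)}"
  proof (rule ideal_prod_subsetI)
    show "ideal {v \<in> carrier R. y \<otimes> v \<in> pow_times J M' (Suc k)} R"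
      by (rule ideal_closedI)
        (use assms(4) C.zero_closed in \<open>auto simp: r_distr m_lcomm simp del: pow_times.simps intro: C.I_l_closed\<close>)
    fix a w assume aw: "a \<in> J" "w \<in> pow_times J M k"
    then have "y \<otimes> (a \<otimes> w) = a \<otimes> (y \<otimes> w)" using J.Icarr B.Icarr assms(4) by (simp add: m_lcomm)
    moreover have "a \<otimes> (y \<otimes> w) \<in> pow_times J M' (Suc k)"
      using Suc.IH[OF aw(2)] aw(1) by (auto intro: ideal_prod.prod)
    ultimately show "a \<otimes> w \<in> {v \<in> carrier R. y \<otimes> v \<in> pow_times J M' (Suc k)}"
      using aw J.Icarr B.Icarr by simp
  qed
  then show ?case using Suc.prems by auto
qed (use assms in simp)

text \<open>In a product of \<open>k + 1\<close> factors from \<open>J + Ra\<close>, either every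
  factor contributes from \<open>J\<close>, or one \<open>a\<close> can be pulled out and
  \<open>k\<close> factors remain.\<close>

lemma pow_times_adjoin:
  assumes J: "ideal J R" and a: "a \<in> carrier R" and M: "ideal M R"
    and z: "z \<in> pow_times (adjoin J a) M (Suc k)"
  obtains x y where "x \<in> pow_times J M (Suc k)" "y \<in> pow_times (adjoin J a) M k" "z = x \<oplus> a \<otimes> y"
proof -
  let ?A = "adjoin J a"
  have A: "ideal ?A R" by (rule adjoin_ideal[OF J a])
  interpret J: ideal J R by fact
  let ?D = "\<lambda>k. {x \<oplus> a \<otimes> y |x y. x \<in> pow_times J M (Suc k) \<and> y \<in> pow_times ?A M k}"
  have D: "ideal (?D k) R" for k
  proof -
    interpret X: ideal "pow_times J M (Suc k)" R by (rule pow_times_ideal[OF J M])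
    interpret Y: ideal "pow_times ?A M k" R by (rule pow_times_ideal[OF A M])
    show ?thesis
    proof (rule ideal_closedI)
      show "?D k \<subseteq> carrier R" using X.Icarr Y.Icarr a by auto
      have "\<zero> = \<zero> \<oplus> a \<otimes> \<zero>" using a by simp
      then show "\<zero> \<in> ?D k" using X.zero_closed Y.zero_closed by blast
    next
      fix s t assume "s \<in> ?D k" "t \<in> ?D k"
      then obtain x y x' y' where *: "x \<in> pow_times J M (Suc k)" "y \<in> pow_times ?A M k" "s = x \<oplus> a \<otimes> y"
        "x' \<in> pow_times J M (Suc k)" "y' \<in> pow_times ?A M k" "t = x' \<oplus> a \<otimes> y'" by blast
      have "s \<oplus> t = (x \<oplus> x') \<oplus> a \<otimes> (y \<oplus> y')"
        using * X.Icarr Y.Icarr a by (simp add: r_distr a_ac del: pow_times.simps)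
      then show "s \<oplus> t \<in> ?D k" using X.a_closed[OF *(1,4)] Y.a_closed[OF *(2,5)] by blast
    next
      fix s r assume "s \<in> ?D k" and r: "r \<in> carrier R"
      then obtain x y where *: "x \<in> pow_times J M (Suc k)" "y \<in> pow_times ?A M k" "s = x \<oplus> a \<otimes> y"
        by blast
      have "r \<otimes> s = r \<otimes> x \<oplus> a \<otimes> (r \<otimes> y)"
        using * X.Icarr Y.Icarr a r by (simp add: r_distr m_lcomm del: pow_times.simps)
      then show "r \<otimes> s \<in> ?D k" using X.I_l_closed[OF *(1) r] Y.I_l_closed[OF *(2) r] by blast
    qed
  qed
  have "pow_times ?A M (Suc k) \<subseteq> ?D k"
  proof (induction k)
    case 0
    interpret M: ideal M R by fact
    have "?A \<cdot> M \<subseteq> ?D 0"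
    proof (rule ideal_prod_subsetI[OF D])
      fix b v assume b: "b \<in> ?A" and v: "v \<in> M"
      obtain j r where jr: "j \<in> J" "r \<in> carrier R" "b = j \<oplus> r \<otimes> a"
        using b by (auto simp: adjoin_def)
      have "b \<otimes> v = j \<otimes> v \<oplus> a \<otimes> (r \<otimes> v)"
        unfolding jr(3) using jr(2) a J.Icarr[OF jr(1)] M.Icarr[OF v] by (simp add: l_distr m_assoc m_lcomm)
      moreover have "j \<otimes> v \<in> J \<cdot> M" using jr v by (intro ideal_prod.prod)
      moreover have "r \<otimes> v \<in> M" using jr v by (simp add: M.I_l_closed)
      ultimately show "b \<otimes> v \<in> ?D 0" by auto
    qed
    then show ?case by simp
  next
    case (Suc k)
    have V: "ideal (pow_times ?A M (Suc k)) R" by (rule pow_times_ideal[OF A M])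
    have X: "ideal (pow_times J M (Suc k)) R" by (rule pow_times_ideal[OF J M])
    have Y: "ideal (pow_times ?A M k) R" by (rule pow_times_ideal[OF A M])
    have "?A \<cdot> pow_times ?A M (Suc k) \<subseteq> ?D (Suc k)"
    proof (rule ideal_prod_subsetI[OF D[of "Suc k"]])
      fix b v assume b: "b \<in> ?A" and v: "v \<in> pow_times ?A M (Suc k)"
      obtain j r where jr: "j \<in> J" "r \<in> carrier R" "b = j \<oplus> r \<otimes> a"
        using b by (auto simp: adjoin_def)
      obtain x y where xy: "x \<in> pow_times J M (Suc k)" "y \<in> pow_times ?A M k" "v = x \<oplus> a \<otimes> y"
        using Suc v by blast
      have carr: "j \<in> carrier R" "v \<in> carrier R" "x \<in> carrier R" "y \<in> carrier R"
        using jr J.Icarr ideal.Icarr[OF V v] ideal.Icarr[OF X xy(1)] ideal.Icarr[OF Y xy(2)] by auto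
      have "b \<otimes> v = j \<otimes> v \<oplus> a \<otimes> (r \<otimes> v)"
        unfolding jr(3) using jr(2) carr a by (simp add: l_distr m_assoc m_lcomm)
      also have "j \<otimes> v = j \<otimes> x \<oplus> a \<otimes> (j \<otimes> y)" unfolding xy(3) using carr a by (simp add: r_distr m_lcomm)
      finally have "b \<otimes> v = j \<otimes> x \<oplus> a \<otimes> (j \<otimes> y \<oplus> r \<otimes> v)"
        using carr jr(2) a by (simp add: r_distr a_assoc)
      moreover have "j \<otimes> x \<in> pow_times J M (Suc (Suc k))"
        using jr(1) xy(1) ideal_prod.prod[of j J x "pow_times J M (Suc k)" R] by simp
      moreover have "j \<otimes> y \<in> pow_times ?A M (Suc k)"
        using jr(1) xy(2) adjoin_subset[OF J a] ideal_prod.prod[of j ?A y "pow_times ?A M k" R] by auto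
      then have "j \<otimes> y \<oplus> r \<otimes> v \<in> pow_times ?A M (Suc k)"
        using ideal.I_l_closed[OF V v jr(2)] additive_subgroup.a_closed[OF ideal.axioms(1)[OF V]] by blast
      ultimately show "b \<otimes> v \<in> ?D (Suc k)" by blast
    qed
    then show ?case by simp
  qed
  then show ?thesis using z that by blast
qed

text \<open>Two decompositions of one element differ by moving \<open>a t\<close>, with
  \<open>t = y - y'\<close>, from one summand to the other; how far a decomposition is unique thus
  depends on what follows from \<open>a t\<close> lying in \<open>K\<close>.\<close>

lemma pow_times_add_swap:
  assumes "ideal K R" "x \<in> K" "x' \<in> K" "y \<in> carrier R" "y' \<in> carrier R" "a \<in> carrier R"
    and "x \<oplus> a \<otimes> y = x' \<oplus> a \<otimes> y'"
  shows "a \<otimes> (y \<ominus> y') \<in> K" "x = x' \<ominus> a \<otimes> (y \<ominus> y')"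
proof -
  interpret K: ideal K R by fact
  have carr: "x \<in> carrier R" "x' \<in> carrier R" using assms K.Icarr by auto
  have "a \<otimes> (y \<ominus> y') = a \<otimes> y \<ominus> a \<otimes> y'" using assms by (simp add: minus_eq r_distr r_minus)
  also have "\<dots> = x' \<ominus> x" using assms carr by (intro diff_eq_diff) auto
  finally have *: "a \<otimes> (y \<ominus> y') = x' \<ominus> x" .
  then show "a \<otimes> (y \<ominus> y') \<in> K" using assms K.I_minus_closed by simp
  show "x = x' \<ominus> a \<otimes> (y \<ominus> y')" unfolding * using carr by (simp add: add_minus_cancel)
qed

text \<open>Freeness of \<open>J\<^sup>k/J\<^sup>kI\<close> over \<open>R/I\<close> for \<open>J\<close> generated by a regular sequence, expressed through
  annihilators so that no monomials in the generators are needed.\<close>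

lemma regular_mod_pow_times_annihilator:
  assumes "ideal I R" "set as \<subseteq> I" "regular_mod {\<zero>} as"
    and "z \<in> pow_times (adjoins {\<zero>} as) (carrier R) k" "z \<notin> pow_times (adjoins {\<zero>} as) I k"
  shows "\<exists>s\<in>carrier R. s \<notin> I \<and>
    (\<forall>u\<in>carrier R. u \<otimes> z \<in> pow_times (adjoins {\<zero>} as) I k \<longrightarrow> u \<otimes> s \<in> I)"
  using assms
proof (induction as arbitrary: I k z rule: rev_induct)
  case Nil
  show ?case
  proof (cases k)
    case 0
    then show ?thesis using Nil.prems by auto
  next
    case (Suc k')
    have "pow_times {\<zero>} (carrier R) (Suc k') \<subseteq> {\<zero>}"
      using pow_times_antimono[OF zeroideal oneideal, of 1 "Suc k'"]
        ideal_prod_inter[OF zeroideal oneideal] by auto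
    then have "z = \<zero>" using Nil.prems(4) Suc by auto
    moreover have "\<zero> \<in> pow_times {\<zero>} I k"
      using pow_times_ideal[OF zeroideal Nil.prems(1)] additive_subgroup.zero_closed ideal.axioms(1)
      by blast
    ultimately show ?thesis using Nil.prems(5) by simp
  qed
next
  case (snoc a as)
  let ?J' = "adjoins {\<zero>} as"
  let ?J = "adjoin ?J' a"
  note I = snoc.prems(1)
  interpret I: ideal I R by fact
  have carr: "set as \<subseteq> carrier R" "a \<in> carrier R" "a \<in> I" "set as \<subseteq> I" using snoc.prems(2) I.Icarr by auto
  have J': "ideal ?J' R" by (rule adjoins_ideal[OF zeroideal carr(1)])
  have J: "ideal ?J R" by (rule adjoin_ideal[OF J' carr(2)])
  have J'J: "?J' \<subseteq> ?J" by (rule adjoin_subset[OF J' carr(2)])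
  have J'I: "?J' \<subseteq> I" by (rule adjoins_minimal[OF I]) (use carr I.zero_closed in auto)
  have reg: "regular_mod {\<zero>} as" "regular_on ?J' a"
    using snoc.prems(3) by (simp_all add: regular_mod_append)
  have Jeq: "adjoins {\<zero>} (as @ [a]) = ?J" by (simp add: adjoins_append)
  \<comment> \<open>The element \<open>a\<close> stays regular modulo all powers of
    \<open>?J'\<close>: if \<open>r\<close> lies in the \<open>j\<close>-th power but not in the
    next one, the induction hypothesis with \<open>?J'\<close> in place of \<open>I\<close> provides
    an \<open>s\<close> outside \<open>?J'\<close> with \<open>a s\<close> in \<open>?J'\<close>,
    against regularity of \<open>a\<close>.\<close>
  have regpow: "r \<in> pow_times ?J' (carrier R) k"
    if r: "r \<in> carrier R" "a \<otimes> r \<in> pow_times ?J' (carrier R) k" for r k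
  proof -
    have "j \<le> k \<Longrightarrow> r \<in> pow_times ?J' (carrier R) j" for j
    proof (induction j)
      case (Suc j)
      show ?case
      proof (rule ccontr)
        assume "r \<notin> pow_times ?J' (carrier R) (Suc j)"
        then have "r \<notin> pow_times ?J' ?J' j" using pow_times_carrier_Suc[OF J'] by simp
        moreover have "r \<in> pow_times ?J' (carrier R) j" using Suc by simp
        ultimately obtain s where s: "s \<in> carrier R" "s \<notin> ?J'"
          "\<forall>u\<in>carrier R. u \<otimes> r \<in> pow_times ?J' ?J' j \<longrightarrow> u \<otimes> s \<in> ?J'"
          using snoc.IH[OF J' set_adjoins[OF zeroideal carr(1)] reg(1)] by blast
        have "a \<otimes> r \<in> pow_times ?J' (carrier R) (Suc j)"
          using r(2) pow_times_antimono[OF J' oneideal Suc.prems] by blast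
        then have "a \<otimes> s \<in> ?J'" using s(3) carr(2) pow_times_carrier_Suc[OF J'] by simp
        then show False using regular_onD[OF reg(2)] s by blast
      qed
    qed (use r in simp)
    then show ?thesis by simp
  qed
  have "\<exists>s\<in>carrier R. s \<notin> I \<and> (\<forall>u\<in>carrier R. u \<otimes> z \<in> pow_times ?J I k \<longrightarrow> u \<otimes> s \<in> I)"
    if "z \<in> pow_times ?J (carrier R) k" "z \<notin> pow_times ?J I k" for z k
    using that
  proof (induction k arbitrary: z)
    case 0
    then show ?case by auto
  next
    case (Suc k)
    interpret X: ideal "pow_times ?J' (carrier R) (Suc k)" R by (rule pow_times_ideal[OF J' oneideal])
    interpret Y: ideal "pow_times ?J (carrier R) k" R by (rule pow_times_ideal[OF J oneideal])
    interpret XI: ideal "pow_times ?J' I (Suc k)" R by (rule pow_times_ideal[OF J' I])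
    interpret YI: ideal "pow_times ?J I k" R by (rule pow_times_ideal[OF J I])
    interpret ZI: ideal "pow_times ?J I (Suc k)" R by (rule pow_times_ideal[OF J I])
    obtain x y where xy: "x \<in> pow_times ?J' (carrier R) (Suc k)" "y \<in> pow_times ?J (carrier R) k"
      "z = x \<oplus> a \<otimes> y" by (rule pow_times_adjoin[OF J' carr(2) oneideal Suc.prems(1)])
    have xyc: "x \<in> carrier R" "y \<in> carrier R" using X.Icarr[OF xy(1)] Y.Icarr[OF xy(2)] by auto
    have XIX: "pow_times ?J' I (Suc k) \<subseteq> pow_times ?J' (carrier R) (Suc k)"
      by (rule pow_times_mono[OF J' oneideal]) (use I.Icarr in auto)
    \<comment> \<open>The decomposition \<open>z = x + a y\<close> is not unique. The discrepancy
      \<open>t\<close> satisfies \<open>a t\<close> in \<open>J'^(k+1)\<close>, so \<open>t\<close>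
      is in \<open>J'^(k+1)\<close> by \<open>regpow\<close>; hence \<open>a t\<close> is in
      \<open>J'^(k+1) I\<close>, as \<open>a\<close> is in \<open>I\<close>, and \<open>t\<close> is
      in \<open>J^k I\<close>, as \<open>J'\<close> lies in both \<open>J\<close> and
      \<open>I\<close>. So membership of \<open>u z\<close> in \<open>J^(k+1) I\<close> passes to
      both summands.\<close>
    have key: "u \<otimes> x \<in> pow_times ?J' I (Suc k) \<and> u \<otimes> y \<in> pow_times ?J I k"
      if u: "u \<in> carrier R" "u \<otimes> z \<in> pow_times ?J I (Suc k)" for u
    proof -
      obtain v w where vw: "v \<in> pow_times ?J' I (Suc k)" "w \<in> pow_times ?J I k" "u \<otimes> z = v \<oplus> a \<otimes> w"
        by (rule pow_times_adjoin[OF J' carr(2) I u(2)])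
      have wc: "w \<in> carrier R" using YI.Icarr[OF vw(2)] .
      let ?t = "u \<otimes> y \<ominus> w"
      have tc: "?t \<in> carrier R" using u xyc wc by simp
      have eq: "u \<otimes> x \<oplus> a \<otimes> (u \<otimes> y) = v \<oplus> a \<otimes> w"
        using vw(3) u(1) xyc carr(2) unfolding xy(3) by (simp add: r_distr m_lcomm)
      have ux: "u \<otimes> x \<in> pow_times ?J' (carrier R) (Suc k)" by (rule X.I_l_closed[OF xy(1) u(1)])
      have v: "v \<in> pow_times ?J' (carrier R) (Suc k)" using vw(1) XIX by blast
      have uy: "u \<otimes> y \<in> carrier R" using u xyc by simp
      note sw = pow_times_add_swap[OF X.is_ideal ux v uy wc carr(2) eq]
      have t: "?t \<in> pow_times ?J' (carrier R) (Suc k)" by (rule regpow[OF tc sw(1)])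
      have "a \<otimes> ?t \<in> pow_times ?J' I (Suc k)"
        by (rule pow_times_mult[OF J' oneideal I carr(2) _ t]) (rule I.I_r_closed[OF carr(3)])
      then have 1: "u \<otimes> x \<in> pow_times ?J' I (Suc k)" using sw(2) vw(1) XI.I_minus_closed by simp
      have "?t \<in> pow_times ?J' ?J' k" using t pow_times_carrier_Suc[OF J'] by simp
      then have "?t \<in> pow_times ?J I k" using pow_times_mono[OF J I J'J J'I] by blast
      then have "?t \<oplus> w \<in> pow_times ?J I k" using vw(2) YI.a_closed by blast
      moreover have "?t \<oplus> w = u \<otimes> y" using uy wc by (simp add: add_minus_cancel)
      ultimately show ?thesis using 1 by simp
    qed
    show ?case
    \<comment> \<open>One of the two summands misses its target; the \<open>s\<close> belonging to
      that summand serves for \<open>z\<close> by \<open>key\<close>.\<close>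
    proof (cases "x \<in> pow_times ?J' I (Suc k)")
      case False
      obtain s where "s \<in> carrier R" "s \<notin> I"
        "\<forall>u\<in>carrier R. u \<otimes> x \<in> pow_times ?J' I (Suc k) \<longrightarrow> u \<otimes> s \<in> I"
        using snoc.IH[OF I carr(4) reg(1) xy(1) False] by blast
      then show ?thesis using key by blast
    next
      case True
      have "y \<notin> pow_times ?J I k"
      proof
        assume y: "y \<in> pow_times ?J I k"
        have "a \<otimes> y \<in> pow_times ?J I (Suc k)"
          using mem_adjoin[OF J' carr(2)] y by (auto intro: ideal_prod.prod)
        moreover have "x \<in> pow_times ?J I (Suc k)"
          using True pow_times_mono[OF J I J'J, of I "Suc k"] by blast
        ultimately show False using Suc.prems(2) xy(3) ZI.a_closed by blast
      qed
      then obtain s where "s \<in> carrier R" "s \<notin> I"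
        "\<forall>u\<in>carrier R. u \<otimes> y \<in> pow_times ?J I k \<longrightarrow> u \<otimes> s \<in> I"
        using Suc.IH[OF xy(2)] by blast
      then show ?thesis using key by blast
    qed
  qed
  then show ?case using snoc.prems(4,5) Jeq by simp
qed

text \<open>In a product of \<open>j + 1\<close> factors from \<open>I\<close>, each of
  \<open>j\<close> factors absorbs one \<open>y\<close> and moves into \<open>J\<close>, while the
  last stays in \<open>I\<close>.\<close>

lemma pow_times_pow_mult:
  assumes "ideal I R" "ideal J R" "y \<in> carrier R" "\<And>f. f \<in> I \<Longrightarrow> y \<otimes> f \<in> J"
    and "v \<in> pow_times I I j"
  shows "y [^] j \<otimes> v \<in> pow_times J I j"
  using assms(5)
proof (induction j arbitrary: v)
  case 0
  then show ?case using assms(1) ideal.Icarr by fastforce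
next
  case (Suc j)
  interpret I: ideal I R by fact
  interpret C: ideal "pow_times J I (Suc j)" R by (rule pow_times_ideal[OF assms(2,1)])
  interpret B: ideal "pow_times I I j" R by (rule pow_times_ideal[OF assms(1,1)])
  let ?C = "{v \<in> carrier R. y [^] Suc j \<otimes> v \<in> pow_times J I (Suc j)}"
  have yj: "y [^] Suc j \<in> carrier R" using assms(3) by (rule nat_pow_closed)
  have "I \<cdot> pow_times I I j \<subseteq> ?C"
  proof (rule ideal_prod_subsetI)
    show "ideal ?C R"
      by (rule ideal_closedI)
        (use yj C.zero_closed in \<open>auto simp: r_distr m_lcomm simp del: pow_times.simps nat_pow_Suc intro: C.I_l_closed\<close>)
    fix f w assume fw: "f \<in> I" "w \<in> pow_times I I j"
    have c: "f \<in> carrier R" "w \<in> carrier R" using fw I.Icarr B.Icarr by auto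
    have "y [^] Suc j \<otimes> (f \<otimes> w) = (y \<otimes> f) \<otimes> (y [^] j \<otimes> w)"
      using c assms(3) by (simp add: m_ac)
    also have "\<dots> \<in> pow_times J I (Suc j)"
      using assms(4)[OF fw(1)] Suc.IH[OF fw(2)] by (auto intro: ideal_prod.prod)
    finally show "f \<otimes> w \<in> ?C" using c by simp
  qed
  then show ?case using Suc.prems by auto
qed

end

section \<open>Symbolic powers as saturated powers\<close>

context noetherian_cring
begin

text \<open>By induction \<open>y^k x\<close> lies in \<open>J^k I\<close>. One more factor
  \<open>y\<close> brings it into \<open>J^(k+1)\<close>; if it missed \<open>J^(k+1) I\<close>,
  freeness would give \<open>s\<close> outside \<open>I\<close> such that every \<open>u\<close>
  with \<open>u x\<close> in \<open>I^(n+1)\<close> satisfies \<open>u s\<close> in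
  \<open>I\<close>. All these \<open>u\<close> then lie in one associated prime of \<open>I\<close>,
  contrary to the assumption on \<open>x\<close>.\<close>

lemma saturated_power_mult:
  assumes I: "ideal I R" and as: "set as \<subseteq> I" "regular_mod {\<zero>} as"
    and y: "y \<in> carrier R" "\<And>f. f \<in> I \<Longrightarrow> y \<otimes> f \<in> adjoins {\<zero>} as"
    and x: "x \<in> carrier R"
      "\<And>p. p \<in> Ass R I \<Longrightarrow> \<exists>u\<in>carrier R - p. u \<otimes> x \<in> ideal_power R I (Suc n)"
  shows "y [^] n \<otimes> x \<in> ideal_power R I (Suc n)"
proof -
  interpret I: ideal I R by fact
  let ?J = "adjoins {\<zero>} as"
  have asc: "set as \<subseteq> carrier R" using as I.Icarr by auto
  have J: "ideal ?J R" by (rule adjoins_ideal[OF zeroideal asc])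
  have JI: "?J \<subseteq> I" by (rule adjoins_minimal[OF I]) (use as I.zero_closed in auto)
  have pw: "ideal_power R I (Suc n) = pow_times I I n"
    using pow_times_carrier[OF I] pow_times_carrier_Suc[OF I] by metis
  have sat: "False" if s: "s \<in> carrier R" "s \<notin> I"
    "\<And>u. u \<in> carrier R \<Longrightarrow> u \<otimes> x \<in> pow_times I I n \<Longrightarrow> u \<otimes> s \<in> I" for s
  proof -
    obtain p where p: "p \<in> Ass R I" "colon_ideal R I {s} \<subseteq> p"
      by (rule colon_ideal_subset_Ass[OF I s(1,2)])
    obtain u where u: "u \<in> carrier R - p" "u \<otimes> x \<in> pow_times I I n" using x(2)[OF p(1)] pw by auto
    then have "u \<otimes> s \<in> I" using s(3) by blast
    then have "u \<in> colon_ideal R I {s}" using u(1) by (simp add: in_colon_ideal_iff)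
    then show False using p(2) u(1) by blast
  qed
  have "k \<le> n \<Longrightarrow> y [^] k \<otimes> x \<in> pow_times ?J I k" for k
  proof (induction k)
    case 0
    \<comment> \<open>The start costs no factor \<open>y\<close>: \<open>sat\<close> with
      \<open>s = x\<close> already gives \<open>x\<close> in \<open>I\<close>.\<close>
    have "x \<in> I"
    proof (rule ccontr)
      assume "x \<notin> I"
      then show False
        using sat[OF x(1)] pow_times_antimono[OF I I, of 0 n] by auto
    qed
    then show ?case using x(1) by simp
  next
    case (Suc k)
    let ?z = "y [^] Suc k \<otimes> x"
    have yk: "y [^] k \<in> carrier R" "y [^] Suc k \<in> carrier R" using y(1) by (auto intro: nat_pow_closed)
    have "y \<otimes> (y [^] k \<otimes> x) \<in> pow_times ?J ?J k"
      by (rule pow_times_mult[OF J I J y]) (use Suc in auto)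
    moreover have "y \<otimes> (y [^] k \<otimes> x) = ?z" using yk(1) y(1) x(1) by (simp add: m_ac)
    ultimately have z: "?z \<in> pow_times ?J (carrier R) (Suc k)" using pow_times_carrier_Suc[OF J] by simp
    show ?case
    proof (rule ccontr)
      assume "?z \<notin> pow_times ?J I (Suc k)"
      then obtain s where s: "s \<in> carrier R" "s \<notin> I"
        "\<forall>u\<in>carrier R. u \<otimes> ?z \<in> pow_times ?J I (Suc k) \<longrightarrow> u \<otimes> s \<in> I"
        using regular_mod_pow_times_annihilator[OF I as z] by blast
      show False
      proof (rule sat[OF s(1,2)])
        fix u assume u: "u \<in> carrier R" "u \<otimes> x \<in> pow_times I I n"
        \<comment> \<open>As \<open>k < n\<close>, the power \<open>I^(n+1)\<close> lies in
          \<open>I^(k+2)\<close>: just enough for \<open>k + 1\<close> factors \<open>y\<close> and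
          a last factor left in \<open>I\<close>.\<close>
        then have "u \<otimes> x \<in> pow_times I I (Suc k)" using pow_times_antimono[OF I I Suc.prems] by blast
        then have "y [^] Suc k \<otimes> (u \<otimes> x) \<in> pow_times ?J I (Suc k)"
          using pow_times_pow_mult[OF I J y(1)] y(2) by blast
        moreover have "y [^] Suc k \<otimes> (u \<otimes> x) = u \<otimes> ?z" using yk(2) u(1) x(1) by (rule m_lcomm)
        ultimately show "u \<otimes> s \<in> I" using s(3) u(1) by simp
      qed
    qed
  qed
  from this[of n] show ?thesis using pow_times_mono[OF I I JI, of I n] pw by auto
qed

text \<open>The contraction condition at \<open>p\<close>, cleared of denominators.\<close>

lemma symbolic_power_saturated:
  assumes I: "ideal I R" and x: "x \<in> symbolic_power R I m" and p: "p \<in> Ass R I"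
  shows "\<exists>u\<in>carrier R - p. u \<otimes> x \<in> ideal_power R I m"
proof -
  interpret p: primeideal p R using p by (simp add: Ass_def)
  interpret U: mult_closed R "carrier R - p" by (rule p.mult_closed_compl)
  have P: "ideal (ideal_power R I m) R"
    using pow_times_ideal[OF I oneideal] pow_times_carrier[OF I] by metis
  have "x \<in> carrier R" "loc_frac R (carrier R - p) x \<one> \<in> extend_local R p (ideal_power R I m)"
    using x p by (auto simp: symbolic_power_def contract_local_def to_local_def)
  moreover have "extend_local R p (ideal_power R I m) = U.loc_ext (ideal_power R I m)"
    unfolding extend_local_def to_local_def by (rule U.Idl_localization[OF P])
  ultimately show ?thesis using U.loc_frac_mem_loc_ext[OF P _ U.U_one] by simp
qed

end

section \<open>Determinants and minors\<close>

context cring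
begin

definition det_term :: "nat \<Rightarrow> (nat \<Rightarrow> nat \<Rightarrow> 'a) \<Rightarrow> (nat \<Rightarrow> nat) \<Rightarrow> 'a" where
  "det_term t N \<pi> = [sign \<pi>] \<cdot> (\<Otimes>i\<in>{..<t}. N i (\<pi> i))"

definition entries_in :: "nat \<Rightarrow> nat \<Rightarrow> (nat \<Rightarrow> nat \<Rightarrow> 'a) \<Rightarrow> bool" where
  [simp]: "entries_in m n N \<longleftrightarrow> (\<forall>i<m. \<forall>j<n. N i j \<in> carrier R)"

lemma matrix_det_eq: "matrix_det R t N = (\<Oplus>\<pi>\<in>{\<pi>. \<pi> permutes {..<t}}. det_term t N \<pi>)"
  by (simp add: matrix_det_def det_term_def)

lemma sign_add_pow:
  assumes "x \<in> carrier R"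
  shows "[sign \<pi>] \<cdot> x = (if evenperm \<pi> then x else \<ominus> x)"
  using assms by (simp add: sign_def add.int_pow_neg)

text \<open>The sign as an element of the ring, so that it can be multiplied, distributed over sums
  and squared inside \<open>R\<close>, in place of the integer multiple in
  \<open>matrix_det\<close>.\<close>

definition sgn_elt :: "(nat \<Rightarrow> nat) \<Rightarrow> 'a" where
  "sgn_elt \<pi> = (if evenperm \<pi> then \<one> else \<ominus> \<one>)"

lemma sgn_elt_closed [simp]: "sgn_elt \<pi> \<in> carrier R"
  by (simp add: sgn_elt_def)

lemma permutes_less: "\<pi> permutes {..<t} \<Longrightarrow> i < t \<Longrightarrow> \<pi> i < (t::nat)"
  using permutes_in_image by fastforce

lemma entries_closed:
  fixes N :: "nat \<Rightarrow> nat \<Rightarrow> 'a"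
  assumes "entries_in t t N" "\<pi> permutes {..<t}"
  shows "(\<lambda>i. N i (\<pi> i)) \<in> {..<t} \<rightarrow> carrier R"
  using assms permutes_less by auto

lemma det_term_sgn:
  assumes "entries_in t t N" "\<pi> permutes {..<t}"
  shows "det_term t N \<pi> = sgn_elt \<pi> \<otimes> (\<Otimes>i\<in>{..<t}. N i (\<pi> i))"
proof -
  have "(\<Otimes>i\<in>{..<t}. N i (\<pi> i)) \<in> carrier R"
    by (rule finprod_closed[OF entries_closed[OF assms]])
  then show ?thesis by (simp add: det_term_def sign_add_pow sgn_elt_def l_minus)
qed

lemma det_term_closed:
  fixes N :: "nat \<Rightarrow> nat \<Rightarrow> 'a"
  assumes "entries_in t t N" "\<pi> permutes {..<t}"
  shows "det_term t N \<pi> \<in> carrier R"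
  unfolding det_term_sgn[OF assms]
  by (rule m_closed[OF sgn_elt_closed finprod_closed[OF entries_closed[OF assms]]])

lemma matrix_det_closed:
  assumes "entries_in t t N"
  shows "matrix_det R t N \<in> carrier R"
  unfolding matrix_det_eq using det_term_closed[OF assms] by (intro finsum_closed) auto

lemma matrix_det_cong:
  assumes "\<And>i j. i < t \<Longrightarrow> j < t \<Longrightarrow> N i j = N' i j"
    and "entries_in t t N'"
  shows "matrix_det R t N = matrix_det R t N'"
  unfolding matrix_det_eq
proof (rule finsum_cong')
  fix \<pi> assume "\<pi> \<in> {\<pi>. \<pi> permutes {..<t}}"
  then have \<pi>: "\<pi> permutes {..<t}" by simp
  have "(\<Otimes>i\<in>{..<t}. N i (\<pi> i)) = (\<Otimes>i\<in>{..<t}. N' i (\<pi> i))"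
    by (rule finprod_cong') (use assms permutes_less[OF \<pi>] in auto)
  then show "det_term t N \<pi> = det_term t N' \<pi>" by (simp add: det_term_def)
qed (use det_term_closed[of t N'] assms in auto)

lemma finprod_permute:
  fixes \<kappa> :: "nat \<Rightarrow> nat" and t :: nat
  assumes "\<kappa> permutes {..<t}" "f \<in> {..<t} \<rightarrow> carrier R"
  shows "(\<Otimes>i\<in>{..<t}. f (\<kappa> i)) = (\<Otimes>i\<in>{..<t}. f i)"
  using finprod_reindex[of f \<kappa> "{..<t}"] assms permutes_image[OF assms(1)] permutes_inj_on[OF assms(1)]
  by simp

lemma finsum_bij:
  assumes "bij_betw h P P" "\<And>x. x \<in> P \<Longrightarrow> f x \<in> carrier R"
  shows "finsum R f P = finsum R (\<lambda>x. f (h x)) P"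
  using finsum_reindex[of f h P] assms by (auto simp: bij_betw_def)

lemma bij_betw_permutes_comp:
  fixes \<kappa> :: "nat \<Rightarrow> nat"
  assumes "\<kappa> permutes S"
  shows "bij_betw (\<lambda>\<pi>. \<pi> \<circ> \<kappa>) {\<pi>. \<pi> permutes S} {\<pi>. \<pi> permutes S}"
proof (rule bij_betw_byWitness[where f' = "\<lambda>\<pi>. \<pi> \<circ> Hilbert_Choice.inv \<kappa>"])
  show "\<forall>a\<in>{\<pi>. \<pi> permutes S}. (a \<circ> \<kappa>) \<circ> Hilbert_Choice.inv \<kappa> = a"
    using permutes_inv_o[OF assms] by (simp add: o_assoc[symmetric])
  show "\<forall>a\<in>{\<pi>. \<pi> permutes S}. (a \<circ> Hilbert_Choice.inv \<kappa>) \<circ> \<kappa> = a"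
    using permutes_inv_o[OF assms] by (simp add: o_assoc[symmetric])
qed (use permutes_compose[OF assms] permutes_compose[OF permutes_inv[OF assms]] in auto)

lemma bij_betw_permutes_inv:
  "bij_betw Hilbert_Choice.inv {\<pi>. \<pi> permutes (S :: nat set)} {\<pi>. \<pi> permutes S}"
  by (rule bij_betw_byWitness[where f' = Hilbert_Choice.inv]) (auto simp: permutes_inv permutes_inv_inv)

text \<open>Reindexing by inverse permutations, which have the same sign.\<close>

lemma matrix_det_transpose:
  fixes N :: "nat \<Rightarrow> nat \<Rightarrow> 'a"
  assumes N: "entries_in t t N"
  shows "matrix_det R t (\<lambda>i j. N j i) = matrix_det R t N"
proof -
  let ?P = "{\<pi>. \<pi> permutes {..<t}}"
  have "matrix_det R t (\<lambda>i j. N j i) = (\<Oplus>\<pi>\<in>?P. det_term t (\<lambda>i j. N j i) (Hilbert_Choice.inv \<pi>))"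
    unfolding matrix_det_eq
    by (rule finsum_bij[OF bij_betw_permutes_inv]) (use det_term_closed[of t "\<lambda>i j. N j i"] N in auto)
  also have "\<dots> = matrix_det R t N"
    unfolding matrix_det_eq
  proof (rule finsum_cong')
    fix \<pi> assume "\<pi> \<in> ?P"
    then have \<pi>: "\<pi> permutes {..<t}" by simp
    have perm: "permutation \<pi>" using \<pi> by (auto simp: permutation_permutes)
    have "(\<Otimes>i\<in>{..<t}. N (Hilbert_Choice.inv \<pi> i) i) = (\<Otimes>i\<in>{..<t}. N (Hilbert_Choice.inv \<pi> (\<pi> i)) (\<pi> i))"
      by (rule finprod_permute[OF \<pi>, symmetric]) (use N permutes_less[OF permutes_inv[OF \<pi>]] in auto)
    also have "\<dots> = (\<Otimes>i\<in>{..<t}. N i (\<pi> i))" using permutes_inverses[OF \<pi>] by simp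
    finally show "det_term t (\<lambda>i j. N j i) (Hilbert_Choice.inv \<pi>) = det_term t N \<pi>"
      using sign_inverse[OF perm] by (simp add: det_term_def)
  qed (use det_term_closed N in auto)
  finally show ?thesis .
qed

lemma sgn_elt_comp:
  fixes t :: nat
  assumes "\<pi> permutes {..<t}" "\<kappa> permutes {..<t}"
  shows "sgn_elt (\<pi> \<circ> \<kappa>) = sgn_elt \<kappa> \<otimes> sgn_elt \<pi>"
proof -
  have "permutation \<pi>" "permutation \<kappa>" using assms by (auto simp: permutation_permutes)
  then show ?thesis by (simp add: sgn_elt_def evenperm_comp l_minus r_minus)
qed

lemma det_term_comp:
  fixes t :: nat
  assumes N: "entries_in t t N"
    and \<pi>: "\<pi> permutes {..<t}" and \<kappa>: "\<kappa> permutes {..<t}"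
  shows "det_term t (\<lambda>i. N (\<kappa> i)) (\<pi> \<circ> \<kappa>) = sgn_elt \<kappa> \<otimes> det_term t N \<pi>"
proof -
  have "(\<Otimes>i\<in>{..<t}. N (\<kappa> i) (\<pi> (\<kappa> i))) = (\<Otimes>i\<in>{..<t}. N i (\<pi> i))"
    by (rule finprod_permute[OF \<kappa>]) (rule entries_closed[OF N \<pi>])
  then show ?thesis
    using det_term_sgn[of t "\<lambda>i. N (\<kappa> i)" "\<pi> \<circ> \<kappa>"] det_term_sgn[OF N \<pi>] N permutes_less[OF \<kappa>]
      permutes_compose[OF \<kappa> \<pi>] sgn_elt_comp[OF \<pi> \<kappa>] finprod_closed[OF entries_closed[OF N \<pi>]]
    by (simp add: m_assoc)
qed

lemma matrix_det_permute_rows: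
  fixes t :: nat
  assumes N: "entries_in t t N" and \<kappa>: "\<kappa> permutes {..<t}"
  shows "matrix_det R t (\<lambda>i. N (\<kappa> i)) = sgn_elt \<kappa> \<otimes> matrix_det R t N"
proof -
  let ?P = "{\<pi>. \<pi> permutes {..<t}}"
  have "matrix_det R t (\<lambda>i. N (\<kappa> i)) = (\<Oplus>\<pi>\<in>?P. det_term t (\<lambda>i. N (\<kappa> i)) (\<pi> \<circ> \<kappa>))"
    unfolding matrix_det_eq
    by (rule finsum_bij[OF bij_betw_permutes_comp[OF \<kappa>]])
      (use det_term_closed[of t "\<lambda>i. N (\<kappa> i)"] N permutes_less[OF \<kappa>] in auto)
  also have "\<dots> = (\<Oplus>\<pi>\<in>?P. sgn_elt \<kappa> \<otimes> det_term t N \<pi>)"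
    by (rule finsum_cong') (use det_term_comp[OF N _ \<kappa>] det_term_closed[OF N] in auto)
  also have "\<dots> = sgn_elt \<kappa> \<otimes> matrix_det R t N"
    unfolding matrix_det_eq
    by (rule finsum_rdistr[symmetric]) (use det_term_closed[OF N] finite_permutations in auto)
  finally show ?thesis .
qed

text \<open>The permutations are paired through a transposition; deducing \<open>det = - det\<close> from the row
  exchange would fail in characteristic two.\<close>

lemma matrix_det_equal_rows:
  assumes N: "entries_in t t N"
    and il: "i < t" "l < t" "i \<noteq> l" "\<And>j. j < t \<Longrightarrow> N i j = N l j"
  shows "matrix_det R t N = \<zero>"
proof -
  let ?P = "{\<pi>. \<pi> permutes {..<t}}"
  let ?E = "{\<pi>. \<pi> permutes {..<t} \<and> evenperm \<pi>}" and ?O = "{\<pi>. \<pi> permutes {..<t} \<and> \<not> evenperm \<pi>}"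
  define \<tau> where "\<tau> = transpose i l"
  have \<tau>: "\<tau> permutes {..<t}" unfolding \<tau>_def by (rule permutes_swap_id) (use il in auto)
  have \<tau>odd: "\<not> evenperm \<tau>" unfolding \<tau>_def using il by (simp add: evenperm_swap)
  have even_comp: "evenperm (\<pi> \<circ> \<tau>) \<longleftrightarrow> \<not> evenperm \<pi>" if "\<pi> permutes {..<t}" for \<pi>
    using evenperm_comp[of \<pi> \<tau>] that \<tau> \<tau>odd by (auto simp: permutation_permutes)
  have fin: "finite ?P" by (simp add: finite_permutations)
  have bij: "inj_on (\<lambda>\<pi>. \<pi> \<circ> \<tau>) ?E" "(\<lambda>\<pi>. \<pi> \<circ> \<tau>) ` ?E = ?O"
  proof -
    have b: "bij_betw (\<lambda>\<pi>. \<pi> \<circ> \<tau>) ?P ?P" by (rule bij_betw_permutes_comp[OF \<tau>])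
    show "inj_on (\<lambda>\<pi>. \<pi> \<circ> \<tau>) ?E"
      using bij_betw_imp_inj_on[OF b] by (rule inj_on_subset) auto
    show "(\<lambda>\<pi>. \<pi> \<circ> \<tau>) ` ?E = ?O"
    proof (intro equalityI subsetI)
      fix \<rho> assume "\<rho> \<in> (\<lambda>\<pi>. \<pi> \<circ> \<tau>) ` ?E"
      then show "\<rho> \<in> ?O" using even_comp permutes_compose[OF \<tau>] by auto
    next
      fix \<rho> assume \<rho>: "\<rho> \<in> ?O"
      then have "\<rho> \<in> (\<lambda>\<pi>. \<pi> \<circ> \<tau>) ` ?P" using bij_betw_imp_surj_on[OF b] by simp
      then obtain \<pi> where "\<pi> permutes {..<t}" "\<rho> = \<pi> \<circ> \<tau>" by auto
      then show "\<rho> \<in> (\<lambda>\<pi>. \<pi> \<circ> \<tau>) ` ?E" using \<rho> even_comp by auto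
    qed
  qed
  have cl: "det_term t N \<pi> \<in> carrier R" if "\<pi> permutes {..<t}" for \<pi>
    using det_term_closed[OF N that] .
  \<comment> \<open>Rows \<open>i\<close> and \<open>l\<close> agree, so permuting the rows by
    \<open>\<tau>\<close> leaves each product unchanged and only the sign changes.\<close>
  have swap: "det_term t N (\<pi> \<circ> \<tau>) = \<ominus> det_term t N \<pi>" if \<pi>: "\<pi> permutes {..<t}" for \<pi>
  proof -
    have "det_term t N (\<pi> \<circ> \<tau>) = det_term t (\<lambda>k. N (\<tau> k)) (\<pi> \<circ> \<tau>)"
    proof -
      have "(\<Otimes>k\<in>{..<t}. N k (\<pi> (\<tau> k))) = (\<Otimes>k\<in>{..<t}. N (\<tau> k) (\<pi> (\<tau> k)))"
      proof (rule finprod_cong')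
        fix k assume "k \<in> {..<t}"
        then have "\<pi> (\<tau> k) < t" using permutes_less \<pi> \<tau> by simp
        then show "N k (\<pi> (\<tau> k)) = N (\<tau> k) (\<pi> (\<tau> k))"
          using il(4) by (auto simp: \<tau>_def transpose_def)
      qed (use N permutes_less[OF \<pi>] permutes_less[OF \<tau>] in auto)
      then show ?thesis by (simp add: det_term_def)
    qed
    also have "\<dots> = sgn_elt \<tau> \<otimes> det_term t N \<pi>" by (rule det_term_comp[OF N \<pi> \<tau>])
    also have "\<dots> = \<ominus> det_term t N \<pi>" using \<tau>odd cl[OF \<pi>] by (simp add: sgn_elt_def l_minus)
    finally show ?thesis .
  qed
  have P: "?P = ?E \<union> ?O" by auto
  have "matrix_det R t N = finsum R (det_term t N) ?E \<oplus> finsum R (det_term t N) ?O"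
    unfolding matrix_det_eq P by (rule finsum_Un_disjoint) (use fin cl in auto)
  also have "finsum R (det_term t N) ?O = (\<Oplus>\<pi>\<in>?E. det_term t N (\<pi> \<circ> \<tau>))"
  proof -
    have "finsum R (det_term t N) ((\<lambda>\<pi>. \<pi> \<circ> \<tau>) ` ?E) = (\<Oplus>\<pi>\<in>?E. det_term t N (\<pi> \<circ> \<tau>))"
      by (rule finsum_reindex) (use bij cl in auto)
    then show ?thesis using bij(2) by simp
  qed
  also have "finsum R (det_term t N) ?E \<oplus> (\<Oplus>\<pi>\<in>?E. det_term t N (\<pi> \<circ> \<tau>))
      = (\<Oplus>\<pi>\<in>?E. det_term t N \<pi> \<oplus> det_term t N (\<pi> \<circ> \<tau>))"
    by (rule finsum_addf[symmetric]) (use cl permutes_compose[OF \<tau>] in auto)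
  also have "\<dots> = (\<Oplus>\<pi>\<in>?E. \<zero>)"
    by (rule finsum_cong') (use swap cl in \<open>auto simp: r_neg\<close>)
  also have "\<dots> = \<zero>" by (simp add: finsum_zero)
  finally show ?thesis .
qed

text \<open>The coefficients \<open>C\<close> are chosen before the row \<open>w\<close>, so the
  determinant becomes a linear form in that row. They are indexed by permutations instead of
  columns, which spares the grouping into cofactors.\<close>

lemma matrix_det_row_expand:
  assumes N: "entries_in t t N" and i: "i < t"
  obtains C where "\<And>\<pi>. C \<pi> \<in> carrier R"
    "\<And>w. (\<And>j. j < t \<Longrightarrow> w j \<in> carrier R) \<Longrightarrow>
      matrix_det R t (N(i := w)) = (\<Oplus>\<pi>\<in>{\<pi>. \<pi> permutes {..<t}}. w (\<pi> i) \<otimes> C \<pi>)"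
proof -
  define C where "C \<pi> = (if \<pi> permutes {..<t}
    then sgn_elt \<pi> \<otimes> (\<Otimes>k\<in>{..<t} - {i}. N k (\<pi> k)) else \<zero>)" for \<pi>
  have Ccl: "C \<pi> \<in> carrier R" for \<pi>
    unfolding C_def using N permutes_less by (auto intro!: finprod_closed)
  have "matrix_det R t (N(i := w)) = (\<Oplus>\<pi>\<in>{\<pi>. \<pi> permutes {..<t}}. w (\<pi> i) \<otimes> C \<pi>)"
    if w: "\<And>j. j < t \<Longrightarrow> w j \<in> carrier R" for w
    unfolding matrix_det_eq
  proof (rule finsum_cong')
    fix \<pi> assume "\<pi> \<in> {\<pi>. \<pi> permutes {..<t}}"
    then have \<pi>: "\<pi> permutes {..<t}" by simp
    have cl: "entries_in t t (N(i := w))" using N w by simp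
    have rest: "(\<lambda>k. N k (\<pi> k)) \<in> {..<t} - {i} \<rightarrow> carrier R" using N permutes_less[OF \<pi>] by auto
    have wi: "w (\<pi> i) \<in> carrier R" using w permutes_less[OF \<pi> i] by simp
    have "(\<Otimes>k\<in>insert i ({..<t} - {i}). (N(i := w)) k (\<pi> k)) =
        w (\<pi> i) \<otimes> (\<Otimes>k\<in>{..<t} - {i}. (N(i := w)) k (\<pi> k))"
    proof (subst finprod_insert)
      show "(\<lambda>k. (N(i := w)) k (\<pi> k)) \<in> {..<t} - {i} \<rightarrow> carrier R"
        using rest by (auto simp: Pi_iff)
    qed (use wi in auto)
    also have "(\<Otimes>k\<in>{..<t} - {i}. (N(i := w)) k (\<pi> k)) = (\<Otimes>k\<in>{..<t} - {i}. N k (\<pi> k))"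
      by (rule finprod_cong') (use rest in auto)
    also have "insert i ({..<t} - {i}) = {..<t}" using i by auto
    finally have "det_term t (N(i := w)) \<pi> = sgn_elt \<pi> \<otimes> (w (\<pi> i) \<otimes> (\<Otimes>k\<in>{..<t} - {i}. N k (\<pi> k)))"
      using det_term_sgn[OF cl \<pi>] by simp
    also have "\<dots> = w (\<pi> i) \<otimes> C \<pi>"
      using wi finprod_closed[OF rest] \<pi> by (simp add: C_def m_lcomm)
    finally show "det_term t (N(i := w)) \<pi> = w (\<pi> i) \<otimes> C \<pi>" .
  qed (use w Ccl permutes_less[OF _ i] in auto)
  then show ?thesis using that Ccl by blast
qed

lemma matrix_det_row_linear:
  assumes N: "entries_in t t N" and i: "i < t"
    and B: "finite B" "\<And>l. l \<in> B \<Longrightarrow> c l \<in> carrier R" "\<And>l j. l \<in> B \<Longrightarrow> j < t \<Longrightarrow> v l j \<in> carrier R"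
  shows "matrix_det R t (N(i := (\<lambda>j. \<Oplus>l\<in>B. c l \<otimes> v l j))) =
    (\<Oplus>l\<in>B. c l \<otimes> matrix_det R t (N(i := v l)))"
proof -
  let ?P = "{\<pi>. \<pi> permutes {..<t}}"
  have fin: "finite ?P" by (simp add: finite_permutations)
  obtain C where C: "\<And>\<pi>. C \<pi> \<in> carrier R"
    "\<And>w. (\<And>j. j < t \<Longrightarrow> w j \<in> carrier R) \<Longrightarrow>
      matrix_det R t (N(i := w)) = (\<Oplus>\<pi>\<in>?P. w (\<pi> i) \<otimes> C \<pi>)"
    using matrix_det_row_expand[OF N i] by blast
  show ?thesis using B
  proof (induction B rule: finite_induct)
    case empty
    have "matrix_det R t (N(i := (\<lambda>j. \<zero>))) = (\<Oplus>\<pi>\<in>?P. \<zero> \<otimes> C \<pi>)" by (rule C(2)) simp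
    also have "\<dots> = \<zero>" using C(1) by (simp add: finsum_zero)
    finally show ?case by (simp only: finsum_empty)
  next
    case (insert l B)
    let ?s = "\<lambda>j. \<Oplus>k\<in>B. c k \<otimes> v k j"
    have cl: "c l \<in> carrier R" "\<And>j. j < t \<Longrightarrow> v l j \<in> carrier R" using insert.prems by auto
    have scl: "?s j \<in> carrier R" if "j < t" for j using insert.prems that by (intro finsum_closed) auto
    have pi: "\<pi> i < t" if "\<pi> \<in> ?P" for \<pi> using that permutes_less i by simp
    have s: "(\<Oplus>k\<in>insert l B. c k \<otimes> v k j) = c l \<otimes> v l j \<oplus> ?s j" if "j < t" for j
      using insert.hyps insert.prems that by (intro finsum_insert) auto
    have "matrix_det R t (N(i := (\<lambda>j. \<Oplus>k\<in>insert l B. c k \<otimes> v k j)))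
        = (\<Oplus>\<pi>\<in>?P. (\<Oplus>k\<in>insert l B. c k \<otimes> v k (\<pi> i)) \<otimes> C \<pi>)"
      by (rule C(2)) (use s cl scl in simp)
    also have "\<dots> = (\<Oplus>\<pi>\<in>?P. c l \<otimes> (v l (\<pi> i) \<otimes> C \<pi>) \<oplus> ?s (\<pi> i) \<otimes> C \<pi>)"
    proof (rule finsum_cong')
      fix \<pi> assume "\<pi> \<in> ?P"
      then have p: "\<pi> i < t" using pi by blast
      show "(\<Oplus>k\<in>insert l B. c k \<otimes> v k (\<pi> i)) \<otimes> C \<pi> = c l \<otimes> (v l (\<pi> i) \<otimes> C \<pi>) \<oplus> ?s (\<pi> i) \<otimes> C \<pi>"
        unfolding s[OF p] using cl(1) cl(2)[OF p] scl[OF p] C(1) by (simp add: l_distr m_assoc)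
    qed (use cl scl pi C(1) in auto)
    also have "\<dots> = (\<Oplus>\<pi>\<in>?P. c l \<otimes> (v l (\<pi> i) \<otimes> C \<pi>)) \<oplus> (\<Oplus>\<pi>\<in>?P. ?s (\<pi> i) \<otimes> C \<pi>)"
      by (rule finsum_addf) (use cl scl pi C(1) in auto)
    also have "(\<Oplus>\<pi>\<in>?P. c l \<otimes> (v l (\<pi> i) \<otimes> C \<pi>)) = c l \<otimes> (\<Oplus>\<pi>\<in>?P. v l (\<pi> i) \<otimes> C \<pi>)"
      by (rule finsum_rdistr[symmetric]) (use fin cl pi C(1) in auto)
    also have "(\<Oplus>\<pi>\<in>?P. v l (\<pi> i) \<otimes> C \<pi>) = matrix_det R t (N(i := v l))"
      by (rule C(2)[symmetric]) (use cl in simp)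
    also have "(\<Oplus>\<pi>\<in>?P. ?s (\<pi> i) \<otimes> C \<pi>) = matrix_det R t (N(i := ?s))"
      by (rule C(2)[symmetric]) (use scl in simp)
    also have "matrix_det R t (N(i := ?s)) = (\<Oplus>l\<in>B. c l \<otimes> matrix_det R t (N(i := v l)))"
      by (rule insert.IH) (use insert.prems in auto)
    also have "c l \<otimes> matrix_det R t (N(i := v l)) \<oplus> (\<Oplus>l\<in>B. c l \<otimes> matrix_det R t (N(i := v l)))
        = (\<Oplus>l\<in>insert l B. c l \<otimes> matrix_det R t (N(i := v l)))"
    proof (rule finsum_insert[symmetric])
      have m: "matrix_det R t (N(i := v k)) \<in> carrier R" if "k \<in> insert l B" for k
        by (rule matrix_det_closed) (use N insert.prems that in auto)
      show "(\<lambda>l. c l \<otimes> matrix_det R t (N(i := v l))) \<in> B \<rightarrow> carrier R"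
        using m insert.prems by auto
      show "c l \<otimes> matrix_det R t (N(i := v l)) \<in> carrier R" using m cl by simp
    qed (use insert.hyps in auto)
    finally show ?case .
  qed
qed

lemma finsum_in_ideal:
  assumes "ideal K R" "\<And>i. i \<in> B \<Longrightarrow> f i \<in> K"
  shows "finsum R f B \<in> K"
proof (cases "finite B")
  case True
  interpret K: ideal K R by fact
  show ?thesis using True assms(2)
  proof (induction B rule: finite_induct)
    case (insert x F)
    then have "finsum R f (insert x F) = f x \<oplus> finsum R f F"
      by (intro finsum_insert) (auto intro: K.Icarr)
    then show ?case using insert by simp
  qed (simp add: finsum_empty)
next
  case False
  then show ?thesis
    using assms(1) additive_subgroup.zero_closed ideal.axioms(1) by (simp add: finsum_infinite) blast
qed

lemma matrix_det_row_in_ideal: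
  assumes K: "ideal K R" and N: "entries_in t t N" and i: "i < t"
    and row: "\<And>j. j < t \<Longrightarrow> N i j \<in> K"
  shows "matrix_det R t N \<in> K"
proof -
  interpret K: ideal K R by fact
  obtain C where C: "\<And>\<pi>. C \<pi> \<in> carrier R"
    "\<And>w. (\<And>j. j < t \<Longrightarrow> w j \<in> carrier R) \<Longrightarrow>
      matrix_det R t (N(i := w)) = (\<Oplus>\<pi>\<in>{\<pi>. \<pi> permutes {..<t}}. w (\<pi> i) \<otimes> C \<pi>)"
    using matrix_det_row_expand[OF N i] by blast
  have "matrix_det R t N = (\<Oplus>\<pi>\<in>{\<pi>. \<pi> permutes {..<t}}. N i (\<pi> i) \<otimes> C \<pi>)"
    using C(2)[of "N i"] N i by simp
  also have "\<dots> \<in> K"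
    by (rule finsum_in_ideal[OF K]) (use C(1) row permutes_less[OF _ i] K.I_r_closed in auto)
  finally show ?thesis .
qed

text \<open>Cramer's rule: replacing row \<open>k\<close> by the combination of all rows with coefficients \<open>f\<close>
  multiplies the determinant by \<open>f k\<close>.\<close>

lemma matrix_det_mult_in_ideal:
  assumes J: "ideal J R" and N: "entries_in t t N"
    and f: "\<And>i. i < t \<Longrightarrow> f i \<in> carrier R"
    and rel: "\<And>j. j < t \<Longrightarrow> (\<Oplus>i\<in>{..<t}. f i \<otimes> N i j) \<in> J" and k: "k < t"
  shows "matrix_det R t N \<otimes> f k \<in> J"
proof -
  have d: "matrix_det R t (N(k := N l)) = (if l = k then matrix_det R t N else \<zero>)" if l: "l < t" for l
  proof (cases "l = k")
    case False
    then have "matrix_det R t (N(k := N l)) = \<zero>"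
      by (intro matrix_det_equal_rows[of t _ k l]) (use N k l in auto)
    then show ?thesis using False by simp
  qed simp
  have dN: "matrix_det R t N \<in> carrier R" by (rule matrix_det_closed[OF N])
  let ?M = "N(k := (\<lambda>j. \<Oplus>l\<in>{..<t}. f l \<otimes> N l j))"
  have "matrix_det R t ?M = (\<Oplus>l\<in>{..<t}. f l \<otimes> matrix_det R t (N(k := N l)))"
    by (rule matrix_det_row_linear[OF N k]) (use f N in auto)
  also have "\<dots> = (\<Oplus>l\<in>{..<t}. if l = k then f k \<otimes> matrix_det R t N else \<zero>)"
    by (rule finsum_cong') (use d f dN k in auto)
  also have "\<dots> = (\<Oplus>l\<in>{..<t}. if k = l then (\<lambda>l. f l \<otimes> matrix_det R t N) l else \<zero>)"
    by (rule finsum_cong') (use f dN k in auto)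
  also have "\<dots> = f k \<otimes> matrix_det R t N"
    by (subst finsum_singleton) (use f dN k in auto)
  finally have "matrix_det R t ?M = matrix_det R t N \<otimes> f k" using f[OF k] dN by (simp add: m_comm)
  moreover have "matrix_det R t ?M \<in> J"
    by (rule matrix_det_row_in_ideal[OF J _ k]) (use N k rel ideal.Icarr[OF J] in auto)
  ultimately show ?thesis by simp
qed

text \<open>Telescoping: \<open>f f' - g g' = f (f' - g') + (f - g) g'\<close>.\<close>

lemma finprod_minus_in_ideal:
  assumes K: "ideal K R" and B: "finite B" "\<And>i. i \<in> B \<Longrightarrow> f i \<in> carrier R" "\<And>i. i \<in> B \<Longrightarrow> g i \<in> carrier R"
    "\<And>i. i \<in> B \<Longrightarrow> f i \<ominus> g i \<in> K"
  shows "finprod R f B \<ominus> finprod R g B \<in> K"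
proof -
  interpret K: ideal K R by fact
  show ?thesis using B
  proof (induction B rule: finite_induct)
    case empty
    then show ?case by (simp add: minus_eq r_neg)
  next
    case (insert x F)
    let ?f = "finprod R f F" and ?g = "finprod R g F"
    have c: "?f \<in> carrier R" "?g \<in> carrier R" "f x \<in> carrier R" "g x \<in> carrier R"
      using insert.prems by (auto intro!: finprod_closed)
    have "f x \<otimes> (?f \<ominus> ?g) \<in> K" "(f x \<ominus> g x) \<otimes> ?g \<in> K"
      using insert c K.I_l_closed K.I_r_closed by auto
    then have "f x \<otimes> (?f \<ominus> ?g) \<oplus> (f x \<ominus> g x) \<otimes> ?g \<in> K" by simp
    also have "f x \<otimes> (?f \<ominus> ?g) \<oplus> (f x \<ominus> g x) \<otimes> ?g = f x \<otimes> ?f \<ominus> g x \<otimes> ?g"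
    proof -
      have "f x \<otimes> (?f \<ominus> ?g) \<oplus> (f x \<ominus> g x) \<otimes> ?g
          = (f x \<otimes> ?f \<ominus> f x \<otimes> ?g) \<oplus> (f x \<otimes> ?g \<ominus> g x \<otimes> ?g)"
        using c by (simp add: minus_eq l_distr r_distr l_minus r_minus)
      also have "\<dots> = (f x \<otimes> ?f \<ominus> f x \<otimes> ?g) \<oplus> f x \<otimes> ?g \<ominus> g x \<otimes> ?g"
        using c by (simp add: minus_eq a_assoc)
      also have "\<dots> = f x \<otimes> ?f \<ominus> g x \<otimes> ?g" using c by (simp add: add_minus_cancel)
      finally show ?thesis .
    qed
    also have "f x \<otimes> ?f = finprod R f (insert x F)" using insert.hyps insert.prems by simp
    also have "g x \<otimes> ?g = finprod R g (insert x F)" using insert.hyps insert.prems by simp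
    finally show ?case .
  qed
qed

lemma finsum_minus_in_ideal:
  assumes K: "ideal K R" and B: "finite B" "\<And>i. i \<in> B \<Longrightarrow> f i \<in> carrier R" "\<And>i. i \<in> B \<Longrightarrow> g i \<in> carrier R"
    "\<And>i. i \<in> B \<Longrightarrow> f i \<ominus> g i \<in> K"
  shows "finsum R f B \<ominus> finsum R g B \<in> K"
proof -
  have "finsum R f B = (\<Oplus>i\<in>B. (f i \<ominus> g i) \<oplus> g i)"
    by (rule finsum_cong') (use B in \<open>auto simp: add_minus_cancel\<close>)
  also have "\<dots> = (\<Oplus>i\<in>B. f i \<ominus> g i) \<oplus> finsum R g B"
    by (rule finsum_addf) (use B in auto)
  finally have "finsum R f B \<ominus> finsum R g B = (\<Oplus>i\<in>B. f i \<ominus> g i)"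
    using B by (simp add: add_minus_cancel finsum_closed Pi_iff)
  then show ?thesis using finsum_in_ideal[OF K, of B] B(4) by simp
qed

text \<open>A determinant is a polynomial in its entries, so its class modulo \<open>K\<close>
  depends on the entries modulo \<open>K\<close> only.\<close>

lemma matrix_det_minus_in_ideal:
  assumes K: "ideal K R" and N: "entries_in t t N"
    and N': "entries_in t t N'"
    and NN': "\<And>i j. i < t \<Longrightarrow> j < t \<Longrightarrow> N i j \<ominus> N' i j \<in> K"
  shows "matrix_det R t N \<ominus> matrix_det R t N' \<in> K"
  unfolding matrix_det_eq
proof (rule finsum_minus_in_ideal[OF K])
  interpret K: ideal K R by fact
  fix \<pi> assume "\<pi> \<in> {\<pi>. \<pi> permutes {..<t}}"
  then have \<pi>: "\<pi> permutes {..<t}" by simp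
  show "det_term t N \<pi> \<in> carrier R" by (rule det_term_closed[OF N \<pi>])
  show "det_term t N' \<pi> \<in> carrier R" by (rule det_term_closed[OF N' \<pi>])
  let ?a = "\<Otimes>i\<in>{..<t}. N i (\<pi> i)" and ?b = "\<Otimes>i\<in>{..<t}. N' i (\<pi> i)"
  have c: "?a \<in> carrier R" "?b \<in> carrier R"
    using finprod_closed[OF entries_closed[OF N \<pi>]] finprod_closed[OF entries_closed[OF N' \<pi>]] by auto
  have "?a \<ominus> ?b \<in> K"
    by (rule finprod_minus_in_ideal[OF K]) (use N N' NN' permutes_less[OF \<pi>] in auto)
  then have "sgn_elt \<pi> \<otimes> (?a \<ominus> ?b) \<in> K" by (simp add: K.I_l_closed)
  moreover have "sgn_elt \<pi> \<otimes> (?a \<ominus> ?b) = sgn_elt \<pi> \<otimes> ?a \<ominus> sgn_elt \<pi> \<otimes> ?b"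
    using c by (simp add: minus_eq r_distr r_minus)
  ultimately show "det_term t N \<pi> \<ominus> det_term t N' \<pi> \<in> K"
    using det_term_sgn[OF N \<pi>] det_term_sgn[OF N' \<pi>] by simp
qed (simp add: finite_permutations)

text \<open>One direction of Cauchy-Binet. Rows are replaced by their combinations one after the
  other, and linearity in each row leaves only determinants of selected rows \<open>v (s j)\<close>;
  the selection \<open>s\<close> may repeat or reorder rows.\<close>

lemma matrix_det_combined_rows_in_ideal:
  fixes q :: nat
  assumes P: "ideal P R" and w: "\<And>j k. j < t \<Longrightarrow> k < q \<Longrightarrow> w j k \<in> carrier R"
    and v: "\<And>k i. k < q \<Longrightarrow> i < t \<Longrightarrow> v k i \<in> carrier R"
    and base: "\<And>s. s ` {..<t} \<subseteq> {..<q} \<Longrightarrow> matrix_det R t (\<lambda>j. v (s j)) \<in> P"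
  shows "matrix_det R t (\<lambda>j i. \<Oplus>k\<in>{..<q}. w j k \<otimes> v k i) \<in> P"
proof -
  let ?c = "\<lambda>j i. \<Oplus>k\<in>{..<q}. w j k \<otimes> v k i"
  have ccl: "?c j i \<in> carrier R" if "j < t" "i < t" for j i
    using w v that by (intro finsum_closed) auto
  have "m \<le> t \<Longrightarrow> \<forall>s. s ` {..<t} \<subseteq> {..<q} \<longrightarrow>
    matrix_det R t (\<lambda>j. if j < m then ?c j else v (s j)) \<in> P" for m
  proof (induction m)
    case 0
    then show ?case using base by simp
  next
    case (Suc m)
    show ?case
    proof (intro allI impI)
      fix s assume s: "s ` {..<t} \<subseteq> {..<q}"
      let ?N = "\<lambda>j. if j < m then ?c j else v (s j)"
      have N: "entries_in t t ?N"
        using ccl v s by (auto simp: image_subset_iff)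
      have m: "m < t" using Suc.prems by simp
      have "(\<lambda>j. if j < Suc m then ?c j else v (s j)) = ?N(m := (\<lambda>i. \<Oplus>k\<in>{..<q}. w m k \<otimes> v k i))"
        by (auto simp: fun_eq_iff less_Suc_eq)
      then have "matrix_det R t (\<lambda>j. if j < Suc m then ?c j else v (s j))
          = (\<Oplus>k\<in>{..<q}. w m k \<otimes> matrix_det R t (?N(m := v k)))"
        using matrix_det_row_linear[OF N m, of "{..<q}" "w m" v] w m v by simp
      also have "\<dots> \<in> P"
      proof (rule finsum_in_ideal[OF P])
        fix k assume k: "k \<in> {..<q}"
        have "?N(m := v k) = (\<lambda>j. if j < m then ?c j else v ((s(m := k)) j))"
          by (auto simp: fun_eq_iff)
        moreover have "(s(m := k)) ` {..<t} \<subseteq> {..<q}" using s k by (auto simp: image_subset_iff)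
        ultimately have "matrix_det R t (?N(m := v k)) \<in> P" using Suc.IH m by simp
        then show "w m k \<otimes> matrix_det R t (?N(m := v k)) \<in> P"
          using w m k ideal.I_l_closed[OF P] by simp
      qed
      finally show "matrix_det R t (\<lambda>j. if j < Suc m then ?c j else v (s j)) \<in> P" .
    qed
  qed
  note step = this
  show ?thesis
  \<comment> \<open>Some selection into \<open>{..<q}\<close> must exist for the intermediate claim
    to say anything. For \<open>q = 0 < t\<close> the combined rows are empty sums, hence zero, and
    the determinant lies in \<open>P\<close>.\<close>
  proof (cases "t = 0 \<or> q > 0")
    case True
    then have "(\<lambda>_. 0) ` {..<t} \<subseteq> {..<q}" by auto
    then have "matrix_det R t (\<lambda>j. if j < t then ?c j else v 0) \<in> P" using step[of t] by auto
    moreover have "matrix_det R t (\<lambda>j. if j < t then ?c j else v 0) = matrix_det R t ?c"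
      by (rule matrix_det_cong) (use ccl in auto)
    ultimately show ?thesis by simp
  next
    case False
    then show ?thesis
      using matrix_det_row_in_ideal[OF P, of t ?c 0] additive_subgroup.zero_closed[OF ideal.axioms(1)[OF P]]
      by (simp add: finsum_empty)
  qed
qed

lemma matrix_det_diagonal:
  assumes "c \<in> carrier R"
  shows "matrix_det R t (\<lambda>i j. if i = j then c else \<zero>) = c [^] t"
proof -
  let ?P = "{\<pi>. \<pi> permutes {..<t}}" and ?N = "\<lambda>i j. if i = j then c else \<zero>"
  have z: "det_term t ?N \<pi> = (if id = \<pi> then (\<lambda>_. c [^] t) \<pi> else \<zero>)" if \<pi>: "\<pi> \<in> ?P" for \<pi>
  proof (cases "\<pi> = id")
    case True
    have "(\<Otimes>i\<in>{..<t}. c) = c [^] card {..<t}" using assms by (rule finprod_const)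
    then show ?thesis using True assms by (simp add: det_term_def)
  next
    case False
    then obtain i where i: "\<pi> i \<noteq> i" by (auto simp: fun_eq_iff)
    then have it: "i < t" using \<pi> by (auto simp: permutes_def)
    have "(\<Otimes>k\<in>insert i ({..<t} - {i}). ?N k (\<pi> k)) = ?N i (\<pi> i) \<otimes> (\<Otimes>k\<in>{..<t} - {i}. ?N k (\<pi> k))"
      using assms by (intro finprod_insert) auto
    also have "\<dots> = \<zero>" using i assms by (auto intro!: l_null finprod_closed)
    also have "insert i ({..<t} - {i}) = {..<t}" using it by auto
    finally show ?thesis using False by (auto simp: det_term_def sign_add_pow)
  qed
  have "matrix_det R t ?N = (\<Oplus>\<pi>\<in>?P. if id = \<pi> then (\<lambda>_. c [^] t) \<pi> else \<zero>)"
    unfolding matrix_det_eq by (rule finsum_cong') (use z assms in auto)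
  also have "\<dots> = c [^] t"
    by (subst finsum_singleton) (use assms in \<open>auto simp: finite_permutations permutes_id\<close>)
  finally show ?thesis .
qed

section \<open>Ideals of minors\<close>

lemma exists_sorting_permutation:
  fixes s :: "nat \<Rightarrow> nat"
  assumes "inj_on s {..<t}"
  obtains \<kappa> where "\<kappa> permutes {..<t}" "strict_mono_on {..<t} (\<lambda>i. s (\<kappa> i))"
proof -
  have "card (s ` {..<t}) = t" using card_image[OF assms] by simp
  then obtain h where h: "bij_betw h {..<t} (s ` {..<t})" "strict_mono_on {..<t} h"
    using ex_bij_betw_strict_mono_card[of "s ` {..<t}"] by (metis finite_imageI finite_lessThan)
  define \<kappa> where "\<kappa> i = (if i < t then inv_into {..<t} s (h i) else i)" for i
  have hi: "h i \<in> s ` {..<t}" if "i < t" for i using h(1) that by (auto simp: bij_betw_def)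
  have s\<kappa>: "s (\<kappa> i) = h i" if "i < t" for i
    using hi[OF that] that by (simp add: \<kappa>_def f_inv_into_f)
  have "\<kappa> permutes {..<t}"
  proof (rule bij_imp_permutes)
    have "bij_betw (inv_into {..<t} s \<circ> h) {..<t} {..<t}"
      by (rule bij_betw_trans[OF h(1)]) (rule bij_betw_inv_into, use assms in \<open>simp add: bij_betw_def\<close>)
    then show "bij_betw \<kappa> {..<t} {..<t}"
      by (rule bij_betw_cong[THEN iffD1, rotated]) (auto simp: \<kappa>_def)
    show "\<kappa> x = x" if "x \<notin> {..<t}" for x using that by (simp add: \<kappa>_def)
  qed
  moreover have "strict_mono_on {..<t} (\<lambda>i. s (\<kappa> i))"
    using h(2) s\<kappa> by (auto simp: strict_mono_on_def)
  ultimately show ?thesis using that by blast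
qed

lemma minors_ideal_ideal:
  assumes "entries_in \<mu> q \<phi>"
  shows "ideal (minors_ideal R \<mu> q \<phi> t) R"
  unfolding minors_ideal_def
  by (rule genideal_ideal) (use assms in \<open>auto intro!: matrix_det_closed simp: image_subset_iff\<close>)

text \<open>The definition admits increasing column selections; an arbitrary one either repeats a
  column, giving zero, or is a rearrangement of an increasing one, giving the same minor up to
  sign.\<close>

lemma minor_in_minors_ideal:
  assumes \<phi>: "entries_in \<mu> q \<phi>"
    and r: "strict_mono_on {..<t} r" "r ` {..<t} \<subseteq> {..<\<mu>}" and s: "s ` {..<t} \<subseteq> {..<q}"
  shows "matrix_det R t (\<lambda>i j. \<phi> (r i) (s j)) \<in> minors_ideal R \<mu> q \<phi> t"
proof -
  interpret F: ideal "minors_ideal R \<mu> q \<phi> t" R by (rule minors_ideal_ideal[OF \<phi>])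
  have cl: "entries_in t t (\<lambda>i j. \<phi> (r i) (s j))"
    using \<phi> r(2) s by (auto simp: image_subset_iff)
  have tr: "matrix_det R t (\<lambda>i j. \<phi> (r i) (s j)) = matrix_det R t (\<lambda>j i. \<phi> (r i) (s j))"
    using matrix_det_transpose[of t "\<lambda>j i. \<phi> (r i) (s j)"] cl by simp
  show ?thesis
  proof (cases "inj_on s {..<t}")
    case False
    then obtain a b where ab: "a < t" "b < t" "a \<noteq> b" "s a = s b" by (auto simp: inj_on_def)
    have "matrix_det R t (\<lambda>j i. \<phi> (r i) (s j)) = \<zero>"
      by (rule matrix_det_equal_rows[of t _ a b]) (use ab cl in auto)
    then show ?thesis using tr F.zero_closed by simp
  next
    case True
    then obtain \<kappa> where \<kappa>: "\<kappa> permutes {..<t}" "strict_mono_on {..<t} (\<lambda>i. s (\<kappa> i))"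
      by (rule exists_sorting_permutation)
    have cl': "entries_in t t (\<lambda>i j. \<phi> (r i) (s (\<kappa> j)))"
      using cl permutes_less[OF \<kappa>(1)] by simp
    have s\<kappa>: "(\<lambda>i. s (\<kappa> i)) ` {..<t} \<subseteq> {..<q}"
      using s permutes_less[OF \<kappa>(1)] by (auto simp: image_subset_iff)
    let ?G = "{matrix_det R t (\<lambda>i j. \<phi> (r i) (s j)) |r s.
      strict_mono_on {..<t} r \<and> r ` {..<t} \<subseteq> {..<\<mu>} \<and> strict_mono_on {..<t} s \<and> s ` {..<t} \<subseteq> {..<q}}"
    have "?G \<subseteq> carrier R"
      using \<phi> by (auto intro!: matrix_det_closed simp: image_subset_iff)
    then have "?G \<subseteq> minors_ideal R \<mu> q \<phi> t" unfolding minors_ideal_def by (rule genideal_self)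
    moreover have "matrix_det R t (\<lambda>i j. \<phi> (r i) (s (\<kappa> j))) \<in> ?G"
      by (rule CollectI, rule exI[of _ r], rule exI[of _ "\<lambda>i. s (\<kappa> i)"])
        (intro conjI refl r \<kappa>(2) s\<kappa>)
    ultimately have 1: "matrix_det R t (\<lambda>i j. \<phi> (r i) (s (\<kappa> j))) \<in> minors_ideal R \<mu> q \<phi> t" by blast
    have "matrix_det R t (\<lambda>i j. \<phi> (r i) (s (\<kappa> j))) = matrix_det R t (\<lambda>j i. \<phi> (r i) (s (\<kappa> j)))"
      using matrix_det_transpose[of t "\<lambda>j i. \<phi> (r i) (s (\<kappa> j))"] cl' by simp
    also have "\<dots> = sgn_elt \<kappa> \<otimes> matrix_det R t (\<lambda>j i. \<phi> (r i) (s j))"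
      by (rule matrix_det_permute_rows[OF _ \<kappa>(1)]) (use cl in auto)
    finally have "sgn_elt \<kappa> \<otimes> (sgn_elt \<kappa> \<otimes> matrix_det R t (\<lambda>i j. \<phi> (r i) (s j))) \<in> minors_ideal R \<mu> q \<phi> t"
      using 1 tr F.I_l_closed by simp
    moreover have "sgn_elt \<kappa> \<otimes> (sgn_elt \<kappa> \<otimes> x) = x" if "x \<in> carrier R" for x
      using that by (simp add: sgn_elt_def l_minus r_minus)
    ultimately show ?thesis using matrix_det_closed[OF cl] by simp
  qed
qed

text \<open>The columns of the product of \<open>\<phi>\<close> with the coefficients
  \<open>w\<close> are combinations of columns of \<open>\<phi>\<close>; after transposing, row
  linearity expands the minor into \<open>t\<close>-minors of \<open>\<phi>\<close> on the rows
  \<open>r\<close>.\<close>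

lemma matrix_det_product_in_minors_ideal:
  assumes \<phi>: "entries_in \<mu> q \<phi>"
    and r: "strict_mono_on {..<t} r" "r ` {..<t} \<subseteq> {..<\<mu>}"
    and w: "\<And>j k. j < t \<Longrightarrow> k < q \<Longrightarrow> w j k \<in> carrier R"
  shows "matrix_det R t (\<lambda>i j. \<Oplus>k\<in>{..<q}. \<phi> (r i) k \<otimes> w j k) \<in> minors_ideal R \<mu> q \<phi> t"
proof -
  have \<phi>r: "\<phi> (r i) k \<in> carrier R" if "i < t" "k < q" for i k
    using \<phi> r(2) that by (auto simp: image_subset_iff)
  have cl: "entries_in t t (\<lambda>i j. \<Oplus>k\<in>{..<q}. w j k \<otimes> \<phi> (r i) k)"
    using \<phi>r w by (auto intro!: finsum_closed)
  have "matrix_det R t (\<lambda>i j. \<Oplus>k\<in>{..<q}. \<phi> (r i) k \<otimes> w j k)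
      = matrix_det R t (\<lambda>i j. \<Oplus>k\<in>{..<q}. w j k \<otimes> \<phi> (r i) k)"
    by (rule matrix_det_cong[OF finsum_cong' cl]) (use \<phi>r w m_comm in auto)
  also have "\<dots> = matrix_det R t (\<lambda>j i. \<Oplus>k\<in>{..<q}. w j k \<otimes> \<phi> (r i) k)"
    using matrix_det_transpose[of t "\<lambda>j i. \<Oplus>k\<in>{..<q}. w j k \<otimes> \<phi> (r i) k"] cl by simp
  also have "\<dots> \<in> minors_ideal R \<mu> q \<phi> t"
  proof (rule matrix_det_combined_rows_in_ideal[OF minors_ideal_ideal[OF \<phi>]])
    fix s assume s: "s ` {..<t} \<subseteq> {..<q}"
    have "matrix_det R t (\<lambda>j i. \<phi> (r i) (s j)) = matrix_det R t (\<lambda>i j. \<phi> (r i) (s j))"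
      using matrix_det_transpose[of t "\<lambda>i j. \<phi> (r i) (s j)"] \<phi>r s by (auto simp: image_subset_iff)
    then show "matrix_det R t (\<lambda>j i. \<phi> (r i) (s j)) \<in> minors_ideal R \<mu> q \<phi> t"
      using minor_in_minors_ideal[OF \<phi> r s] by simp
  qed (use \<phi>r w in auto)
  finally show ?thesis .
qed

end

section \<open>Positively graded domains\<close>

lemma (in ring) in_set_add_iff: "x \<in> I <+> J \<longleftrightarrow> (\<exists>a\<in>I. \<exists>b\<in>J. x = a \<oplus> b)"
  by (auto simp: set_add_def' Bex_def)

locale graded_domain = "domain" R for R (structure) +
  fixes A :: "nat \<Rightarrow> 'a set"
  assumes graded: "positively_graded R A"
begin

lemma component_subgroup: "additive_subgroup (A i) R"
  using graded by (simp add: positively_graded_def)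

lemma component_closed: "x \<in> A i \<Longrightarrow> x \<in> carrier R"
  using additive_subgroup.a_subset[OF component_subgroup] by blast

lemma component_zero: "\<zero> \<in> A i"
  by (rule additive_subgroup.zero_closed[OF component_subgroup])

lemma component_add: "x \<in> A i \<Longrightarrow> y \<in> A i \<Longrightarrow> x \<oplus> y \<in> A i"
  by (rule additive_subgroup.a_closed[OF component_subgroup])

lemma component_mult: "x \<in> A i \<Longrightarrow> y \<in> A j \<Longrightarrow> x \<otimes> y \<in> A (i + j)"
  using graded by (simp add: positively_graded_def)

lemma component_decomposition:
  "x \<in> carrier R \<Longrightarrow> \<exists>!f. (\<forall>i. f i \<in> A i) \<and> finite {i. f i \<noteq> \<zero>} \<and> x = (\<Oplus>i\<in>{i. f i \<noteq> \<zero>}. f i)"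
  using graded by (simp add: positively_graded_def)

text \<open>The elements of order at least \<open>N\<close>, built from homogeneous summands.
  Closure properties thus go by induction on the summands; uniqueness of the homogeneous
  decomposition enters in \<open>component_not_above\<close>.\<close>

inductive_set above :: "nat \<Rightarrow> 'a set" for N :: nat where
  above_zero: "\<zero> \<in> above N"
| above_add: "a \<in> A i \<Longrightarrow> N \<le> i \<Longrightarrow> y \<in> above N \<Longrightarrow> a \<oplus> y \<in> above N"

lemma above_closed: "x \<in> above N \<Longrightarrow> x \<in> carrier R"
  by (induction rule: above.induct) (auto dest: component_closed)

lemma component_above: "x \<in> A i \<Longrightarrow> N \<le> i \<Longrightarrow> x \<in> above N"
  using above_add[OF _ _ above_zero, of x i N] component_closed[of x i] by simp

lemma above_mono: "x \<in> above M \<Longrightarrow> N \<le> M \<Longrightarrow> x \<in> above N"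
  by (induction rule: above.induct) (auto intro: above_zero above_add)

lemma above_sum: "x \<in> above N \<Longrightarrow> y \<in> above N \<Longrightarrow> x \<oplus> y \<in> above N"
proof (induction rule: above.induct)
  case above_zero
  then show ?case using above_closed by simp
next
  case (above_add a i x)
  have "(a \<oplus> x) \<oplus> y = a \<oplus> (x \<oplus> y)"
    using above_add component_closed above_closed by (intro a_assoc) auto
  then show ?case using above_add above.above_add by auto
qed

lemma above_0: "above 0 = carrier R"
proof
  show "above 0 \<subseteq> carrier R" using above_closed by blast
  show "carrier R \<subseteq> above 0"
  proof
    fix x assume "x \<in> carrier R"
    then obtain f where f: "\<forall>i. f i \<in> A i" "finite {i. f i \<noteq> \<zero>}" "x = (\<Oplus>i\<in>{i. f i \<noteq> \<zero>}. f i)"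
      using component_decomposition by blast
    have "finsum R f B \<in> above 0" if "finite B" for B
      using that
    proof (induction B rule: finite_induct)
      case empty then show ?case by (simp add: finsum_empty above_zero)
    next
      case (insert b B)
      have "finsum R f (insert b B) = f b \<oplus> finsum R f B"
        using insert f(1) component_closed by (intro finsum_insert) auto
      then show ?case using above_add[of "f b" b 0] f(1) insert.IH by simp
    qed
    then show "x \<in> above 0" using f by simp
  qed
qed

lemma component_mult_above: "y \<in> above N \<Longrightarrow> a \<in> A i \<Longrightarrow> a \<otimes> y \<in> above (i + N)"
proof (induction rule: above.induct)
  case above_zero
  then show ?case using component_closed above.above_zero by simp
next
  case (above_add b j y)
  have "a \<otimes> (b \<oplus> y) = a \<otimes> b \<oplus> a \<otimes> y"
    using above_add component_closed above_closed by (intro r_distr) auto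
  then show ?case
    using above.above_add[of "a \<otimes> b" "i + j" "i + N"] component_mult[of a i b j] above_add by simp
qed

lemma above_mult: "x \<in> above N \<Longrightarrow> y \<in> above M \<Longrightarrow> x \<otimes> y \<in> above (N + M)"
proof (induction rule: above.induct)
  case above_zero
  then show ?case using above_closed above.above_zero by simp
next
  case (above_add a i x)
  have "(a \<oplus> x) \<otimes> y = a \<otimes> y \<oplus> x \<otimes> y"
    using above_add component_closed above_closed by (intro l_distr) auto
  moreover have "a \<otimes> y \<in> above (N + M)"
    using component_mult_above[OF above_add.prems above_add.hyps(1)]
    by (rule above_mono) (use above_add.hyps(2) in simp)
  ultimately show ?case using above_sum above_add by simp
qed

lemma above_ideal: "ideal (above N) R"
proof (rule ideal_closedI)
  fix x r assume "x \<in> above N" "r \<in> carrier R"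
  then show "r \<otimes> x \<in> above N" using above_mult[of r 0 x N] above_0 by simp
qed (use above_closed above_zero above_sum in auto)

text \<open>The summation range \<open>{..K}\<close> is left open from \<open>M\<close> upwards, so
  that a further summand of any degree can be added over a common range.\<close>

lemma above_decomposition:
  "x \<in> above N \<Longrightarrow> \<exists>f M. (\<forall>i. f i \<in> A i) \<and> (\<forall>i. i < N \<or> M < i \<longrightarrow> f i = \<zero>) \<and>
     (\<forall>K\<ge>M. x = (\<Oplus>i\<in>{..K}. f i))"
proof (induction rule: above.induct)
  case above_zero
  show ?case by (intro exI[of _ "\<lambda>_. \<zero>"] exI[of _ 0]) (simp add: component_zero finsum_zero)
next
  case (above_add a j y)
  then obtain f M where f: "\<forall>i. f i \<in> A i" "\<forall>i. i < N \<or> M < i \<longrightarrow> f i = \<zero>"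
    "\<forall>K\<ge>M. y = (\<Oplus>i\<in>{..K}. f i)" by blast
  let ?d = "\<lambda>i. if i = j then (\<lambda>_. a) i else \<zero>"
  let ?f = "\<lambda>i. ?d i \<oplus> f i" and ?M = "max M j"
  have ac: "a \<in> carrier R" using above_add.hyps component_closed by blast
  have fc: "f i \<in> carrier R" for i using f(1) component_closed by blast
  have "?f i \<in> A i" for i using f(1) above_add.hyps component_add component_zero fc by auto
  moreover have "?f i = \<zero>" if "i < N \<or> ?M < i" for i
    using that f(2) above_add.hyps(2) by auto
  moreover have "a \<oplus> y = (\<Oplus>i\<in>{..K}. ?f i)" if "?M \<le> K" for K
  proof -
    have "(\<Oplus>i\<in>{..K}. ?f i) = (\<Oplus>i\<in>{..K}. ?d i) \<oplus> (\<Oplus>i\<in>{..K}. f i)"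
      by (rule finsum_addf) (use ac fc in auto)
    also have "(\<Oplus>i\<in>{..K}. ?d i) = a"
      by (subst add.finprod_singleton_swap) (use that ac in auto)
    finally show ?thesis using f(3)[rule_format, of K] that by simp
  qed
  ultimately have *: "(\<forall>i. ?f i \<in> A i) \<and> (\<forall>i. i < N \<or> ?M < i \<longrightarrow> ?f i = \<zero>) \<and>
      (\<forall>K\<ge>?M. a \<oplus> y = (\<Oplus>i\<in>{..K}. ?f i))" by blast
  show ?case by (rule exI[of _ ?f], rule exI[of _ ?M], rule *)
qed

text \<open>By uniqueness the decomposition of \<open>x\<close> is concentrated in degree
  \<open>d\<close>, while one coming from \<open>above N\<close> vanishes below degree
  \<open>N\<close>.\<close>

lemma component_not_above:
  assumes "x \<in> A d" "x \<noteq> \<zero>" "d < N"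
  shows "x \<notin> above N"
proof
  assume "x \<in> above N"
  then obtain f M where f: "\<forall>i. f i \<in> A i" "\<forall>i. i < N \<or> M < i \<longrightarrow> f i = \<zero>"
    "\<forall>K\<ge>M. x = (\<Oplus>i\<in>{..K}. f i)" using above_decomposition by blast
  have fc: "f i \<in> carrier R" for i using f(1) component_closed by blast
  have xc: "x \<in> carrier R" using assms(1) component_closed by blast
  let ?d = "\<lambda>i. if i = d then x else \<zero>"
  have sup: "{i. f i \<noteq> \<zero>} \<subseteq> {..M}" using f(2) by (auto simp: not_less[symmetric])
  have "(\<Oplus>i\<in>{i. f i \<noteq> \<zero>}. f i) = (\<Oplus>i\<in>{..M}. f i)"
    by (rule add.finprod_mono_neutral_cong_left) (use sup fc in auto)
  then have 1: "x = (\<Oplus>i\<in>{i. f i \<noteq> \<zero>}. f i)" using f(3) by simp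
  let ?P = "\<lambda>f. (\<forall>i. f i \<in> A i) \<and> finite {i. f i \<noteq> \<zero>} \<and> x = (\<Oplus>i\<in>{i. f i \<noteq> \<zero>}. f i)"
  have ex1: "\<exists>!f. ?P f" by (rule component_decomposition[OF xc])
  have "finite {i. f i \<noteq> \<zero>}" using sup by (rule finite_subset) simp
  then have Pf: "?P f" using f(1) 1 by (intro conjI)
  have sd: "{i. ?d i \<noteq> \<zero>} = {d}" using assms(2) by auto
  have Pd: "?P ?d"
    unfolding sd using assms(1) component_zero xc by (simp add: finsum_insert finsum_empty)
  have "f = ?d" by (rule trans[OF the1_equality[of ?P f, OF ex1 Pf, symmetric] the1_equality[of ?P ?d, OF ex1 Pd]])
  then have "f d = x" by simp
  then show False using f(2) assms by simp
qed

lemma above_split: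
  "x \<in> above N \<Longrightarrow> \<exists>x0\<in>A N. \<exists>x1\<in>above (Suc N). x = x0 \<oplus> x1"
proof (induction rule: above.induct)
  case above_zero
  show ?case by (rule bexI[OF _ component_zero], rule bexI[OF _ above.above_zero]) simp
next
  case (above_add a i y)
  then obtain y0 y1 where y: "y0 \<in> A N" "y1 \<in> above (Suc N)" "y = y0 \<oplus> y1" by blast
  have c: "a \<in> carrier R" "y0 \<in> carrier R" "y1 \<in> carrier R"
    using above_add.hyps y component_closed above_closed by auto
  show ?case
  proof (cases "i = N")
    case True
    have "a \<oplus> y = (a \<oplus> y0) \<oplus> y1" using c y by (simp add: a_assoc)
    then show ?thesis using component_add[of a N y0] above_add.hyps True y by blast
  next
    case False
    have "a \<oplus> y = y0 \<oplus> (a \<oplus> y1)" using c y by (simp add: a_lcomm)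
    moreover have "a \<oplus> y1 \<in> above (Suc N)"
      using above.above_add[of a i "Suc N" y1] above_add.hyps False y by simp
    ultimately show ?thesis using y by blast
  qed
qed

lemma exact_order:
  assumes "x \<in> carrier R" "x \<notin> above (Suc n)"
  obtains a where "a \<le> n" "x \<in> above a" "x \<notin> above (Suc a)"
proof -
  define k where "k = (LEAST k. x \<notin> above k)"
  have k: "x \<notin> above k" unfolding k_def using assms(2) by (rule LeastI)
  have kn: "k \<le> Suc n" unfolding k_def using assms(2) by (rule Least_le)
  obtain a where a: "k = Suc a" using k assms(1) above_0 by (cases k) auto
  have "x \<in> above a" using not_less_Least[of a "\<lambda>k. x \<notin> above k"] a k_def by auto
  then show ?thesis using that[of a] a k kn by simp
qed

text \<open>Lowest-degree components multiply, since \<open>R\<close> is a domain.\<close>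

lemma not_above_mult:
  assumes "x \<in> carrier R" "y \<in> carrier R" "x \<notin> above (Suc n)" "y \<notin> above (Suc m)"
  shows "x \<otimes> y \<notin> above (Suc (n + m))"
proof
  assume xy: "x \<otimes> y \<in> above (Suc (n + m))"
  obtain a where a: "a \<le> n" "x \<in> above a" "x \<notin> above (Suc a)" using exact_order assms by blast
  obtain b where b: "b \<le> m" "y \<in> above b" "y \<notin> above (Suc b)" using exact_order assms by blast
  obtain x0 x1 where x: "x0 \<in> A a" "x1 \<in> above (Suc a)" "x = x0 \<oplus> x1" using above_split a by blast
  obtain y0 y1 where y: "y0 \<in> A b" "y1 \<in> above (Suc b)" "y = y0 \<oplus> y1" using above_split b by blast
  have c: "x0 \<in> carrier R" "x1 \<in> carrier R" "y0 \<in> carrier R" "y1 \<in> carrier R"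
    using x y component_closed above_closed by auto
  have "x0 \<noteq> \<zero>" using x a(3) c by auto
  moreover have "y0 \<noteq> \<zero>" using y b(3) c by auto
  ultimately have ne: "x0 \<otimes> y0 \<noteq> \<zero>" using integral[of x0 y0] c by blast
  interpret I: ideal "above (Suc (a + b))" R by (rule above_ideal)
  have "x1 \<otimes> y \<in> above (Suc (a + b))" using above_mult[OF x(2) b(2)] by simp
  moreover have "x0 \<otimes> y1 \<in> above (Suc (a + b))"
    using above_mult[OF component_above[OF x(1) order_refl] y(2)] by simp
  moreover have "x \<otimes> y \<in> above (Suc (a + b))" using xy a(1) b(1) above_mono by simp
  ultimately have "x \<otimes> y \<ominus> (x0 \<otimes> y1 \<oplus> x1 \<otimes> y) \<in> above (Suc (a + b))" by (simp add: I.I_minus_closed)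
  moreover have "x \<otimes> y = x0 \<otimes> y0 \<oplus> (x0 \<otimes> y1 \<oplus> x1 \<otimes> y)"
  proof -
    have "x \<otimes> y = x0 \<otimes> y \<oplus> x1 \<otimes> y" unfolding x(3) using c assms(2) by (simp add: l_distr)
    also have "x0 \<otimes> y = x0 \<otimes> y0 \<oplus> x0 \<otimes> y1" unfolding y(3) using c by (simp add: r_distr)
    finally show ?thesis using c assms(2) by (simp add: a_assoc)
  qed
  ultimately have "x0 \<otimes> y0 \<in> above (Suc (a + b))"
    using c assms(2) by (simp add: add_minus_cancel)
  then show False using component_not_above[OF component_mult[OF x(1) y(1)] ne] by simp
qed

lemma not_above_pow:
  assumes "y \<in> carrier R" "y \<notin> above (Suc m)"
  shows "y [^] k \<notin> above (Suc (k * m))"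
proof (induction k)
  case 0
  \<comment> \<open>If \<open>\<one>\<close> had positive order, multiplying by it would raise the
    finite order of \<open>y\<close>.\<close>
  have "\<one> \<notin> above (Suc 0)"
  proof
    assume "\<one> \<in> above (Suc 0)"
    then have "above (Suc 0) = carrier R" using ideal.one_imp_carrier[OF above_ideal] by blast
    moreover obtain a where "a \<le> m" "y \<in> above a" "y \<notin> above (Suc a)" using exact_order assms by blast
    moreover have "\<one> \<otimes> y \<in> above (Suc 0 + a)" using above_mult \<open>\<one> \<in> above (Suc 0)\<close> \<open>y \<in> above a\<close> by blast
    ultimately show False using assms(1) by simp
  qed
  then show ?case by simp
next
  case (Suc k)
  then show ?case
    using not_above_mult[of "y [^] k" y "k * m" m] assms by (simp add: add.commute)
qed

lemma homogeneous_ideal_above: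
  assumes I: "homogeneous_ideal R A I" and "\<And>d x. x \<in> I \<inter> A d \<Longrightarrow> x \<noteq> \<zero> \<Longrightarrow> a \<le> d"
  shows "I \<subseteq> above a"
proof -
  have "I = Idl (I \<inter> (\<Union>i. A i))" using I by (simp add: homogeneous_ideal_def)
  moreover have "Idl (I \<inter> (\<Union>i. A i)) \<subseteq> above a"
  proof (rule genideal_minimal[OF above_ideal])
    show "I \<inter> (\<Union>i. A i) \<subseteq> above a"
    proof
      fix x assume "x \<in> I \<inter> (\<Union>i. A i)"
      then obtain i where i: "x \<in> I \<inter> A i" by blast
      show "x \<in> above a"
      proof (cases "x = \<zero>")
        case False
        then show ?thesis using assms(2)[OF i] i component_above by blast
      qed (simp add: above_zero)
    qed
  qed
  ultimately show ?thesis by simp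
qed

lemma ideal_power_above:
  assumes "ideal I R" "I \<subseteq> above a"
  shows "ideal_power R I m \<subseteq> above (m * a)"
proof -
  have "pow_times I (carrier R) m \<subseteq> above (m * a)"
  proof (induction m)
    case (Suc m)
    have "I \<cdot> pow_times I (carrier R) m \<subseteq> above (Suc m * a)"
    proof (rule ideal_prod_subsetI[OF above_ideal])
      fix x y assume "x \<in> I" "y \<in> pow_times I (carrier R) m"
      then show "x \<otimes> y \<in> above (Suc m * a)" using above_mult[of x a y "m * a"] assms(2) Suc by auto
    qed
    then show ?case by simp
  qed (simp add: above_0)
  then show ?thesis using pow_times_carrier[OF assms(1)] by simp
qed

text \<open>A nonzero element of degree zero is a unit, because \<open>A 0\<close> is a
  field.\<close>

lemma proper_homogeneous_ideal_above_1:
  assumes I: "homogeneous_ideal R A I" "I \<noteq> carrier R"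
  shows "I \<subseteq> above 1"
proof (rule homogeneous_ideal_above[OF I(1)])
  have ideal: "ideal I R" using I(1) by (simp add: homogeneous_ideal_def)
  fix d x assume x: "x \<in> I \<inter> A d" "x \<noteq> \<zero>"
  show "1 \<le> d"
  proof (rule ccontr)
    assume "\<not> 1 \<le> d"
    then have "d = 0" by simp
    then have "x \<in> A 0 - {\<zero>}" using x by blast
    moreover have "subfield (A 0) R" using graded by (simp add: positively_graded_def)
    ultimately have "inv x \<in> A 0 - {\<zero>}" "inv x \<otimes> x = \<one>" using subfield_m_inv by blast+
    then have "\<one> \<in> I" using ideal.I_l_closed[OF ideal, of x "inv x"] x component_closed by auto
    then show False using ideal.one_imp_carrier[OF ideal] I(2) by blast
  qed
qed

text \<open>A homogeneous \<open>a\<close> of positive degree has \<open>a^N\<close> in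
  \<open>above N\<close>, hence in \<open>p\<close>. Perturbations may therefore be asked to have
  order as high as desired: only primes over \<open>above 1\<close> obstruct them.\<close>

lemma above_1_prime_subset:
  assumes p: "primeideal p R" and sub: "above N \<subseteq> p"
  shows "above 1 \<subseteq> p"
proof
  interpret p: primeideal p R by fact
  have pow: "a \<in> p" if "a \<in> carrier R" "a [^] n \<in> p" for a and n :: nat
    using that(2)
  proof (induction n)
    case 0
    then show ?case using p.one_imp_carrier p.I_notcarr by auto
  next
    case (Suc n)
    then show ?case using p.I_prime[of "a [^] n" a] that(1) by auto
  qed
  fix x assume "x \<in> above 1"
  then show "x \<in> p"
  proof (induction rule: above.induct)
    case (above_add a i y)
    have ac: "a \<in> carrier R" using above_add component_closed by blast
    have "a [^] n \<in> above n" for n :: nat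
    proof (induction n)
      case 0
      then show ?case using above_0 by simp
    next
      case (Suc n)
      then show ?case
        using above_mult[OF Suc component_above[OF above_add.hyps(1,2)]] by simp
    qed
    then have "a \<in> p" using pow[OF ac] sub by blast
    then show ?case using above_add by simp
  qed simp
qed

lemma initial_degree_cases:
  obtains (zero) "\<And>d x. x \<in> L \<inter> A d \<Longrightarrow> x = \<zero>" "initial_degree R A L = \<infinity>"
  | (degree) d x where "x \<in> L \<inter> A d" "x \<noteq> \<zero>" "initial_degree R A L = ereal (real d)"
      "\<And>e y. y \<in> L \<inter> A e \<Longrightarrow> y \<noteq> \<zero> \<Longrightarrow> d \<le> e"
proof (cases "\<exists>d. \<exists>x\<in>L \<inter> A d. x \<noteq> \<zero>")
  case False
  then have "{d. \<exists>x\<in>L \<inter> A d. x \<noteq> \<zero>} = {}" by simp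
  then have "initial_degree R A L = \<infinity>" unfolding initial_degree_def by (simp add: top_ereal_def)
  then show ?thesis using zero False by blast
next
  case True
  define d where "d = (LEAST d. \<exists>x\<in>L \<inter> A d. x \<noteq> \<zero>)"
  have d: "\<exists>x\<in>L \<inter> A d. x \<noteq> \<zero>" unfolding d_def using True by (rule LeastI_ex)
  have le: "d \<le> e" if "y \<in> L \<inter> A e" "y \<noteq> \<zero>" for e y
    unfolding d_def using that by (intro Least_le) blast
  have "initial_degree R A L = ereal (real d)"
    unfolding initial_degree_def
  proof (rule antisym)
    show "(INF d\<in>{d. \<exists>x\<in>L \<inter> A d. x \<noteq> \<zero>}. ereal (real d)) \<le> ereal (real d)"
      by (rule INF_lower) (use d in simp)
    show "ereal (real d) \<le> (INF d\<in>{d. \<exists>x\<in>L \<inter> A d. x \<noteq> \<zero>}. ereal (real d))"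
      by (rule INF_greatest) (use le in auto)
  qed
  then show ?thesis using degree d le by blast
qed

lemma initial_degree_geI:
  assumes "\<And>d x. x \<in> L \<inter> A d \<Longrightarrow> x \<noteq> \<zero> \<Longrightarrow> r \<le> real d"
  shows "ereal r \<le> initial_degree R A L"
  unfolding initial_degree_def by (rule INF_greatest) (use assms in auto)

end

section \<open>Syzygies and free presentations\<close>

context cring
begin

text \<open>With \<open>n = carrier R\<close> this is the ideal generated by the \<open>f l\<close>;
  with a smaller ideal \<open>n\<close> it is \<open>n\<close> times that ideal. Keeping one
  coefficient for each index lets these coefficients enter a matrix.\<close>

definition combinations :: "'a set \<Rightarrow> (nat \<Rightarrow> 'a) \<Rightarrow> nat \<Rightarrow> 'a set" where
  "combinations n f t = {\<Oplus>l\<in>{..<t}. e l \<otimes> f l |e. \<forall>l<t. e l \<in> n}"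

lemma finsum_combine_add:
  assumes "\<And>l. l < (t::nat) \<Longrightarrow> e l \<in> carrier R" "\<And>l. l < t \<Longrightarrow> e' l \<in> carrier R"
    "\<And>l. l < t \<Longrightarrow> f l \<in> carrier R"
  shows "(\<Oplus>l\<in>{..<t}. e l \<otimes> f l) \<oplus> (\<Oplus>l\<in>{..<t}. e' l \<otimes> f l) = (\<Oplus>l\<in>{..<t}. (e l \<oplus> e' l) \<otimes> f l)"
proof -
  have "(\<Oplus>l\<in>{..<t}. (e l \<oplus> e' l) \<otimes> f l) = (\<Oplus>l\<in>{..<t}. e l \<otimes> f l \<oplus> e' l \<otimes> f l)"
    by (rule finsum_cong') (use assms in \<open>auto simp: l_distr\<close>)
  also have "\<dots> = (\<Oplus>l\<in>{..<t}. e l \<otimes> f l) \<oplus> (\<Oplus>l\<in>{..<t}. e' l \<otimes> f l)"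
    by (rule finsum_addf) (use assms in auto)
  finally show ?thesis by simp
qed

lemma finsum_combine_single:
  assumes "k < (t::nat)" "x \<in> carrier R" "\<And>l. l < t \<Longrightarrow> f l \<in> carrier R"
  shows "(\<Oplus>l\<in>{..<t}. (if l = k then x else \<zero>) \<otimes> f l) = x \<otimes> f k"
proof -
  have "(\<Oplus>l\<in>{..<t}. (if l = k then x else \<zero>) \<otimes> f l)
      = (\<Oplus>l\<in>{..<t}. if l = k then (\<lambda>l. x \<otimes> f l) l else \<zero>)"
    by (rule finsum_cong') (use assms in auto)
  also have "\<dots> = x \<otimes> f k"
    by (subst add.finprod_singleton_swap) (use assms in auto)
  finally show ?thesis .
qed

lemma combinations_ideal:
  assumes n: "ideal n R" and f: "\<And>l. l < t \<Longrightarrow> f l \<in> carrier R"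
  shows "ideal (combinations n f t) R"
proof (rule ideal_closedI)
  interpret n: ideal n R by fact
  show "combinations n f t \<subseteq> carrier R"
    using n.Icarr f by (auto simp: combinations_def intro!: finsum_closed)
  have "(\<Oplus>l\<in>{..<t}. \<zero> \<otimes> f l) = (\<Oplus>l\<in>{..<t}. \<zero>)" by (rule finsum_cong') (use f in auto)
  also have "\<dots> = \<zero>" by (simp add: finsum_zero)
  finally show "\<zero> \<in> combinations n f t"
    unfolding combinations_def using n.zero_closed by (intro CollectI exI[of _ "\<lambda>_. \<zero>"]) simp
next
  interpret n: ideal n R by fact
  fix x y assume "x \<in> combinations n f t" "y \<in> combinations n f t"
  then obtain e e' where e: "\<forall>l<t. e l \<in> n" "x = (\<Oplus>l\<in>{..<t}. e l \<otimes> f l)"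
    "\<forall>l<t. e' l \<in> n" "y = (\<Oplus>l\<in>{..<t}. e' l \<otimes> f l)" by (auto simp: combinations_def)
  have "x \<oplus> y = (\<Oplus>l\<in>{..<t}. (e l \<oplus> e' l) \<otimes> f l)"
    unfolding e by (rule finsum_combine_add) (use e n.Icarr f in auto)
  then show "x \<oplus> y \<in> combinations n f t"
    unfolding combinations_def using e by (intro CollectI exI[of _ "\<lambda>l. e l \<oplus> e' l"]) simp
next
  interpret n: ideal n R by fact
  fix x r assume "x \<in> combinations n f t" and r: "r \<in> carrier R"
  then obtain e where e: "\<forall>l<t. e l \<in> n" "x = (\<Oplus>l\<in>{..<t}. e l \<otimes> f l)"
    by (auto simp: combinations_def)
  have "r \<otimes> x = (\<Oplus>l\<in>{..<t}. r \<otimes> (e l \<otimes> f l))"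
    unfolding e by (rule finsum_rdistr) (use e n.Icarr f r in auto)
  also have "\<dots> = (\<Oplus>l\<in>{..<t}. (r \<otimes> e l) \<otimes> f l)"
    by (rule finsum_cong') (use e n.Icarr f r in \<open>auto simp: m_assoc\<close>)
  finally show "r \<otimes> x \<in> combinations n f t"
    unfolding combinations_def using e r n.I_l_closed by (intro CollectI exI[of _ "\<lambda>l. r \<otimes> e l"]) simp
qed

lemma combinations_single:
  assumes n: "ideal n R" and f: "\<And>l. l < t \<Longrightarrow> f l \<in> carrier R" and "k < t" "x \<in> n"
  shows "x \<otimes> f k \<in> combinations n f t"
proof -
  interpret n: ideal n R by fact
  have "x \<otimes> f k = (\<Oplus>l\<in>{..<t}. (if l = k then x else \<zero>) \<otimes> f l)"
    by (rule finsum_combine_single[symmetric]) (use assms n.Icarr in auto)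
  then show ?thesis
    unfolding combinations_def using assms(4) n.zero_closed
    by (intro CollectI exI[of _ "\<lambda>l. if l = k then x else \<zero>"]) simp
qed

lemma combinations_subset:
  assumes "ideal J R" "n \<subseteq> carrier R" "\<And>l. l < t \<Longrightarrow> f l \<in> J"
  shows "combinations n f t \<subseteq> J"
proof
  fix x assume "x \<in> combinations n f t"
  then obtain e where e: "\<forall>l<t. e l \<in> n" "x = (\<Oplus>l\<in>{..<t}. e l \<otimes> f l)"
    by (auto simp: combinations_def)
  show "x \<in> J" unfolding e(2)
    by (rule finsum_in_ideal[OF assms(1)]) (use e assms ideal.I_l_closed[OF assms(1)] in auto)
qed

lemma Idl_list_eq_combinations:
  assumes "set fs \<subseteq> carrier R"
  shows "Idl (set fs) = combinations (carrier R) ((!) fs) (length fs)"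
proof
  have f: "fs ! l \<in> carrier R" if "l < length fs" for l using assms that nth_mem by blast
  show "combinations (carrier R) ((!) fs) (length fs) \<subseteq> Idl (set fs)"
    by (rule combinations_subset[OF genideal_ideal[OF assms]]) (use genideal_self[OF assms] in auto)
  show "Idl (set fs) \<subseteq> combinations (carrier R) ((!) fs) (length fs)"
  proof (rule genideal_minimal)
    show "ideal (combinations (carrier R) ((!) fs) (length fs)) R"
      by (rule combinations_ideal[OF oneideal f])
    show "set fs \<subseteq> combinations (carrier R) ((!) fs) (length fs)"
    proof
      fix x assume "x \<in> set fs"
      then obtain k where k: "k < length fs" "x = fs ! k" by (auto simp: in_set_conv_nth)
      have "\<one> \<otimes> fs ! k \<in> combinations (carrier R) ((!) fs) (length fs)"
        by (rule combinations_single[OF oneideal f k(1)]) auto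
      then show "x \<in> combinations (carrier R) ((!) fs) (length fs)" using k f by simp
    qed
  qed
qed

section \<open>Finite generation of syzygies\<close>

inductive_set vspan :: "(nat \<Rightarrow> 'a) set \<Rightarrow> (nat \<Rightarrow> 'a) set" for G :: "(nat \<Rightarrow> 'a) set" where
  vspan_zero: "(\<lambda>_. \<zero>) \<in> vspan G"
| vspan_step: "v \<in> vspan G \<Longrightarrow> g \<in> G \<Longrightarrow> r \<in> carrier R \<Longrightarrow> (\<lambda>i. v i \<oplus> r \<otimes> g i) \<in> vspan G"

definition vsubmodule :: "(nat \<Rightarrow> 'a) set \<Rightarrow> bool" where
  "vsubmodule N \<longleftrightarrow> N \<subseteq> UNIV \<rightarrow> carrier R \<and> (\<lambda>_. \<zero>) \<in> N \<and>
    (\<forall>v\<in>N. \<forall>w\<in>N. \<forall>r\<in>carrier R. (\<lambda>i. v i \<oplus> r \<otimes> w i) \<in> N)"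

lemma vspan_subset: "v \<in> vspan G \<Longrightarrow> vsubmodule N \<Longrightarrow> G \<subseteq> N \<Longrightarrow> v \<in> N"
  by (induction rule: vspan.induct) (auto simp: vsubmodule_def)

lemma vspan_mono: "v \<in> vspan G \<Longrightarrow> G \<subseteq> H \<Longrightarrow> v \<in> vspan H"
  by (induction rule: vspan.induct) (auto intro: vspan_zero vspan_step)

lemma vspan_closed: "v \<in> vspan G \<Longrightarrow> G \<subseteq> UNIV \<rightarrow> carrier R \<Longrightarrow> v i \<in> carrier R"
  by (induction rule: vspan.induct) (auto simp: subset_iff Pi_iff)

lemma vspan_add:
  assumes "w \<in> vspan G" "v \<in> vspan G" "G \<subseteq> UNIV \<rightarrow> carrier R"
  shows "(\<lambda>i. v i \<oplus> w i) \<in> vspan G"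
  using assms(1)
proof (induction rule: vspan.induct)
  case vspan_zero
  have "(\<lambda>i. v i \<oplus> \<zero>) = v" using vspan_closed[OF assms(2,3)] by auto
  then show ?case using assms(2) by simp
next
  case (vspan_step w g r)
  have "(\<lambda>i. v i \<oplus> (w i \<oplus> r \<otimes> g i)) = (\<lambda>i. (v i \<oplus> w i) \<oplus> r \<otimes> g i)"
  proof
    fix i
    have "g i \<in> carrier R" using vspan_step.hyps(2) assms(3) by auto
    then show "v i \<oplus> (w i \<oplus> r \<otimes> g i) = (v i \<oplus> w i) \<oplus> r \<otimes> g i"
      using vspan_closed[OF assms(2,3)] vspan_closed[OF vspan_step.hyps(1) assms(3)] vspan_step.hyps(3)
      by (simp add: a_assoc)
  qed
  then show ?case using vspan.vspan_step[OF vspan_step.IH vspan_step.hyps(2,3)] by simp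
qed

lemma vspan_smult:
  assumes "w \<in> vspan G" "s \<in> carrier R" "G \<subseteq> UNIV \<rightarrow> carrier R"
  shows "(\<lambda>i. s \<otimes> w i) \<in> vspan G"
  using assms(1)
proof (induction rule: vspan.induct)
  case vspan_zero
  then show ?case using assms(2) vspan.vspan_zero by simp
next
  case (vspan_step w g r)
  have "(\<lambda>i. s \<otimes> (w i \<oplus> r \<otimes> g i)) = (\<lambda>i. s \<otimes> w i \<oplus> (s \<otimes> r) \<otimes> g i)"
  proof
    fix i
    have "g i \<in> carrier R" using vspan_step.hyps(2) assms(3) by auto
    then show "s \<otimes> (w i \<oplus> r \<otimes> g i) = s \<otimes> w i \<oplus> (s \<otimes> r) \<otimes> g i"
      using vspan_closed[OF vspan_step.hyps(1) assms(3)] vspan_step.hyps(3) assms(2)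
      by (simp add: r_distr m_assoc)
  qed
  then show ?case using vspan.vspan_step[OF vspan_step.IH vspan_step.hyps(2)] vspan_step.hyps(3) assms(2)
    by simp
qed

lemma vspan_list_coefficients:
  assumes "v \<in> vspan (set gs)" "set gs \<subseteq> UNIV \<rightarrow> carrier R"
  shows "\<exists>w. (\<forall>j<length gs. w j \<in> carrier R) \<and> (\<forall>i. v i = (\<Oplus>j\<in>{..<length gs}. w j \<otimes> (gs ! j) i))"
  using assms(1)
proof (induction rule: vspan.induct)
  have g: "(gs ! j) i \<in> carrier R" if "j < length gs" for i j
    using assms(2) nth_mem[OF that] by auto
  {
    case vspan_zero
    have "(\<Oplus>j\<in>{..<length gs}. \<zero> \<otimes> (gs ! j) i) = (\<Oplus>j\<in>{..<length gs}. \<zero>)" for i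
      by (rule finsum_cong') (use g in auto)
    then show ?case by (intro exI[of _ "\<lambda>_. \<zero>"]) (simp add: finsum_zero)
  next
    case (vspan_step v h r)
    then obtain w where w: "\<forall>j<length gs. w j \<in> carrier R"
      "\<forall>i. v i = (\<Oplus>j\<in>{..<length gs}. w j \<otimes> (gs ! j) i)" by blast
    obtain k where k: "k < length gs" "h = gs ! k" using vspan_step.hyps(2) by (auto simp: in_set_conv_nth)
    let ?d = "\<lambda>j. if j = k then r else \<zero>"
    have "v i \<oplus> r \<otimes> h i = (\<Oplus>j\<in>{..<length gs}. (w j \<oplus> ?d j) \<otimes> (gs ! j) i)" for i
    proof -
      have "r \<otimes> h i = (\<Oplus>j\<in>{..<length gs}. ?d j \<otimes> (gs ! j) i)"
        unfolding k(2) by (rule finsum_combine_single[symmetric]) (use k vspan_step.hyps g in auto)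
      moreover have "v i = (\<Oplus>j\<in>{..<length gs}. w j \<otimes> (gs ! j) i)" using w(2) by blast
      ultimately have "v i \<oplus> r \<otimes> h i = (\<Oplus>j\<in>{..<length gs}. w j \<otimes> (gs ! j) i) \<oplus>
          (\<Oplus>j\<in>{..<length gs}. ?d j \<otimes> (gs ! j) i)" by simp
      also have "\<dots> = (\<Oplus>j\<in>{..<length gs}. (w j \<oplus> ?d j) \<otimes> (gs ! j) i)"
        by (rule finsum_combine_add) (use w(1) vspan_step.hyps g in auto)
      finally show ?thesis .
    qed
    then show ?case using w(1) vspan_step.hyps(3) by (intro exI[of _ "\<lambda>j. w j \<oplus> ?d j"]) auto
  }
qed

lemma list_combination_in_vsubmodule:
  assumes N: "vsubmodule N" and gs: "set gs \<subseteq> N" and w: "\<And>j. j < length gs \<Longrightarrow> w j \<in> carrier R"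
  shows "(\<lambda>i. \<Oplus>j\<in>{..<length gs}. w j \<otimes> (gs ! j) i) \<in> N"
proof -
  have g: "(gs ! j) i \<in> carrier R" if "j < length gs" for i j
    using gs N nth_mem[OF that] unfolding vsubmodule_def by blast
  have "m \<le> length gs \<Longrightarrow> (\<lambda>i. \<Oplus>j\<in>{..<m}. w j \<otimes> (gs ! j) i) \<in> N" for m
  proof (induction m)
    case 0
    then show ?case using N by (simp add: finsum_empty vsubmodule_def)
  next
    case (Suc m)
    have "(\<Oplus>j\<in>{..<Suc m}. w j \<otimes> (gs ! j) i) = (\<Oplus>j\<in>{..<m}. w j \<otimes> (gs ! j) i) \<oplus> w m \<otimes> (gs ! m) i" for i
    proof -
      have "(\<Oplus>j\<in>insert m {..<m}. w j \<otimes> (gs ! j) i) = w m \<otimes> (gs ! m) i \<oplus> (\<Oplus>j\<in>{..<m}. w j \<otimes> (gs ! j) i)"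
        by (rule finsum_insert) (use w g Suc.prems in auto)
      moreover have "(\<Oplus>j\<in>{..<m}. w j \<otimes> (gs ! j) i) \<in> carrier R"
        by (rule finsum_closed) (use w g Suc.prems in auto)
      ultimately show ?thesis using w g Suc.prems by (simp add: lessThan_Suc a_comm)
    qed
    moreover have "(\<lambda>i. (\<Oplus>j\<in>{..<m}. w j \<otimes> (gs ! j) i) \<oplus> w m \<otimes> (gs ! m) i) \<in> N"
    proof -
      have "gs ! m \<in> N" using gs Suc.prems by auto
      then show ?thesis using N Suc w unfolding vsubmodule_def by simp
    qed
    ultimately show ?case by simp
  qed
  then show ?thesis by simp
qed

end

context noetherian_cring
begin

text \<open>Induction on the number of coordinates: the last coordinates form an ideal, finitely
  many vectors of \<open>N\<close> realize its generators, and what is left has last coordinate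
  zero. Vectors are functions on all of \<open>nat\<close>, so agreement is claimed below
  \<open>n\<close> only.\<close>

lemma vsubmodule_finitely_generated:
  assumes "vsubmodule N"
  shows "\<exists>G. finite G \<and> G \<subseteq> N \<and> (\<forall>v\<in>N. \<exists>s\<in>vspan G. \<forall>i<n. v i = s i)"
  using assms
proof (induction n arbitrary: N)
  case 0
  then show ?case by (intro exI[of _ "{}"]) (auto intro: vspan_zero)
next
  case (Suc n)
  note N = Suc.prems
  have Nc: "v i \<in> carrier R" if "v \<in> N" for v i using N that by (auto simp: vsubmodule_def)
  have Ncomb: "(\<lambda>i. v i \<oplus> r \<otimes> w i) \<in> N" if "v \<in> N" "w \<in> N" "r \<in> carrier R" for v w r
    using N that by (simp add: vsubmodule_def)
  have Nz: "(\<lambda>_. \<zero>) \<in> N" using N by (simp add: vsubmodule_def)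
  let ?L = "(\<lambda>v. v n) ` N"
  have L: "ideal ?L R"
  proof (rule ideal_closedI)
    show "?L \<subseteq> carrier R" using Nc by auto
    show "\<zero> \<in> ?L" using Nz by (rule image_eqI[rotated]) simp
  next
    fix x y assume "x \<in> ?L" "y \<in> ?L"
    then obtain v w where vw: "v \<in> N" "w \<in> N" "x = v n" "y = w n" by auto
    have "(\<lambda>i. v i \<oplus> \<one> \<otimes> w i) \<in> N" using Ncomb vw by simp
    then show "x \<oplus> y \<in> ?L" using vw Nc by (intro image_eqI[of _ _ "\<lambda>i. v i \<oplus> \<one> \<otimes> w i"]) auto
  next
    fix x r assume "x \<in> ?L" and r: "r \<in> carrier R"
    then obtain v where v: "v \<in> N" "x = v n" by auto
    have "(\<lambda>i. \<zero> \<oplus> r \<otimes> v i) \<in> N" using Ncomb[OF Nz v(1) r] by simp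
    then show "r \<otimes> x \<in> ?L" using v Nc r by (intro image_eqI[of _ _ "\<lambda>i. \<zero> \<oplus> r \<otimes> v i"]) auto
  qed
  obtain B where B: "B \<subseteq> carrier R" "finite B" "?L = Idl B" using finetely_gen[OF L] by auto
  have "B \<subseteq> ?L" unfolding B(3) by (rule genideal_self[OF B(1)])
  then obtain G where G: "G \<subseteq> N" "finite G" "B = (\<lambda>v. v n) ` G"
    by (rule finite_subset_image[OF B(2), THEN exE]) blast
  have Gc: "G \<subseteq> UNIV \<rightarrow> carrier R" using G(1) Nc by auto
  let ?N' = "{v \<in> N. v n = \<zero>}"
  have N': "vsubmodule ?N'"
    using N Nc unfolding vsubmodule_def by auto
  then obtain H where H: "finite H" "H \<subseteq> ?N'" "\<forall>v\<in>?N'. \<exists>s\<in>vspan H. \<forall>i<n. v i = s i"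
    using Suc.IH[OF N'] by blast
  have Hc: "H \<subseteq> UNIV \<rightarrow> carrier R" using H(2) Nc by auto
  have GHc: "G \<union> H \<subseteq> UNIV \<rightarrow> carrier R" using Gc Hc by simp
  have last: "\<exists>s\<in>vspan G. s n = x" if "x \<in> ?L" for x
  proof -
    have "ideal {s n |s. s \<in> vspan G} R"
    proof (rule ideal_closedI)
      show "{s n |s. s \<in> vspan G} \<subseteq> carrier R" using vspan_closed[OF _ Gc] by auto
      show "\<zero> \<in> {s n |s. s \<in> vspan G}" by (intro CollectI exI[of _ "\<lambda>_. \<zero>"]) (simp add: vspan_zero)
    next
      fix x y assume "x \<in> {s n |s. s \<in> vspan G}" "y \<in> {s n |s. s \<in> vspan G}"
      then obtain s s' where "s \<in> vspan G" "s' \<in> vspan G" "x = s n" "y = s' n" by auto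
      then show "x \<oplus> y \<in> {s n |s. s \<in> vspan G}"
        using vspan_add[of s' G s, OF _ _ Gc] by (intro CollectI exI[of _ "\<lambda>i. s i \<oplus> s' i"]) simp
    next
      fix x r assume "x \<in> {s n |s. s \<in> vspan G}" and r: "r \<in> carrier R"
      then obtain s where "s \<in> vspan G" "x = s n" by auto
      then show "r \<otimes> x \<in> {s n |s. s \<in> vspan G}"
        using vspan_smult[of s G r, OF _ r Gc] by (intro CollectI exI[of _ "\<lambda>i. r \<otimes> s i"]) simp
    qed
    moreover have "B \<subseteq> {s n |s. s \<in> vspan G}"
    proof
      fix b assume "b \<in> B"
      then obtain g where g: "g \<in> G" "b = g n" using G(3) by auto
      have "g i \<in> carrier R" for i using g Gc by auto
      then have "(\<lambda>i. \<zero> \<oplus> \<one> \<otimes> g i) = g" by auto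
      then have "g \<in> vspan G" using vspan_step[OF vspan_zero g(1) one_closed] by simp
      then show "b \<in> {s n |s. s \<in> vspan G}" using g by blast
    qed
    ultimately have "Idl B \<subseteq> {s n |s. s \<in> vspan G}" by (rule genideal_minimal)
    then show ?thesis using that B(3) by auto
  qed
  have "\<exists>s\<in>vspan (G \<union> H). \<forall>i<Suc n. v i = s i" if v: "v \<in> N" for v
  proof -
    obtain s where s: "s \<in> vspan G" "s n = v n" using last v by auto
    have sN: "s \<in> N" by (rule vspan_subset[OF s(1) N G(1)])
    \<comment> \<open>Subtracting \<open>s\<close> clears coordinate \<open>n\<close> and moves
      \<open>v\<close> into \<open>?N'\<close>, where the induction hypothesis applies.\<close>
    let ?u = "\<lambda>i. v i \<oplus> (\<ominus> \<one>) \<otimes> s i"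
    have "?u \<in> N" using Ncomb[OF v sN] by simp
    moreover have "?u n = \<zero>" using s(2) Nc[OF v] by (simp add: l_minus r_neg)
    ultimately have "?u \<in> ?N'" by simp
    from bspec[OF H(3) this] obtain s' where s': "s' \<in> vspan H" "\<forall>i<n. ?u i = s' i" by (rule bexE)
    have "s' n = \<zero>" using vspan_subset[OF s'(1) N' H(2)] by blast
    have "v i = s i \<oplus> s' i" if "i < Suc n" for i
    proof (cases "i = n")
      case True
      show ?thesis unfolding True s(2) \<open>s' n = \<zero>\<close> by (rule r_zero[OF Nc[OF v], symmetric])
    next
      case False
      then have "s' i = v i \<ominus> s i" using s'(2) that Nc[OF sN] Nc[OF v] by (simp add: l_minus minus_eq)
      then show ?thesis using Nc[OF sN] Nc[OF v] by (simp add: add_minus_cancel)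
    qed
    moreover have "(\<lambda>i. s i \<oplus> s' i) \<in> vspan (G \<union> H)"
      by (rule vspan_add[OF _ _ GHc]) (use s s' in \<open>auto intro: vspan_mono\<close>)
    ultimately show ?thesis by (intro bexI[of _ "\<lambda>i. s i \<oplus> s' i"] allI impI)
  qed
  then have "\<forall>v\<in>N. \<exists>s\<in>vspan (G \<union> H). \<forall>i<Suc n. v i = s i" by (rule ballI)
  moreover have "finite (G \<union> H)" "G \<union> H \<subseteq> N" using G H by auto
  ultimately show ?case by (intro exI[of _ "G \<union> H"] conjI)
qed

end

context cring
begin

lemma ideal_as_module_finsum:
  assumes I: "ideal I R" and f: "\<And>i. i \<in> B \<Longrightarrow> f i \<in> I" and fin: "finite B"
  shows "finsum (ideal_as_module R I) f B = finsum R f B"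
proof -
  interpret M: module R "ideal_as_module R I" by (rule module_ideal_as_module[OF I])
  have *: "carrier (ideal_as_module R I) = I" "\<zero>\<^bsub>ideal_as_module R I\<^esub> = \<zero>"
    "x \<oplus>\<^bsub>ideal_as_module R I\<^esub> y = x \<oplus> y" for x y
    by (simp_all add: ideal_as_module_def)
  show ?thesis using fin f
  proof (induction B rule: finite_induct)
    case empty
    then show ?case using * by (simp add: finsum_empty M.finsum_empty)
  next
    case (insert b B)
    have "finsum (ideal_as_module R I) f (insert b B) =
        f b \<oplus>\<^bsub>ideal_as_module R I\<^esub> finsum (ideal_as_module R I) f B"
      by (rule M.finsum_insert) (use insert * in auto)
    moreover have "finsum R f (insert b B) = f b \<oplus> finsum R f B"
      by (rule finsum_insert) (use insert ideal.Icarr[OF I] in auto)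
    ultimately show ?case using insert * by simp
  qed
qed

lemma free_presentation_ideal_iff:
  assumes I: "ideal I R"
  shows "free_presentation R (ideal_as_module R I) \<mu> q \<phi> g \<longleftrightarrow>
    entries_in \<mu> q \<phi> \<and> (\<forall>i<\<mu>. g i \<in> I) \<and> I = combinations (carrier R) g \<mu> \<and>
    (\<forall>v\<in>{..<\<mu>} \<rightarrow> carrier R. (\<Oplus>i\<in>{..<\<mu>}. v i \<otimes> g i) = \<zero> \<longleftrightarrow>
      (\<exists>w\<in>{..<q} \<rightarrow> carrier R. \<forall>i<\<mu>. v i = (\<Oplus>j\<in>{..<q}. \<phi> i j \<otimes> w j)))"
proof (cases "\<forall>i<\<mu>. g i \<in> I")
  case True
  have fs: "(\<Oplus>\<^bsub>ideal_as_module R I\<^esub>i\<in>{..<\<mu>}. v i \<odot>\<^bsub>ideal_as_module R I\<^esub> g i)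
      = (\<Oplus>i\<in>{..<\<mu>}. v i \<otimes> g i)" if v: "v \<in> {..<\<mu>} \<rightarrow> carrier R" for v
  proof -
    have "(\<Oplus>\<^bsub>ideal_as_module R I\<^esub>i\<in>{..<\<mu>}. v i \<otimes> g i) = (\<Oplus>i\<in>{..<\<mu>}. v i \<otimes> g i)"
      by (rule ideal_as_module_finsum[OF I]) (use True v ideal.I_l_closed[OF I] in auto)
    then show ?thesis by (simp add: ideal_as_module_def)
  qed
  have car: "carrier (ideal_as_module R I) = I" "\<zero>\<^bsub>ideal_as_module R I\<^esub> = \<zero>"
    by (simp_all add: ideal_as_module_def)
  have "combinations (carrier R) g \<mu> \<subseteq> I"
    by (rule combinations_subset[OF I]) (use True in auto)
  moreover have "combinations (carrier R) g \<mu> =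
      {x. \<exists>v\<in>{..<\<mu>} \<rightarrow> carrier R. x = (\<Oplus>i\<in>{..<\<mu>}. v i \<otimes> g i)}"
    by (auto simp: combinations_def Pi_iff Bex_def)
  ultimately have "I = combinations (carrier R) g \<mu> \<longleftrightarrow>
      (\<forall>x\<in>I. \<exists>v\<in>{..<\<mu>} \<rightarrow> carrier R. x = (\<Oplus>i\<in>{..<\<mu>}. v i \<otimes> g i))"
    by blast
  then show ?thesis
    unfolding free_presentation_def car using True fs by (simp cong: bex_cong)
next
  case False
  then show ?thesis by (auto simp: free_presentation_def ideal_as_module_def)
qed

end

text \<open>Finitely many generators of \<open>I\<close> form \<open>g\<close>; the columns of
  \<open>\<phi>\<close> are finitely many generators of their syzygies.\<close>

lemma (in noetherian_cring) exists_free_presentation: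
  assumes I: "ideal I R"
  shows "\<exists>\<mu> q \<phi> g. free_presentation R (ideal_as_module R I) \<mu> q \<phi> g"
proof -
  interpret I: ideal I R by fact
  obtain B where B: "B \<subseteq> carrier R" "finite B" "I = Idl B" using finetely_gen[OF I] by blast
  obtain fs where fs: "set fs = B" using finite_list[OF B(2)] by blast
  let ?\<mu> = "length fs" and ?g = "(!) fs"
  have g: "?g i \<in> I" if "i < ?\<mu>" for i using genideal_self[OF B(1)] B(3) fs that nth_mem by blast
  have gc: "?g i \<in> carrier R" if "i < ?\<mu>" for i using g[OF that] I.Icarr by blast
  have comb: "I = combinations (carrier R) ?g ?\<mu>" using Idl_list_eq_combinations[of fs] B fs by simp
  let ?N = "{v \<in> UNIV \<rightarrow> carrier R. (\<Oplus>i\<in>{..<?\<mu>}. v i \<otimes> ?g i) = \<zero>}"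
  have N: "vsubmodule ?N"
    unfolding vsubmodule_def
  proof (intro conjI ballI)
    have "(\<Oplus>i\<in>{..<?\<mu>}. \<zero> \<otimes> ?g i) = (\<Oplus>i\<in>{..<?\<mu>}. \<zero>)" by (rule finsum_cong') (use gc in auto)
    then show "(\<lambda>_. \<zero>) \<in> ?N" by (simp add: finsum_zero)
  next
    fix v w r assume vw: "v \<in> ?N" "w \<in> ?N" and r: "r \<in> carrier R"
    have c: "v i \<in> carrier R" "w i \<in> carrier R" for i using vw by auto
    have "(\<Oplus>i\<in>{..<?\<mu>}. (v i \<oplus> r \<otimes> w i) \<otimes> ?g i)
        = (\<Oplus>i\<in>{..<?\<mu>}. v i \<otimes> ?g i) \<oplus> (\<Oplus>i\<in>{..<?\<mu>}. (r \<otimes> w i) \<otimes> ?g i)"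
      by (rule finsum_combine_add[symmetric]) (use c r gc in auto)
    also have "(\<Oplus>i\<in>{..<?\<mu>}. (r \<otimes> w i) \<otimes> ?g i) = (\<Oplus>i\<in>{..<?\<mu>}. r \<otimes> (w i \<otimes> ?g i))"
      by (rule finsum_cong') (use c r gc in \<open>auto simp: m_assoc\<close>)
    also have "\<dots> = r \<otimes> (\<Oplus>i\<in>{..<?\<mu>}. w i \<otimes> ?g i)"
      by (rule finsum_rdistr[symmetric]) (use c r gc in auto)
    finally have "(\<Oplus>i\<in>{..<?\<mu>}. (v i \<oplus> r \<otimes> w i) \<otimes> ?g i) = \<zero>" using vw r by simp
    then show "(\<lambda>i. v i \<oplus> r \<otimes> w i) \<in> ?N" using c r by simp
  qed auto
  obtain G where G: "finite G" "G \<subseteq> ?N" "\<forall>v\<in>?N. \<exists>s\<in>vspan G. \<forall>i<?\<mu>. v i = s i"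
    using vsubmodule_finitely_generated[OF N, of ?\<mu>] by blast
  obtain gs where gs: "set gs = G" using finite_list[OF G(1)] by blast
  let ?\<phi> = "\<lambda>i j. (gs ! j) i"
  have gsN: "gs ! j \<in> ?N" if "j < length gs" for j using gs G(2) that nth_mem by blast
  have phi: "?\<phi> i j \<in> carrier R" if "j < length gs" for i j using gsN[OF that] by auto
  have "free_presentation R (ideal_as_module R I) ?\<mu> (length gs) ?\<phi> ?g"
    unfolding free_presentation_ideal_iff[OF I]
  proof (intro conjI ballI comb)
    show "entries_in ?\<mu> (length gs) ?\<phi>" using phi by simp
    show "\<forall>i<?\<mu>. ?g i \<in> I" using g by blast
    fix v assume v: "v \<in> {..<?\<mu>} \<rightarrow> carrier R"
    \<comment> \<open>Extended by zero, since the syzygies in \<open>?N\<close> are functions on all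
      of \<open>nat\<close>.\<close>
    let ?v = "\<lambda>i. if i < ?\<mu> then v i else \<zero>"
    have eqv: "(\<Oplus>i\<in>{..<?\<mu>}. ?v i \<otimes> ?g i) = (\<Oplus>i\<in>{..<?\<mu>}. v i \<otimes> ?g i)"
      by (rule finsum_cong') (use v gc in auto)
    have comm: "(\<Oplus>j\<in>{..<length gs}. ?\<phi> i j \<otimes> w j) = (\<Oplus>j\<in>{..<length gs}. w j \<otimes> ?\<phi> i j)"
      if "w \<in> {..<length gs} \<rightarrow> carrier R" for w i
      by (rule finsum_cong') (use that phi in \<open>auto simp: Pi_iff intro!: m_comm\<close>)
    show "(\<Oplus>i\<in>{..<?\<mu>}. v i \<otimes> ?g i) = \<zero> \<longleftrightarrow>
      (\<exists>w\<in>{..<length gs} \<rightarrow> carrier R. \<forall>i<?\<mu>. v i = (\<Oplus>j\<in>{..<length gs}. ?\<phi> i j \<otimes> w j))"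
    proof
      assume "(\<Oplus>i\<in>{..<?\<mu>}. v i \<otimes> ?g i) = \<zero>"
      then have "?v \<in> ?N" using eqv v by auto
      from bspec[OF G(3) this] obtain s where s: "s \<in> vspan G" "\<forall>i<?\<mu>. ?v i = s i" by (rule bexE)
      have "set gs \<subseteq> UNIV \<rightarrow> carrier R" using gs G(2) by blast
      then obtain w where w: "\<forall>j<length gs. w j \<in> carrier R"
        "\<forall>i. s i = (\<Oplus>j\<in>{..<length gs}. w j \<otimes> (gs ! j) i)"
        using vspan_list_coefficients[of s gs] s(1) gs by blast
      have wP: "w \<in> {..<length gs} \<rightarrow> carrier R" using w(1) by auto
      have "v i = (\<Oplus>j\<in>{..<length gs}. ?\<phi> i j \<otimes> w j)" if i: "i < ?\<mu>" for i
      proof -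
        have "v i = s i" using s(2) i by auto
        then show ?thesis unfolding comm[OF wP] using w(2) by simp
      qed
      then show "\<exists>w\<in>{..<length gs} \<rightarrow> carrier R. \<forall>i<?\<mu>. v i = (\<Oplus>j\<in>{..<length gs}. ?\<phi> i j \<otimes> w j)"
        using wP by blast
    next
      assume "\<exists>w\<in>{..<length gs} \<rightarrow> carrier R. \<forall>i<?\<mu>. v i = (\<Oplus>j\<in>{..<length gs}. ?\<phi> i j \<otimes> w j)"
      then obtain w where w: "w \<in> {..<length gs} \<rightarrow> carrier R"
        "\<forall>i<?\<mu>. v i = (\<Oplus>j\<in>{..<length gs}. ?\<phi> i j \<otimes> w j)" by blast
      let ?s = "\<lambda>i. \<Oplus>j\<in>{..<length gs}. w j \<otimes> (gs ! j) i"
      have "?s \<in> ?N"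
        by (rule list_combination_in_vsubmodule[OF N]) (use gs G(2) w(1) in auto)
      then have "(\<Oplus>i\<in>{..<?\<mu>}. ?s i \<otimes> ?g i) = \<zero>" "\<And>i. ?s i \<in> carrier R" by auto
      moreover have "(\<Oplus>i\<in>{..<?\<mu>}. v i \<otimes> ?g i) = (\<Oplus>i\<in>{..<?\<mu>}. ?s i \<otimes> ?g i)"
        by (rule finsum_cong') (use w comm[OF w(1)] gc calculation(2) in auto)
      ultimately show "(\<Oplus>i\<in>{..<?\<mu>}. v i \<otimes> ?g i) = \<zero>" by simp
    qed
  qed
  then show ?thesis by blast
qed

section \<open>Fitting ideals as conductors\<close>

text \<open>The colon ideal \<open>Q : n\<close>; knowing that it is an ideal reduces the claim that
  \<open>n T\<close> lies in \<open>Q\<close> to generators of \<open>T\<close>.\<close>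

lemma (in cring) mult_subset_ideal:
  assumes "ideal Q R" "n \<subseteq> carrier R"
  shows "ideal {v \<in> carrier R. \<forall>e\<in>n. e \<otimes> v \<in> Q} R"
proof (rule ideal_closedI)
  interpret Q: ideal Q R by fact
  show "\<zero> \<in> {v \<in> carrier R. \<forall>e\<in>n. e \<otimes> v \<in> Q}" using assms(2) Q.zero_closed by auto
  fix v r assume v: "v \<in> {v \<in> carrier R. \<forall>e\<in>n. e \<otimes> v \<in> Q}" and r: "r \<in> carrier R"
  have "e \<otimes> (r \<otimes> v) \<in> Q" if e: "e \<in> n" for e
  proof -
    have "e \<in> carrier R" using e assms(2) by blast
    then have "e \<otimes> (r \<otimes> v) = r \<otimes> (e \<otimes> v)" using v r by (simp add: m_lcomm)
    then show ?thesis using v r e Q.I_l_closed by simp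
  qed
  then show "r \<otimes> v \<in> {v \<in> carrier R. \<forall>e\<in>n. e \<otimes> v \<in> Q}" using v r by simp
next
  interpret Q: ideal Q R by fact
  fix v w assume vw: "v \<in> {v \<in> carrier R. \<forall>e\<in>n. e \<otimes> v \<in> Q}" "w \<in> {v \<in> carrier R. \<forall>e\<in>n. e \<otimes> v \<in> Q}"
  have "e \<otimes> (v \<oplus> w) \<in> Q" if e: "e \<in> n" for e
  proof -
    have "e \<in> carrier R" using e assms(2) by blast
    then have "e \<otimes> (v \<oplus> w) = e \<otimes> v \<oplus> e \<otimes> w" using vw by (simp add: r_distr)
    then show ?thesis using vw e by simp
  qed
  then show "v \<oplus> w \<in> {v \<in> carrier R. \<forall>e\<in>n. e \<otimes> v \<in> Q}" using vw by simp
qed blast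

text \<open>Replaces the binomial theorem in showing that radicals are closed under addition: one
  factor of \<open>(a + b)^(s+t) u\<close> is expanded, and each of \<open>a u\<close> and
  \<open>b u\<close> satisfies the hypotheses with one exponent lowered. The extra factor
  \<open>u\<close> makes the induction run.\<close>

lemma (in cring) pow_mult_add_closed:
  fixes s t :: nat
  assumes F: "ideal F R" and ab: "a \<in> carrier R" "b \<in> carrier R"
  shows "u \<in> carrier R \<Longrightarrow> a [^] s \<otimes> u \<in> F \<Longrightarrow> b [^] t \<otimes> u \<in> F \<Longrightarrow> (a \<oplus> b) [^] (s + t) \<otimes> u \<in> F"
proof (induction "s + t" arbitrary: s t u)
  case 0
  then show ?case by simp
next
  case (Suc k)
  interpret F: ideal F R by fact
  have powc: "(a \<oplus> b) [^] j \<in> carrier R" "a [^] j \<in> carrier R" "b [^] j \<in> carrier R" for j :: nat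
    using ab by auto
  show ?case
  proof (cases "s = 0 \<or> t = 0")
    case True
    then have "u \<in> F" using Suc.prems by auto
    then show ?thesis using powc by (simp add: F.I_l_closed)
  next
    case False
    then obtain s' t' where st: "s = Suc s'" "t = Suc t'" by (auto simp: gr0_conv_Suc)
    have k: "k = s' + t" "k = s + t'" using Suc.hyps(2) st by auto
    have "a [^] s' \<otimes> (a \<otimes> u) \<in> F"
      using Suc.prems(2) ab Suc.prems(1) powc st by (simp add: m_assoc)
    moreover have "b [^] t \<otimes> (a \<otimes> u) \<in> F"
    proof -
      have "b [^] t \<otimes> (a \<otimes> u) = a \<otimes> (b [^] t \<otimes> u)" using ab Suc.prems(1) powc(3)[of t] by (simp add: m_lcomm)
      then show ?thesis using Suc.prems(3) ab(1) F.I_l_closed by simp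
    qed
    ultimately have 1: "(a \<oplus> b) [^] (s' + t) \<otimes> (a \<otimes> u) \<in> F"
      using Suc.hyps(1)[OF k(1), of "a \<otimes> u"] ab Suc.prems(1) by simp
    have "b [^] t' \<otimes> (b \<otimes> u) \<in> F"
      using Suc.prems(3) ab Suc.prems(1) powc st by (simp add: m_assoc)
    moreover have "a [^] s \<otimes> (b \<otimes> u) \<in> F"
    proof -
      have "a [^] s \<otimes> (b \<otimes> u) = b \<otimes> (a [^] s \<otimes> u)" using ab Suc.prems(1) powc(2)[of s] by (simp add: m_lcomm)
      then show ?thesis using Suc.prems(2) ab(2) F.I_l_closed by simp
    qed
    ultimately have 2: "(a \<oplus> b) [^] (s + t') \<otimes> (b \<otimes> u) \<in> F"
      using Suc.hyps(1)[OF k(2), of "b \<otimes> u"] ab Suc.prems(1) by simp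
    have "(a \<oplus> b) [^] (s + t) \<otimes> u = (a \<oplus> b) [^] k \<otimes> ((a \<oplus> b) \<otimes> u)"
      using Suc.hyps(2)[symmetric] ab Suc.prems(1) powc by (simp add: m_assoc)
    also have "\<dots> = (a \<oplus> b) [^] k \<otimes> (a \<otimes> u) \<oplus> (a \<oplus> b) [^] k \<otimes> (b \<otimes> u)"
      using ab Suc.prems(1) powc by (simp add: l_distr r_distr)
    also have "\<dots> \<in> F" using 1 2 k by simp
    finally show ?thesis .
  qed
qed

lemma (in cring) radical_ideal:
  assumes F: "ideal F R"
  shows "ideal {x \<in> carrier R. \<exists>n::nat. x [^] n \<in> F} R"
proof (rule ideal_closedI)
  interpret F: ideal F R by fact
  show "\<zero> \<in> {x \<in> carrier R. \<exists>n::nat. x [^] n \<in> F}"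
    using F.zero_closed by (auto intro!: exI[of _ 1])
  {
    fix x y assume "x \<in> {x \<in> carrier R. \<exists>n::nat. x [^] n \<in> F}" "y \<in> {x \<in> carrier R. \<exists>n::nat. x [^] n \<in> F}"
    then obtain n m :: nat where xy: "x \<in> carrier R" "y \<in> carrier R" "x [^] n \<in> F" "y [^] m \<in> F" by auto
    have "(x \<oplus> y) [^] (n + m) \<otimes> \<one> \<in> F" by (rule pow_mult_add_closed[OF F]) (use xy in auto)
    then have "(x \<oplus> y) [^] (n + m) \<in> F" using xy by simp
    then show "x \<oplus> y \<in> {x \<in> carrier R. \<exists>n::nat. x [^] n \<in> F}" using xy by blast
  next
    fix x r assume "x \<in> {x \<in> carrier R. \<exists>n::nat. x [^] n \<in> F}" and r: "r \<in> carrier R"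
    then obtain n :: nat where x: "x \<in> carrier R" "x [^] n \<in> F" by auto
    have "(r \<otimes> x) [^] n = r [^] n \<otimes> x [^] n" using x r by (simp add: nat_pow_distrib)
    then have "(r \<otimes> x) [^] n \<in> F" using x r by (simp add: F.I_l_closed)
    then show "r \<otimes> x \<in> {x \<in> carrier R. \<exists>n::nat. x [^] n \<in> F}" using x r by blast
  }
qed blast

text \<open>The Koszul relations \<open>g j e_i - g i e_j\<close> are syzygies, hence combinations
  of the columns of \<open>\<phi>\<close>. On \<open>t\<close> rows different from \<open>j\<close>
  the matrix of \<open>t\<close> such relations is \<open>g j\<close> times the identity, and its
  determinant is a \<open>t\<close>-minor of a product with \<open>\<phi>\<close>.\<close>

lemma (in cring) generators_power_in_minors_ideal:
  assumes I: "ideal I R" and pres: "free_presentation R (ideal_as_module R I) \<mu> q \<phi> g"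
    and t: "t < \<mu>" and j: "j < \<mu>"
  shows "g j [^] t \<in> minors_ideal R \<mu> q \<phi> t"
proof -
  have \<phi>: "entries_in \<mu> q \<phi>" and gI: "\<And>i. i < \<mu> \<Longrightarrow> g i \<in> I"
    and syz: "\<And>v. v \<in> {..<\<mu>} \<rightarrow> carrier R \<Longrightarrow> (\<Oplus>i\<in>{..<\<mu>}. v i \<otimes> g i) = \<zero> \<Longrightarrow>
      \<exists>w\<in>{..<q} \<rightarrow> carrier R. \<forall>i<\<mu>. v i = (\<Oplus>k\<in>{..<q}. \<phi> i k \<otimes> w k)"
    using pres unfolding free_presentation_ideal_iff[OF I] by blast+
  have gc: "g i \<in> carrier R" if "i < \<mu>" for i using gI[OF that] ideal.Icarr[OF I] by blast
  \<comment> \<open>Enumerates the indices while skipping \<open>j\<close>; its values on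
    \<open>{..<t}\<close> are at most \<open>t\<close>, hence below \<open>\<mu>\<close>.\<close>
  define r where "r i = (if i < j then i else Suc i)" for i
  have r: "strict_mono_on {..<t} r" "r ` {..<t} \<subseteq> {..<\<mu>}"
    using t by (auto simp: r_def strict_mono_on_def)
  have rlt: "r i < \<mu>" if "i < t" for i using r(2) that by auto
  have rj: "r i \<noteq> j" for i by (simp add: r_def)
  have rinj: "r i = r i' \<longleftrightarrow> i = i'" for i i' by (auto simp: r_def)
  define v where "v l k = (if k = r l then g j else \<zero>) \<oplus> (if k = j then \<ominus> g (r l) else \<zero>)" for l k
  have "\<exists>w\<in>{..<q} \<rightarrow> carrier R. \<forall>i<\<mu>. v l i = (\<Oplus>k\<in>{..<q}. \<phi> i k \<otimes> w k)" if l: "l < t" for l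
  proof (rule syz)
    show "v l \<in> {..<\<mu>} \<rightarrow> carrier R" using gc j rlt[OF l] by (auto simp: v_def)
    have "(\<Oplus>i\<in>{..<\<mu>}. v l i \<otimes> g i) = (\<Oplus>i\<in>{..<\<mu>}. (if i = r l then g j else \<zero>) \<otimes> g i) \<oplus>
        (\<Oplus>i\<in>{..<\<mu>}. (if i = j then \<ominus> g (r l) else \<zero>) \<otimes> g i)"
      unfolding v_def by (rule finsum_combine_add[symmetric]) (use gc j rlt[OF l] in auto)
    also have "(\<Oplus>i\<in>{..<\<mu>}. (if i = r l then g j else \<zero>) \<otimes> g i) = g j \<otimes> g (r l)"
      by (rule finsum_combine_single) (use gc j rlt[OF l] in auto)
    also have "(\<Oplus>i\<in>{..<\<mu>}. (if i = j then \<ominus> g (r l) else \<zero>) \<otimes> g i) = \<ominus> g (r l) \<otimes> g j"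
      by (rule finsum_combine_single) (use gc j rlt[OF l] in auto)
    also have "g j \<otimes> g (r l) \<oplus> \<ominus> g (r l) \<otimes> g j = \<zero>"
      using gc[OF j] gc[OF rlt[OF l]] by (simp add: l_minus r_minus m_comm r_neg)
    finally show "(\<Oplus>i\<in>{..<\<mu>}. v l i \<otimes> g i) = \<zero>" .
  qed
  then obtain w where w: "\<And>l. l < t \<Longrightarrow> w l \<in> {..<q} \<rightarrow> carrier R"
    "\<And>l i. l < t \<Longrightarrow> i < \<mu> \<Longrightarrow> v l i = (\<Oplus>k\<in>{..<q}. \<phi> i k \<otimes> w l k)" by metis
  have "matrix_det R t (\<lambda>i l. \<Oplus>k\<in>{..<q}. \<phi> (r i) k \<otimes> w l k) \<in> minors_ideal R \<mu> q \<phi> t"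
    by (rule matrix_det_product_in_minors_ideal[OF \<phi> r]) (use w(1) in auto)
  also have "matrix_det R t (\<lambda>i l. \<Oplus>k\<in>{..<q}. \<phi> (r i) k \<otimes> w l k)
      = matrix_det R t (\<lambda>i l. if i = l then g j else \<zero>)"
  proof (rule matrix_det_cong)
    fix i l assume il: "i < t" "l < t"
    have "(\<Oplus>k\<in>{..<q}. \<phi> (r i) k \<otimes> w l k) = v l (r i)" using w(2)[OF il(2) rlt[OF il(1)]] by simp
    also have "\<dots> = (if i = l then g j else \<zero>)" using rj rinj gc[OF j] by (simp add: v_def)
    finally show "(\<Oplus>k\<in>{..<q}. \<phi> (r i) k \<otimes> w l k) = (if i = l then g j else \<zero>)" .
  qed (use gc[OF j] in simp)
  also have "\<dots> = g j [^] t" by (rule matrix_det_diagonal[OF gc[OF j]])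
  finally show ?thesis .
qed

text \<open>The radical is an ideal, so the generators \<open>g l\<close> suffice;
  \<open>0 < c\<close> leaves a row outside the minor, as the Koszul relations demand. Over a domain
  this makes the Fitting ideal of a nonzero ideal nonzero.\<close>

lemma (in cring) ideal_subset_radical_minors_ideal:
  assumes I: "ideal I R" and pres: "free_presentation R (ideal_as_module R I) \<mu> q \<phi> g"
    and c: "0 < c" and x: "x \<in> I"
  shows "\<exists>n::nat. x [^] n \<in> minors_ideal R \<mu> q \<phi> (\<mu> - c)"
proof -
  have \<phi>: "entries_in \<mu> q \<phi>" and gI: "\<And>i. i < \<mu> \<Longrightarrow> g i \<in> I" and comb: "I = combinations (carrier R) g \<mu>"
    using pres unfolding free_presentation_ideal_iff[OF I] by blast+
  let ?F = "minors_ideal R \<mu> q \<phi> (\<mu> - c)"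
  have F: "ideal ?F R" by (rule minors_ideal_ideal[OF \<phi>])
  have "combinations (carrier R) g \<mu> \<subseteq> {x \<in> carrier R. \<exists>n::nat. x [^] n \<in> ?F}"
  proof (rule combinations_subset[OF radical_ideal[OF F]])
    fix l assume l: "l < \<mu>"
    \<comment> \<open>The index \<open>l\<close> shows that \<open>\<mu>\<close> is positive, so the
      truncated difference is strictly smaller.\<close>
    then have "\<mu> - c < \<mu>" using c by simp
    then show "g l \<in> {x \<in> carrier R. \<exists>n::nat. x [^] n \<in> ?F}"
      using generators_power_in_minors_ideal[OF I pres _ l] gI[OF l] ideal.Icarr[OF I] by blast
  qed simp
  then show ?thesis using x comb by blast
qed

lemma (in cring) finsum_swap:
  assumes "finite C" "finite D" "\<And>i l. i \<in> C \<Longrightarrow> l \<in> D \<Longrightarrow> f i l \<in> carrier R"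
  shows "(\<Oplus>i\<in>C. \<Oplus>l\<in>D. f i l) = (\<Oplus>l\<in>D. \<Oplus>i\<in>C. f i l)"
  using assms(1,3)
proof (induction C rule: finite_induct)
  case empty
  then show ?case by (simp add: finsum_empty finsum_zero)
next
  case (insert x C)
  have cl: "f i l \<in> carrier R" if "i \<in> insert x C" "l \<in> D" for i l using insert.prems that by blast
  have "(\<Oplus>i\<in>insert x C. \<Oplus>l\<in>D. f i l) = (\<Oplus>l\<in>D. f x l) \<oplus> (\<Oplus>i\<in>C. \<Oplus>l\<in>D. f i l)"
    by (rule finsum_insert) (use insert.hyps cl in \<open>auto intro!: finsum_closed\<close>)
  also have "\<dots> = (\<Oplus>l\<in>D. f x l) \<oplus> (\<Oplus>l\<in>D. \<Oplus>i\<in>C. f i l)" using insert.IH cl by simp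
  also have "\<dots> = (\<Oplus>l\<in>D. f x l \<oplus> (\<Oplus>i\<in>C. f i l))"
    by (rule finsum_addf[symmetric]) (use cl in \<open>auto intro!: finsum_closed\<close>)
  also have "\<dots> = (\<Oplus>l\<in>D. \<Oplus>i\<in>insert x C. f i l)"
  proof (rule finsum_cong')
    fix l assume l: "l \<in> D"
    show "f x l \<oplus> (\<Oplus>i\<in>C. f i l) = (\<Oplus>i\<in>insert x C. f i l)"
      by (rule finsum_insert[symmetric]) (use insert.hyps cl l in auto)
  qed (use cl in \<open>auto intro!: finsum_closed\<close>)
  finally show ?case .
qed

section \<open>Perturbing generators into a regular sequence\<close>

context noetherian_cring
begin

text \<open>Each \<open>h\<close> in turn is replaced by \<open>h + k\<close> with \<open>k\<close>
  in \<open>n T\<close>, where \<open>T\<close> is generated by the entries not yet treated. Since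
  \<open>k\<close> lies in \<open>T\<close>, the new list still generates \<open>I\<close>; since it
  lies in \<open>n T\<close>, unfolding the later replacements puts every original \<open>h\<close>
  into the ideal of the final sequence plus \<open>n\<close> times the ideal of \<open>ts\<close>.
  The bound by \<open>c\<close> keeps the sequence shorter than \<open>c\<close> before each
  replacement, where \<open>avoid\<close> applies.\<close>

lemma regular_perturbation:
  assumes n: "ideal n R" and I: "ideal I R"
    and avoid: "\<And>as p. set as \<subseteq> I \<Longrightarrow> regular_mod {\<zero>} as \<Longrightarrow> length as < c \<Longrightarrow>
      p \<in> Ass R (adjoins {\<zero>} as) \<Longrightarrow> \<not> I \<subseteq> p \<and> \<not> n \<subseteq> p"
    and "regular_mod {\<zero>} as" "adjoins {\<zero>} (as @ hs @ ts) = I" "length as + length hs \<le> c"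
    and "set as \<subseteq> I" "set hs \<subseteq> I" "set ts \<subseteq> I"
  shows "\<exists>bs. set (as @ bs) \<subseteq> I \<and> regular_mod {\<zero>} (as @ bs) \<and>
    set hs \<subseteq> adjoins {\<zero>} (as @ bs) <+>\<^bsub>R\<^esub> n \<cdot> adjoins {\<zero>} ts"
  using assms(4-)
proof (induction hs arbitrary: as)
  case Nil
  then show ?case by (intro exI[of _ "[]"]) auto
next
  case (Cons h hs)
  interpret I: ideal I R by fact
  interpret n: ideal n R by fact
  have sub: "set as \<subseteq> I" "h \<in> I" "set hs \<subseteq> I" "set ts \<subseteq> I" using Cons.prems by auto
  have carr: "set as \<subseteq> carrier R" "h \<in> carrier R" "set (hs @ ts) \<subseteq> carrier R" "set ts \<subseteq> carrier R"
    using sub I.Icarr by auto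
  let ?J = "adjoins {\<zero>} as" and ?T = "adjoins {\<zero>} (hs @ ts)"
  have J: "ideal ?J R" by (rule adjoins_ideal[OF zeroideal carr(1)])
  have T: "ideal ?T R" by (rule adjoins_ideal[OF zeroideal carr(3)])
  have K: "ideal (n \<cdot> ?T) R" by (rule ideal_prod_is_ideal[OF n T])
  have TI: "?T \<subseteq> I" by (rule adjoins_minimal[OF I]) (use sub I.zero_closed in auto)
  have KT: "n \<cdot> ?T \<subseteq> ?T" using ideal_prod_inter[OF n T] by blast
  have len: "length as < c" using Cons.prems(3) by simp
  \<comment> \<open>A prime \<open>p\<close> containing \<open>n T\<close> contains
    \<open>T\<close>, as it does not contain \<open>n\<close>; with \<open>as\<close> and
    \<open>h\<close> it would then contain all generators of \<open>I\<close>.\<close>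
  have ex: "\<not> n \<cdot> ?T \<subseteq> p" if p: "p \<in> Ass R ?J" "h \<in> p" for p
  proof
    assume Kp: "n \<cdot> ?T \<subseteq> p"
    have pp: "primeideal p R" using p(1) by (simp add: Ass_def)
    have pI: "ideal p R" by (rule primeideal.axioms(1)[OF pp])
    have av: "\<not> I \<subseteq> p" "\<not> n \<subseteq> p" using avoid[OF sub(1) Cons.prems(1) len p(1)] by auto
    have "?T \<subseteq> p" using primeideal_divides_ideal_prod[OF pp n T Kp] av(2) by blast
    then have "set (hs @ ts) \<subseteq> p" using set_adjoins[OF zeroideal carr(3)] by blast
    moreover have "set as \<subseteq> p" using set_adjoins[OF zeroideal carr(1)] Ass_subset[OF J p(1)] by blast
    ultimately have "adjoins {\<zero>} (as @ (h # hs) @ ts) \<subseteq> p"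
      using p(2) additive_subgroup.zero_closed[OF ideal.axioms(1)[OF pI]]
      by (intro adjoins_minimal[OF pI]) auto
    then show False using av(1) Cons.prems(2) by simp
  qed
  have pr: "primeideal p R" if "p \<in> Ass R ?J" for p using that by (simp add: Ass_def)
  obtain k where k: "k \<in> n \<cdot> ?T" "\<And>p. p \<in> Ass R ?J \<Longrightarrow> h \<oplus> k \<notin> p"
    by (rule coset_prime_avoidance[OF finite_Ass[OF J] pr K carr(2) ex]) blast+
  have kI: "k \<in> I" and kT: "k \<in> ?T" using k(1) KT TI by auto
  have kc: "k \<in> carrier R" using kI I.Icarr by blast
  let ?a = "h \<oplus> k"
  have aI: "?a \<in> I" and ac: "?a \<in> carrier R" using sub(2) kI carr(2) kc by auto
  have rega: "regular_on ?J ?a"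
  proof (rule ccontr)
    assume "\<not> ?thesis"
    then show False using not_regular_imp_Ass[OF J ac] k(2) by metis
  qed
  have rega': "regular_mod {\<zero>} (as @ [?a])" using Cons.prems(1) rega by (simp add: regular_mod_append)
  have gen: "adjoins {\<zero>} ((as @ [?a]) @ hs @ ts) = I"
  proof
    show "adjoins {\<zero>} ((as @ [?a]) @ hs @ ts) \<subseteq> I"
      by (rule adjoins_minimal[OF I]) (use sub aI I.zero_closed in auto)
    have c': "set ((as @ [?a]) @ hs @ ts) \<subseteq> carrier R" using carr ac by auto
    let ?Q = "adjoins {\<zero>} ((as @ [?a]) @ hs @ ts)"
    interpret Q: ideal ?Q R by (rule adjoins_ideal[OF zeroideal c'])
    have setQ: "set ((as @ [?a]) @ hs @ ts) \<subseteq> ?Q" by (rule set_adjoins[OF zeroideal c'])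
    have "?T \<subseteq> ?Q" by (rule adjoins_minimal[OF Q.is_ideal]) (use setQ Q.zero_closed in auto)
    then have "?a \<ominus> k \<in> ?Q" using kT setQ Q.I_minus_closed by auto
    then have "h \<in> ?Q" using carr(2) kc by (simp add: add_minus_cancel)
    then have "adjoins {\<zero>} (as @ (h # hs) @ ts) \<subseteq> ?Q"
      using setQ Q.zero_closed by (intro adjoins_minimal[OF Q.is_ideal]) auto
    then show "I \<subseteq> ?Q" using Cons.prems(2) by simp
  qed
  have "\<exists>bs. set ((as @ [?a]) @ bs) \<subseteq> I \<and> regular_mod {\<zero>} ((as @ [?a]) @ bs) \<and>
    set hs \<subseteq> adjoins {\<zero>} ((as @ [?a]) @ bs) <+>\<^bsub>R\<^esub> n \<cdot> adjoins {\<zero>} ts"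
    by (rule Cons.IH[OF rega' gen]) (use Cons.prems(3) sub aI in auto)
  then obtain bs where bs: "set ((as @ [?a]) @ bs) \<subseteq> I" "regular_mod {\<zero>} ((as @ [?a]) @ bs)"
    "set hs \<subseteq> adjoins {\<zero>} ((as @ [?a]) @ bs) <+>\<^bsub>R\<^esub> n \<cdot> adjoins {\<zero>} ts" by blast
  let ?B = "adjoins {\<zero>} ((as @ [?a]) @ bs)" and ?t = "adjoins {\<zero>} ts"
  have bc: "set ((as @ [?a]) @ bs) \<subseteq> carrier R" using bs(1) I.Icarr by blast
  have B: "ideal ?B R" by (rule adjoins_ideal[OF zeroideal bc])
  have t: "ideal ?t R" by (rule adjoins_ideal[OF zeroideal carr(4)])
  have nt: "ideal (n \<cdot> ?t) R" by (rule ideal_prod_is_ideal[OF n t])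
  interpret Q: ideal "?B <+>\<^bsub>R\<^esub> n \<cdot> ?t" R by (rule add_ideals[OF B nt])
  have BQ: "?B \<subseteq> ?B <+>\<^bsub>R\<^esub> n \<cdot> ?t"
  proof
    fix x assume x: "x \<in> ?B"
    have "x = x \<oplus> \<zero>" using ideal.Icarr[OF B x] by simp
    then show "x \<in> ?B <+>\<^bsub>R\<^esub> n \<cdot> ?t"
      using x additive_subgroup.zero_closed[OF ideal.axioms(1)[OF nt]] unfolding in_set_add_iff by blast
  qed
  have ntQ: "n \<cdot> ?t \<subseteq> ?B <+>\<^bsub>R\<^esub> n \<cdot> ?t"
  proof
    fix x assume x: "x \<in> n \<cdot> ?t"
    have "x = \<zero> \<oplus> x" using ideal.Icarr[OF nt x] by simp
    then show "x \<in> ?B <+>\<^bsub>R\<^esub> n \<cdot> ?t"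
      using x additive_subgroup.zero_closed[OF ideal.axioms(1)[OF B]] unfolding in_set_add_iff by blast
  qed
  \<comment> \<open>All of \<open>?T\<close> is multiplied by \<open>n\<close> into the target: the
    entries of \<open>hs\<close> lie there by induction, and \<open>n\<close> times
    \<open>ts\<close> does by construction. Hence \<open>k\<close> lies there too, and so does
    \<open>h\<close>.\<close>
  let ?V = "{v \<in> carrier R. \<forall>e\<in>n. e \<otimes> v \<in> ?B <+>\<^bsub>R\<^esub> n \<cdot> ?t}"
  have V: "ideal ?V R" by (rule mult_subset_ideal[OF Q.is_ideal]) (use n.Icarr in blast)
  have "?T \<subseteq> ?V"
  proof (rule adjoins_minimal[OF V])
    show "{\<zero>} \<subseteq> ?V" using additive_subgroup.zero_closed[OF ideal.axioms(1)[OF V]] by blast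
    have "x \<in> ?V" if x: "x \<in> set hs" for x
      using x bs(3) carr(3) n.Icarr Q.I_l_closed by auto
    moreover have "x \<in> ?V" if x: "x \<in> set ts" for x
    proof -
      have "x \<in> ?t" using x set_adjoins[OF zeroideal carr(4)] by blast
      then have "e \<otimes> x \<in> n \<cdot> ?t" if "e \<in> n" for e using that by (intro ideal_prod.prod)
      then show ?thesis using x carr(4) ntQ by blast
    qed
    ultimately show "set (hs @ ts) \<subseteq> ?V" by auto
  qed
  then have "n \<cdot> ?T \<subseteq> ?B <+>\<^bsub>R\<^esub> n \<cdot> ?t" by (intro ideal_prod_subsetI[OF Q.is_ideal]) blast
  then have kQ: "k \<in> ?B <+>\<^bsub>R\<^esub> n \<cdot> ?t" using k(1) by blast
  moreover have "?a \<in> ?B <+>\<^bsub>R\<^esub> n \<cdot> ?t" using set_adjoins[OF zeroideal bc] BQ by auto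
  ultimately have "?a \<ominus> k \<in> ?B <+>\<^bsub>R\<^esub> n \<cdot> ?t" using Q.I_minus_closed by blast
  then have "h \<in> ?B <+>\<^bsub>R\<^esub> n \<cdot> ?t" using carr(2) kc by (simp add: add_minus_cancel)
  then show ?case using bs by (intro exI[of _ "?a # bs"]) simp
qed

text \<open>A minor \<open>M\<close> of a presentation conducts \<open>I\<close> into the ideal of the generators belonging to
  the rows outside \<open>M\<close>. Those generators need not form a regular sequence; perturbing them
  by \<open>n\<close>-multiples of the other generators makes them one and changes \<open>M\<close> only modulo \<open>n\<close>.\<close>

lemma exists_regular_conductor:
  assumes n: "ideal n R" and I: "ideal I R"
    and avoid: "\<And>as p. set as \<subseteq> I \<Longrightarrow> regular_mod {\<zero>} as \<Longrightarrow> length as < c \<Longrightarrow>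
      p \<in> Ass R (adjoins {\<zero>} as) \<Longrightarrow> \<not> I \<subseteq> p \<and> \<not> n \<subseteq> p"
    and pres: "free_presentation R (ideal_as_module R I) \<mu> q \<phi> g"
    and r: "strict_mono_on {..<t} r" "r ` {..<t} \<subseteq> {..<\<mu>}" and s: "s ` {..<t} \<subseteq> {..<q}"
    and t: "\<mu> - c \<le> t"
  shows "\<exists>bs y. set bs \<subseteq> I \<and> regular_mod {\<zero>} bs \<and> y \<in> carrier R \<and>
    (\<forall>f\<in>I. y \<otimes> f \<in> adjoins {\<zero>} bs) \<and> y \<ominus> matrix_det R t (\<lambda>i j. \<phi> (r i) (s j)) \<in> n"
proof -
  interpret I: ideal I R by fact
  interpret n: ideal n R by fact
  have \<phi>: "entries_in \<mu> q \<phi>" and gI: "\<And>i. i < \<mu> \<Longrightarrow> g i \<in> I" and comb: "I = combinations (carrier R) g \<mu>"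
    and syz: "\<And>v. v \<in> {..<\<mu>} \<rightarrow> carrier R \<Longrightarrow> (\<exists>w\<in>{..<q} \<rightarrow> carrier R. \<forall>i<\<mu>. v i = (\<Oplus>k\<in>{..<q}. \<phi> i k \<otimes> w k))
      \<Longrightarrow> (\<Oplus>i\<in>{..<\<mu>}. v i \<otimes> g i) = \<zero>"
    using pres unfolding free_presentation_ideal_iff[OF I] by blast+
  have gc: "g i \<in> carrier R" if "i < \<mu>" for i using gI[OF that] I.Icarr by blast
  have rlt: "r l < \<mu>" if "l < t" for l using r(2) that by auto
  have slt: "s l < q" if "l < t" for l using s that by auto
  have rinj: "inj_on r {..<t}" by (rule strict_mono_on_imp_inj_on[OF r(1)])
  have \<phi>c: "\<phi> i (s j) \<in> carrier R" if "i < \<mu>" "j < t" for i j using \<phi> slt that by simp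
  \<comment> \<open>The rows outside the minor. There are \<open>\<mu> - t\<close> of them, at most
    \<open>c\<close>, so their generators can be perturbed into a regular sequence.\<close>
  define C where "C = {..<\<mu>} - r ` {..<t}"
  have Cfin: "finite C" by (simp add: C_def)
  have Clt: "i < \<mu>" if "i \<in> C" for i using that by (simp add: C_def)
  have "card (r ` {..<t}) = t" using card_image[OF rinj] by simp
  then have Ccard: "card C = \<mu> - t" unfolding C_def using card_Diff_subset[OF _ r(2)] by simp
  define hs where "hs = map g (sorted_list_of_set C)"
  define ts where "ts = map (g \<circ> r) [0..<t]"
  have hset: "set hs = g ` C" using Cfin by (simp add: hs_def)
  have tset: "set ts = (g \<circ> r) ` {..<t}" by (simp add: ts_def atLeast0LessThan)
  have hI: "set hs \<subseteq> I" and tI: "set ts \<subseteq> I" using hset tset gI Clt rlt by auto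
  have carr: "set hs \<subseteq> carrier R" "set ts \<subseteq> carrier R" using hI tI I.Icarr by auto
  have hlen: "length hs \<le> c" using Ccard t by (simp add: hs_def)
  have gen: "adjoins {\<zero>} ([] @ hs @ ts) = I"
  proof
    show "adjoins {\<zero>} ([] @ hs @ ts) \<subseteq> I"
      by (rule adjoins_minimal[OF I]) (use hI tI I.zero_closed in auto)
    have c': "set ([] @ hs @ ts) \<subseteq> carrier R" using carr by simp
    have "combinations (carrier R) g \<mu> \<subseteq> adjoins {\<zero>} ([] @ hs @ ts)"
    proof (rule combinations_subset[OF adjoins_ideal[OF zeroideal c']])
      fix l assume "l < \<mu>"
      then have "l \<in> C \<or> l \<in> r ` {..<t}" by (simp add: C_def)
      then have "g l \<in> set ([] @ hs @ ts)" using hset tset by auto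
      then show "g l \<in> adjoins {\<zero>} ([] @ hs @ ts)" using set_adjoins[OF zeroideal c'] by blast
    qed simp
    then show "I \<subseteq> adjoins {\<zero>} ([] @ hs @ ts)" using comb by simp
  qed
  have "\<exists>bs. set ([] @ bs) \<subseteq> I \<and> regular_mod {\<zero>} ([] @ bs) \<and>
    set hs \<subseteq> adjoins {\<zero>} ([] @ bs) <+>\<^bsub>R\<^esub> n \<cdot> adjoins {\<zero>} ts"
  proof (rule regular_perturbation[OF n I])
    fix as p assume "set as \<subseteq> I" "regular_mod {\<zero>} as" "length as < c" "p \<in> Ass R (adjoins {\<zero>} as)"
    then show "\<not> I \<subseteq> p \<and> \<not> n \<subseteq> p" by (rule avoid)
  qed (use gen hI tI hlen in auto)
  then obtain bs where bs: "set bs \<subseteq> I" "regular_mod {\<zero>} bs"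
    "set hs \<subseteq> adjoins {\<zero>} bs <+>\<^bsub>R\<^esub> n \<cdot> adjoins {\<zero>} ts" by auto
  have bc: "set bs \<subseteq> carrier R" using bs(1) I.Icarr by blast
  let ?J = "adjoins {\<zero>} bs" and ?K = "combinations n (\<lambda>l. g (r l)) t"
  interpret J: ideal ?J R by (rule adjoins_ideal[OF zeroideal bc])
  have grc: "g (r l) \<in> carrier R" if "l < t" for l using gc rlt that by simp
  have K: "ideal ?K R" by (rule combinations_ideal[OF n grc])
  have nT: "n \<cdot> adjoins {\<zero>} ts \<subseteq> ?K"
  proof (rule ideal_prod_subsetI[OF K])
    let ?V = "{v \<in> carrier R. \<forall>e\<in>n. e \<otimes> v \<in> ?K}"
    have V: "ideal ?V R" by (rule mult_subset_ideal[OF K]) (use n.Icarr in blast)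
    have "set ts \<subseteq> ?V"
    proof
      fix x assume "x \<in> set ts"
      then obtain l where l: "l < t" "x = g (r l)" using tset by auto
      have "e \<otimes> g (r l) \<in> ?K" if e: "e \<in> n" for e
        by (rule combinations_single[OF n grc l(1) e])
      then show "x \<in> ?V" using l grc by simp
    qed
    then have "adjoins {\<zero>} ts \<subseteq> ?V"
      using additive_subgroup.zero_closed[OF ideal.axioms(1)[OF V]] by (intro adjoins_minimal[OF V]) auto
    then show "x \<otimes> y \<in> ?K" if "x \<in> n" "y \<in> adjoins {\<zero>} ts" for x y using that by blast
  qed
  have "\<exists>j e. j \<in> ?J \<and> (\<forall>l<t. e l \<in> n) \<and> g i = j \<oplus> (\<Oplus>l\<in>{..<t}. e l \<otimes> g (r l))" if i: "i \<in> C" for i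
  proof -
    have "g i \<in> set hs" using hset i by simp
    then have "g i \<in> ?J <+>\<^bsub>R\<^esub> n \<cdot> adjoins {\<zero>} ts" using bs(3) by blast
    then obtain j k where jk: "j \<in> ?J" "k \<in> n \<cdot> adjoins {\<zero>} ts" "g i = j \<oplus> k"
      unfolding in_set_add_iff by blast
    then have "k \<in> ?K" using nT by blast
    then obtain e where "\<forall>l<t. e l \<in> n" "k = (\<Oplus>l\<in>{..<t}. e l \<otimes> g (r l))"
      by (auto simp: combinations_def)
    then show ?thesis using jk by blast
  qed
  then obtain jj e where je: "\<And>i. i \<in> C \<Longrightarrow> jj i \<in> ?J" "\<And>i l. i \<in> C \<Longrightarrow> l < t \<Longrightarrow> e i l \<in> n"
    "\<And>i. i \<in> C \<Longrightarrow> g i = jj i \<oplus> (\<Oplus>l\<in>{..<t}. e i l \<otimes> g (r l))" by metis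
  have ec: "e i l \<in> carrier R" if "i \<in> C" "l < t" for i l using je(2)[OF that] n.Icarr by blast
  have jc: "jj i \<in> carrier R" if "i \<in> C" for i using je(1)[OF that] J.Icarr by blast
  \<comment> \<open>Replacing \<open>g i\<close> for \<open>i\<close> in \<open>C\<close> by
    \<open>jj i\<close> and a combination of the \<open>g (r l)\<close> changes the coefficient of
    \<open>g (r l)\<close> in the syzygy given by column \<open>s j\<close> by \<open>P l j\<close>.
    The corrected matrix \<open>W\<close> agrees modulo \<open>n\<close> with the one that defines
    the minor.\<close>
  define P where "P l j = (\<Oplus>i\<in>C. \<phi> i (s j) \<otimes> e i l)" for l j
  define W where "W l j = \<phi> (r l) (s j) \<oplus> P l j" for l j
  have Pn: "P l j \<in> n" if "l < t" "j < t" for l j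
    unfolding P_def by (rule finsum_in_ideal[OF n]) (use je(2) that n.I_l_closed \<phi>c Clt in auto)
  have Pc: "P l j \<in> carrier R" if "l < t" "j < t" for l j using Pn[OF that] n.Icarr by blast
  have M: "entries_in t t (\<lambda>i j. \<phi> (r i) (s j))" using \<phi>c rlt by simp
  have Wc: "entries_in t t W" using \<phi>c rlt Pc by (simp add: W_def)
  let ?y = "matrix_det R t W"
  have yc: "?y \<in> carrier R" by (rule matrix_det_closed[OF Wc])
  have yM: "?y \<ominus> matrix_det R t (\<lambda>i j. \<phi> (r i) (s j)) \<in> n"
  proof (rule matrix_det_minus_in_ideal[OF n Wc M])
    fix i j assume "i < t" "j < t"
    then show "W i j \<ominus> \<phi> (r i) (s j) \<in> n"
      using Pn Pc \<phi>c rlt by (simp add: W_def add_minus_cancel)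
  qed
  \<comment> \<open>Modulo \<open>?J\<close> the column \<open>s j\<close> of \<open>\<phi>\<close>
    becomes a relation among the \<open>g (r l)\<close> with coefficients
    \<open>W l j\<close>.\<close>
  have rel: "(\<Oplus>l\<in>{..<t}. g (r l) \<otimes> W l j) \<in> ?J" if j: "j < t" for j
  proof -
    let ?x = "\<lambda>i. \<phi> i (s j)"
    have xc: "?x i \<in> carrier R" if "i < \<mu>" for i using \<phi>c that j by blast
    have "(\<Oplus>i\<in>{..<\<mu>}. ?x i \<otimes> g i) = \<zero>"
    proof (rule syz)
      show "?x \<in> {..<\<mu>} \<rightarrow> carrier R" using xc by auto
      \<comment> \<open>A column is the image of a standard basis vector.\<close>
      show "\<exists>w\<in>{..<q} \<rightarrow> carrier R. \<forall>i<\<mu>. ?x i = (\<Oplus>k\<in>{..<q}. \<phi> i k \<otimes> w k)"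
      proof (intro bexI[of _ "\<lambda>k. if k = s j then \<one> else \<zero>"] allI impI)
        fix i assume i: "i < \<mu>"
        have "(\<Oplus>k\<in>{..<q}. \<phi> i k \<otimes> (if k = s j then \<one> else \<zero>))
            = (\<Oplus>k\<in>{..<q}. (if k = s j then \<one> else \<zero>) \<otimes> \<phi> i k)"
          by (rule finsum_cong') (use \<phi> i in auto)
        also have "\<dots> = \<one> \<otimes> \<phi> i (s j)"
          by (rule finsum_combine_single) (use \<phi> i slt[OF j] in auto)
        finally show "?x i = (\<Oplus>k\<in>{..<q}. \<phi> i k \<otimes> (if k = s j then \<one> else \<zero>))"
          using xc[OF i] by simp
      qed auto
    qed
    moreover have "{..<\<mu>} = r ` {..<t} \<union> C" using r(2) by (auto simp: C_def)
    moreover have "(\<Oplus>i\<in>r ` {..<t} \<union> C. ?x i \<otimes> g i)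
        = (\<Oplus>i\<in>r ` {..<t}. ?x i \<otimes> g i) \<oplus> (\<Oplus>i\<in>C. ?x i \<otimes> g i)"
      by (rule finsum_Un_disjoint) (use Cfin C_def xc gc Clt rlt in auto)
    moreover have "(\<Oplus>i\<in>r ` {..<t}. ?x i \<otimes> g i) = (\<Oplus>l\<in>{..<t}. ?x (r l) \<otimes> g (r l))"
      by (rule finsum_reindex[OF _ rinj]) (use xc gc rlt in auto)
    ultimately have XY: "(\<Oplus>l\<in>{..<t}. ?x (r l) \<otimes> g (r l)) \<oplus> (\<Oplus>i\<in>C. ?x i \<otimes> g i) = \<zero>" by simp
    have "(\<Oplus>i\<in>C. ?x i \<otimes> g i) = (\<Oplus>i\<in>C. ?x i \<otimes> jj i \<oplus> (\<Oplus>l\<in>{..<t}. (?x i \<otimes> e i l) \<otimes> g (r l)))"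
    proof (rule finsum_cong')
      fix i assume i: "i \<in> C"
      have sc: "(\<Oplus>l\<in>{..<t}. e i l \<otimes> g (r l)) \<in> carrier R" by (rule finsum_closed) (use ec i grc in auto)
      have "?x i \<otimes> g i = ?x i \<otimes> (jj i \<oplus> (\<Oplus>l\<in>{..<t}. e i l \<otimes> g (r l)))" using je(3)[OF i] by simp
      also have "\<dots> = ?x i \<otimes> jj i \<oplus> ?x i \<otimes> (\<Oplus>l\<in>{..<t}. e i l \<otimes> g (r l))"
        using xc[OF Clt[OF i]] jc[OF i] sc by (simp add: r_distr)
      also have "?x i \<otimes> (\<Oplus>l\<in>{..<t}. e i l \<otimes> g (r l)) = (\<Oplus>l\<in>{..<t}. ?x i \<otimes> (e i l \<otimes> g (r l)))"
        by (rule finsum_rdistr) (use xc[OF Clt[OF i]] ec i grc in auto)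
      also have "\<dots> = (\<Oplus>l\<in>{..<t}. (?x i \<otimes> e i l) \<otimes> g (r l))"
        by (rule finsum_cong') (use xc[OF Clt[OF i]] ec i grc in \<open>auto simp: m_assoc\<close>)
      finally show "?x i \<otimes> g i = ?x i \<otimes> jj i \<oplus> (\<Oplus>l\<in>{..<t}. (?x i \<otimes> e i l) \<otimes> g (r l))" .
    qed (use xc Clt jc ec grc in \<open>auto intro!: finsum_closed a_closed\<close>)
    also have "\<dots> = (\<Oplus>i\<in>C. ?x i \<otimes> jj i) \<oplus> (\<Oplus>i\<in>C. \<Oplus>l\<in>{..<t}. (?x i \<otimes> e i l) \<otimes> g (r l))"
      by (rule finsum_addf) (use xc Clt jc ec grc in \<open>auto intro!: finsum_closed\<close>)
    also have "(\<Oplus>i\<in>C. \<Oplus>l\<in>{..<t}. (?x i \<otimes> e i l) \<otimes> g (r l)) = (\<Oplus>l\<in>{..<t}. \<Oplus>i\<in>C. (?x i \<otimes> e i l) \<otimes> g (r l))"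
      by (rule finsum_swap) (use Cfin xc Clt ec grc in auto)
    also have "\<dots> = (\<Oplus>l\<in>{..<t}. P l j \<otimes> g (r l))"
    proof (rule finsum_cong')
      fix l assume "l \<in> {..<t}"
      then have l: "l < t" by simp
      show "(\<Oplus>i\<in>C. (?x i \<otimes> e i l) \<otimes> g (r l)) = P l j \<otimes> g (r l)"
        unfolding P_def by (rule finsum_ldistr[symmetric]) (use Cfin xc Clt ec[OF _ l] grc[OF l] in auto)
    qed (use Pc[OF _ j] grc in auto)
    finally have Y: "(\<Oplus>i\<in>C. ?x i \<otimes> g i) = (\<Oplus>i\<in>C. ?x i \<otimes> jj i) \<oplus> (\<Oplus>l\<in>{..<t}. P l j \<otimes> g (r l))" .
    let ?X = "\<Oplus>l\<in>{..<t}. ?x (r l) \<otimes> g (r l)" and ?A = "\<Oplus>i\<in>C. ?x i \<otimes> jj i"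
      and ?Z = "\<Oplus>l\<in>{..<t}. P l j \<otimes> g (r l)"
    have AJ: "?A \<in> ?J"
      by (rule finsum_in_ideal[OF J.is_ideal]) (use xc Clt je(1) J.I_l_closed in auto)
    have c: "?X \<in> carrier R" "?A \<in> carrier R" "?Z \<in> carrier R"
      using J.Icarr[OF AJ] Pc[OF _ j] grc xc rlt by (auto intro!: finsum_closed)
    have "?X \<oplus> ?Z = \<ominus> ?A"
    proof -
      have "?X \<oplus> (?A \<oplus> ?Z) = \<zero>" using XY Y by simp
      then have "(?X \<oplus> ?Z) \<oplus> ?A = \<zero>" using c by (simp only: a_assoc a_comm[of ?Z ?A])
      from minus_equality[OF this c(2) a_closed[OF c(1,3)]] show ?thesis by (rule sym)
    qed
    moreover have "?X \<oplus> ?Z = (\<Oplus>l\<in>{..<t}. (?x (r l) \<oplus> P l j) \<otimes> g (r l))"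
      by (rule finsum_combine_add) (use xc rlt Pc[OF _ j] grc in auto)
    moreover have "\<dots> = (\<Oplus>l\<in>{..<t}. g (r l) \<otimes> W l j)"
      by (rule finsum_cong') (use xc rlt Pc[OF _ j] grc in \<open>auto simp: W_def m_comm\<close>)
    ultimately show ?thesis using J.a_inv_closed[OF AJ] by simp
  qed
  have ygr: "?y \<otimes> g (r l) \<in> ?J" if l: "l < t" for l
    by (rule matrix_det_mult_in_ideal[OF J.is_ideal Wc grc rel l])
  \<comment> \<open>For \<open>i\<close> in \<open>C\<close> the generator lies in \<open>?J\<close>
    plus a combination of the \<open>g (r l)\<close>, which \<open>?y\<close> already multiplies
    into \<open>?J\<close>.\<close>
  have yg: "g i \<in> {v \<in> carrier R. \<forall>z\<in>{?y}. z \<otimes> v \<in> ?J}" if i: "i < \<mu>" for i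
  proof (cases "i \<in> C")
    case False
    then obtain l where "l < t" "i = r l" using i by (auto simp: C_def)
    then show ?thesis using ygr grc by simp
  next
    case True
    have "combinations n (\<lambda>l. g (r l)) t \<subseteq> {v \<in> carrier R. \<forall>z\<in>{?y}. z \<otimes> v \<in> ?J}"
      by (rule combinations_subset[OF mult_subset_ideal[OF J.is_ideal]])
        (use yc n.Icarr ygr grc in auto)
    moreover have "(\<Oplus>l\<in>{..<t}. e i l \<otimes> g (r l)) \<in> combinations n (\<lambda>l. g (r l)) t"
      unfolding combinations_def using je(2)[OF True] by blast
    ultimately have k: "(\<Oplus>l\<in>{..<t}. e i l \<otimes> g (r l)) \<in> carrier R"
      "?y \<otimes> (\<Oplus>l\<in>{..<t}. e i l \<otimes> g (r l)) \<in> ?J" by auto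
    have "?y \<otimes> g i = ?y \<otimes> jj i \<oplus> ?y \<otimes> (\<Oplus>l\<in>{..<t}. e i l \<otimes> g (r l))"
      unfolding je(3)[OF True] using yc jc[OF True] k(1) by (rule r_distr[rotated 2])
    also have "\<dots> \<in> ?J" using k(2) J.I_l_closed[OF je(1)[OF True] yc] by simp
    finally show ?thesis using gc[OF i] by simp
  qed
  have "combinations (carrier R) g \<mu> \<subseteq> {v \<in> carrier R. \<forall>z\<in>{?y}. z \<otimes> v \<in> ?J}"
    by (rule combinations_subset[OF mult_subset_ideal[OF J.is_ideal] _ yg]) (use yc in auto)
  then have "\<forall>f\<in>I. ?y \<otimes> f \<in> ?J" using comb by blast
  then show ?thesis using bs(1,2) yc yM by blast
qed

end

section \<open>Initial degrees of symbolic powers\<close>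

text \<open>Existence of a presentation makes the choice in \<open>fitting_ideal\<close> meaningful
  and lets one work with the presentation behind it.\<close>

lemma (in noetherian_cring) fitting_ideal_eq_minors_ideal:
  assumes "ideal I R"
  obtains \<mu> q \<phi> g where "free_presentation R (ideal_as_module R I) \<mu> q \<phi> g"
    "fitting_ideal R (ideal_as_module R I) c = minors_ideal R \<mu> q \<phi> (\<mu> - c)"
proof -
  let ?P = "\<lambda>F. \<exists>\<mu> q \<phi> g. free_presentation R (ideal_as_module R I) \<mu> q \<phi> g \<and> F = minors_ideal R \<mu> q \<phi> (\<mu> - c)"
  have "\<exists>F. ?P F" using exists_free_presentation[OF assms] by blast
  then have "?P (SOME F. ?P F)" by (rule someI_ex)
  then show ?thesis unfolding fitting_ideal_def[symmetric] using that by blast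
qed

lemma (in graded_domain) component_pow: "x \<in> A i \<Longrightarrow> x [^] n \<in> A (n * i)" for n :: nat
proof (induction n)
  case 0
  have "subfield (A 0) R" using graded by (simp add: positively_graded_def)
  then show ?case using subringE(3)[OF subfieldE(1)] by simp
next
  case (Suc n)
  then show ?case using component_mult[of "x [^] n" "n * i" x i] by (simp add: add.commute)
qed

lemma (in cring) pow_in_ideal_power:
  assumes I: "ideal I R" and y: "y \<in> I"
  shows "y [^] m \<in> ideal_power R I m"
proof -
  have yc: "y \<in> carrier R" using ideal.Icarr[OF I y] .
  have "y [^] m \<in> pow_times I (carrier R) m"
  proof (induction m)
    case (Suc m)
    have "y \<otimes> y [^] m \<in> I \<cdot> pow_times I (carrier R) m" by (rule ideal_prod.prod[OF y Suc])
    then show ?case using yc by (simp add: m_comm)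
  qed simp
  then show ?thesis using pow_times_carrier[OF I] by simp
qed

text \<open>In a domain the zero ideal is a prime strictly below every prime that contains a nonzero
  \<open>I\<close>. This provides \<open>0 < c\<close>.\<close>

lemma (in "domain") height_pos:
  assumes "ideal I R" "I \<noteq> {\<zero>}"
  shows "1 \<le> height R I"
  unfolding height_def
proof (rule INF_greatest)
  fix p assume "p \<in> {p. primeideal p R \<and> I \<subseteq> p}"
  then have p: "primeideal p R" "I \<subseteq> p" by auto
  have "\<zero> \<in> I" by (rule additive_subgroup.zero_closed[OF ideal.axioms(1)[OF assms(1)]])
  then have "{\<zero>} \<subset> p" using p(2) assms(2) by blast
  then have "prime_chain R [{\<zero>}, p]" using p(1) zeroprimeideal by (simp add: prime_chain_def)
  then have "enat (length [{\<zero>}, p] - 1) \<le> prime_height R p"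
    unfolding prime_height_def by (intro SUP_upper) simp
  then show "1 \<le> prime_height R p" by (simp add: one_enat_def)
qed

section \<open>Conductors and Fitting ideals in graded Cohen-Macaulay domains\<close>

locale graded_cohen_macaulay_domain = graded_domain +
  assumes cm: "cohen_macaulay R"

sublocale graded_cohen_macaulay_domain \<subseteq> noetherian_cring
  using cm by unfold_locales (simp add: cohen_macaulay_def noetherian_ring_def noetherian_ring_axioms_def)

context graded_cohen_macaulay_domain
begin

text \<open>A prime over \<open>I\<close> has height at least \<open>c\<close>, but \<open>p\<close>
  has height at most \<open>length as\<close>. If \<open>p\<close> contained some
  \<open>above N\<close>, it would contain \<open>above 1\<close>, in which the proper homogeneous
  ideal \<open>I\<close> lies.\<close>

lemma regular_sequence_Ass_avoids:
  assumes I: "homogeneous_ideal R A I" "I \<noteq> carrier R" and ht: "height R I = enat c"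
    and as: "set as \<subseteq> I" "regular_mod {\<zero>} as" "length as < c" and p: "p \<in> Ass R (adjoins {\<zero>} as)"
  shows "\<not> I \<subseteq> p \<and> \<not> above N \<subseteq> p"
proof -
  have ideal: "ideal I R" using I(1) by (simp add: homogeneous_ideal_def)
  have pp: "primeideal p R" using p by (simp add: Ass_def)
  have asc: "set as \<subseteq> carrier R" using as(1) ideal.Icarr[OF ideal] by blast
  have "\<not> I \<subseteq> p"
  proof
    assume "I \<subseteq> p"
    then have "height R I \<le> prime_height R p" unfolding height_def by (intro INF_lower) (use pp in simp)
    also have "\<dots> \<le> enat (length as)" by (rule cohen_macaulay_height_Ass_le[OF cm asc as(2) p])
    finally show False using ht as(3) by simp
  qed
  moreover have "I \<subseteq> above 1" by (rule proper_homogeneous_ideal_above_1[OF I])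
  ultimately show ?thesis using above_1_prime_subset[OF pp] by blast
qed

text \<open>As \<open>above (Suc d)\<close> is an ideal, some minor among the generators of the
  Fitting ideal lies outside it along with \<open>y\<close>. Perturbing with
  \<open>n = above (Suc d)\<close> replaces this minor by a conductor congruent to it, hence again
  outside.\<close>

lemma conductor_of_order_le:
  assumes I: "homogeneous_ideal R A I" "I \<noteq> carrier R" and ht: "height R I = enat c"
    and y: "y \<in> fitting_ideal R (ideal_as_module R I) c" "y \<notin> above (Suc d)"
  shows "\<exists>bs z. set bs \<subseteq> I \<and> regular_mod {\<zero>} bs \<and> z \<in> carrier R \<and>
    (\<forall>f\<in>I. z \<otimes> f \<in> adjoins {\<zero>} bs) \<and> z \<notin> above (Suc d)"
proof -
  have ideal: "ideal I R" using I(1) by (simp add: homogeneous_ideal_def)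
  obtain \<mu> q \<phi> g where pres: "free_presentation R (ideal_as_module R I) \<mu> q \<phi> g"
    and F: "fitting_ideal R (ideal_as_module R I) c = minors_ideal R \<mu> q \<phi> (\<mu> - c)"
    by (rule fitting_ideal_eq_minors_ideal[OF ideal])
  have \<phi>: "entries_in \<mu> q \<phi>" using pres unfolding free_presentation_ideal_iff[OF ideal] by blast
  let ?t = "\<mu> - c" and ?n = "above (Suc d)"
  have "\<exists>r s. strict_mono_on {..<?t} r \<and> r ` {..<?t} \<subseteq> {..<\<mu>} \<and> strict_mono_on {..<?t} s \<and>
    s ` {..<?t} \<subseteq> {..<q} \<and> matrix_det R ?t (\<lambda>i j. \<phi> (r i) (s j)) \<notin> ?n"
  proof (rule ccontr)
    assume *: "\<not> ?thesis"
    have "minors_ideal R \<mu> q \<phi> ?t \<subseteq> ?n"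
      unfolding minors_ideal_def
    proof (rule genideal_minimal[OF above_ideal], rule subsetI)
      fix M assume "M \<in> {matrix_det R ?t (\<lambda>i j. \<phi> (r i) (s j)) |r s.
        strict_mono_on {..<?t} r \<and> r ` {..<?t} \<subseteq> {..<\<mu>} \<and> strict_mono_on {..<?t} s \<and> s ` {..<?t} \<subseteq> {..<q}}"
      then obtain r s where "M = matrix_det R ?t (\<lambda>i j. \<phi> (r i) (s j))"
        "strict_mono_on {..<?t} r" "r ` {..<?t} \<subseteq> {..<\<mu>}" "strict_mono_on {..<?t} s" "s ` {..<?t} \<subseteq> {..<q}"
        by blast
      then show "M \<in> ?n" using * by meson
    qed
    then show False using y F by blast
  qed
  then obtain r s where rs: "strict_mono_on {..<?t} r" "r ` {..<?t} \<subseteq> {..<\<mu>}" "s ` {..<?t} \<subseteq> {..<q}"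
    "matrix_det R ?t (\<lambda>i j. \<phi> (r i) (s j)) \<notin> ?n" by blast
  let ?M = "matrix_det R ?t (\<lambda>i j. \<phi> (r i) (s j))"
  have Mc: "?M \<in> carrier R"
    by (rule matrix_det_closed) (use \<phi> rs in \<open>auto simp: image_subset_iff\<close>)
  have "\<exists>bs z. set bs \<subseteq> I \<and> regular_mod {\<zero>} bs \<and> z \<in> carrier R \<and>
    (\<forall>f\<in>I. z \<otimes> f \<in> adjoins {\<zero>} bs) \<and> z \<ominus> ?M \<in> ?n"
  proof (rule exists_regular_conductor[OF above_ideal ideal _ pres rs(1-3) order_refl])
    fix as p assume "set as \<subseteq> I" "regular_mod {\<zero>} as" "length as < c" "p \<in> Ass R (adjoins {\<zero>} as)"
    then show "\<not> I \<subseteq> p \<and> \<not> ?n \<subseteq> p" by (rule regular_sequence_Ass_avoids[OF I ht])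
  qed
  then obtain bs z where bz: "set bs \<subseteq> I" "regular_mod {\<zero>} bs" "z \<in> carrier R"
    "\<forall>f\<in>I. z \<otimes> f \<in> adjoins {\<zero>} bs" "z \<ominus> ?M \<in> ?n" by blast
  have "z \<notin> ?n"
  proof
    assume "z \<in> ?n"
    then have "z \<ominus> (z \<ominus> ?M) \<in> ?n" using bz(5) by (rule ideal.I_minus_closed[OF above_ideal])
    then show False using rs(4) bz(3) Mc by (simp add: add_minus_cancel)
  qed
  then show ?thesis using bz by blast
qed

text \<open>A power of \<open>x\<close> lies in the Fitting ideal; it is homogeneous, and nonzero
  since orders add up in a domain.\<close>

lemma initial_degree_fitting_ideal_finite:
  assumes I: "ideal I R" and c: "0 < c" and x: "x \<in> I \<inter> A a" "x \<noteq> \<zero>"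
  obtains d y where "initial_degree R A (fitting_ideal R (ideal_as_module R I) c) = ereal (real d)"
    "y \<in> fitting_ideal R (ideal_as_module R I) c \<inter> A d" "y \<noteq> \<zero>"
proof -
  let ?F = "fitting_ideal R (ideal_as_module R I) c"
  obtain \<mu> q \<phi> g where pres: "free_presentation R (ideal_as_module R I) \<mu> q \<phi> g"
    and F: "?F = minors_ideal R \<mu> q \<phi> (\<mu> - c)"
    by (rule fitting_ideal_eq_minors_ideal[OF I])
  obtain n :: nat where n: "x [^] n \<in> ?F"
    using ideal_subset_radical_minors_ideal[OF I pres c, of x] x(1) F by auto
  have xA: "x \<in> A a" using x by blast
  have "x \<notin> above (Suc a)" by (rule component_not_above[OF xA x(2)]) simp
  then have "x [^] n \<notin> above (Suc (n * a))" by (rule not_above_pow[OF component_closed[OF xA]])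
  then have ne: "x [^] n \<noteq> \<zero>" using above_zero by metis
  have xn: "x [^] n \<in> ?F \<inter> A (n * a)" using n component_pow[OF xA] by blast
  show ?thesis
    using initial_degree_cases[of ?F thesis] xn ne that by blast
qed

end

theorem corollary5p11:
  fixes S :: "('a, 'b) ring_scheme" and A :: "nat \<Rightarrow> 'a set" and I :: "'a set" and c m :: nat
  assumes "domain S" and "cohen_macaulay S" and "positively_graded S A"
    and "homogeneous_ideal S A I" and "I \<noteq> carrier S"
    and "height S I = enat c" and "unmixed S I c"
    and "generically_complete_intersection S I"
    and "m > 0"
  defines "F \<equiv> fitting_ideal S (ideal_as_module S I) c"
    and "\<alpha> \<equiv> initial_degree S A"
  shows "(\<forall>t\<^sub>0::nat. symbolic_power S I m = colon_ideal S (ideal_power S I m) (ideal_power S F t\<^sub>0) \<longrightarrow>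
            \<alpha> (symbolic_power S I m) \<ge> ereal (real m) * \<alpha> I - ereal (real t\<^sub>0) * \<alpha> F) \<and>
         \<alpha> (symbolic_power S I m) \<ge> ereal (real m) * (\<alpha> I - \<alpha> F) + \<alpha> F"
proof -
  interpret S: graded_cohen_macaulay_domain S A
    using assms(1-3)
    by (simp add: graded_cohen_macaulay_domain_def graded_cohen_macaulay_domain_axioms_def
        graded_domain_def graded_domain_axioms_def)
  have I: "ideal I S" using assms(4) by (simp add: homogeneous_ideal_def)
  let ?z = "\<zero>\<^bsub>S\<^esub>" and ?I = "ideal_power S I m" and ?Y = "symbolic_power S I m"
  have sat: "\<exists>u\<in>carrier S - p. u \<otimes>\<^bsub>S\<^esub> x \<in> ?I" if "x \<in> ?Y" "p \<in> Ass S I" for x p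
    by (rule S.symbolic_power_saturated[OF I that])
  show ?thesis
  proof (cases "I = {?z}")
    \<comment> \<open>Here \<open>\<alpha> I\<close> is infinite and no arithmetic with it is
      attempted: the symbolic power vanishes as well, so \<open>\<alpha> ?Y\<close> is
      \<open>\<infinity>\<close> and every lower bound holds.\<close>
    case True
    have "x = ?z" if x: "x \<in> ?Y" for x
    proof -
      obtain p where p: "p \<in> Ass S I" by (rule S.Ass_nonempty[OF I assms(5)])
      obtain u where u: "u \<in> carrier S" "u \<notin> p" "u \<otimes>\<^bsub>S\<^esub> x \<in> ?I" using sat[OF x p] by blast
      obtain n where n: "m = Suc n" using assms(9) by (cases m) auto
      have "S.pow_times I (carrier S) m \<subseteq> S.pow_times I (carrier S) 1"
        by (rule S.pow_times_antimono[OF I S.oneideal]) (use n in simp)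
      also have "\<dots> \<subseteq> I" using S.ideal_prod_inter[OF I S.oneideal] by simp
      finally have "?I \<subseteq> I" using S.pow_times_carrier[OF I] by simp
      then have "u \<otimes>\<^bsub>S\<^esub> x = ?z" using u(3) True by blast
      moreover have "x \<in> carrier S" using x by (simp add: symbolic_power_def)
      moreover have "u \<noteq> ?z" using u(2) S.Ass_subset[OF I p] True by blast
      ultimately show ?thesis using S.integral u(1) by blast
    qed
    then have "\<alpha> ?Y = \<infinity>" unfolding \<alpha>_def using S.initial_degree_cases[of ?Y] by blast
    then have "r \<le> \<alpha> ?Y" for r by simp
    then show ?thesis by blast
  next
    case False
    have "1 \<le> height S I" by (rule S.height_pos[OF I False])
    \<comment> \<open>Positivity of \<open>c\<close> makes the Fitting ideal nonzero, so that both
      \<open>\<alpha> I\<close> and \<open>\<alpha> F\<close> are finite and the estimates take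
      place in the reals.\<close>
    then have c: "0 < c" using assms(6) by (simp add: one_enat_def)
    obtain a x\<^sub>0 where a: "x\<^sub>0 \<in> I \<inter> A a" "x\<^sub>0 \<noteq> ?z" "\<alpha> I = ereal (real a)"
      "\<And>e y. y \<in> I \<inter> A e \<Longrightarrow> y \<noteq> ?z \<Longrightarrow> a \<le> e"
    proof (cases rule: S.initial_degree_cases[of I])
      case zero
      have "Idl\<^bsub>S\<^esub> (I \<inter> (\<Union>i. A i)) \<subseteq> {?z}"
        by (rule S.genideal_minimal[OF S.zeroideal]) (use zero(1) in blast)
      then have "I \<subseteq> {?z}" using assms(4) by (simp add: homogeneous_ideal_def)
      then have "I = {?z}" using additive_subgroup.zero_closed[OF ideal.axioms(1)[OF I]] by blast
      with False show ?thesis by blast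
    next
      case (degree d x)
      then show ?thesis using that unfolding \<alpha>_def by blast
    qed
    obtain d y where d: "\<alpha> F = ereal (real d)" "y \<in> F \<inter> A d" "y \<noteq> ?z"
      unfolding \<alpha>_def F_def by (rule S.initial_degree_fitting_ideal_finite[OF I c a(1,2)])
    have Fid: "ideal F S"
    proof -
      obtain \<mu> q \<phi> g where "free_presentation S (ideal_as_module S I) \<mu> q \<phi> g"
        "F = minors_ideal S \<mu> q \<phi> (\<mu> - c)"
        unfolding F_def by (rule S.fitting_ideal_eq_minors_ideal[OF I])
      then show ?thesis using S.minors_ideal_ideal unfolding S.free_presentation_ideal_iff[OF I] by blast
    qed
    have yF: "y \<in> F" and yA: "y \<in> A d" and yc: "y \<in> carrier S" using d(2) S.component_closed by auto
    have yd: "y \<notin> S.above (Suc d)" by (rule S.component_not_above[OF yA d(3)]) simp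
    have "I \<subseteq> S.above a" by (rule S.homogeneous_ideal_above[OF assms(4) a(4)])
    then have Im: "?I \<subseteq> S.above (m * a)" by (rule S.ideal_power_above[OF I])
    \<comment> \<open>Orders are compared: \<open>z^k x\<close> has order at most
      \<open>k d + e\<close>, whereas \<open>I^m\<close> has order at least
      \<open>m a\<close>.\<close>
    have key: "m * a \<le> k * d + e"
      if x: "x \<in> A e" "x \<noteq> ?z" and z: "z \<in> carrier S" "z \<notin> S.above (Suc d)"
        and zx: "z [^]\<^bsub>S\<^esub> k \<otimes>\<^bsub>S\<^esub> x \<in> ?I" for x e z and k :: nat
    proof (rule ccontr)
      assume "\<not> ?thesis"
      then have le: "Suc (k * d + e) \<le> m * a" by simp
      have "x \<notin> S.above (Suc e)" by (rule S.component_not_above[OF x]) simp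
      then have "z [^]\<^bsub>S\<^esub> k \<otimes>\<^bsub>S\<^esub> x \<notin> S.above (Suc (k * d + e))"
        using S.not_above_mult[OF S.nat_pow_closed[OF z(1)] S.component_closed[OF x(1)] S.not_above_pow[OF z]]
        by blast
      then show False using S.above_mono[OF _ le] zx Im by blast
    qed
    have 1: "ereal (real m) * \<alpha> I - ereal (real t) * \<alpha> F \<le> \<alpha> ?Y"
      if eq: "?Y = colon_ideal S ?I (ideal_power S F t)" for t :: nat
    proof -
      have "ereal (real m * real a - real t * real d) \<le> \<alpha> ?Y"
        unfolding \<alpha>_def
      proof (rule S.initial_degree_geI)
        fix e x assume x: "x \<in> ?Y \<inter> A e" "x \<noteq> ?z"
        have "y [^]\<^bsub>S\<^esub> t \<in> ideal_power S F t" by (rule S.pow_in_ideal_power[OF Fid yF])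
        moreover have "x \<in> colon_ideal S ?I (ideal_power S F t)" using x(1) eq by blast
        ultimately have "x \<otimes>\<^bsub>S\<^esub> y [^]\<^bsub>S\<^esub> t \<in> ?I" by (simp add: colon_ideal_def)
        moreover have "x \<in> carrier S" using x S.component_closed by blast
        ultimately have "y [^]\<^bsub>S\<^esub> t \<otimes>\<^bsub>S\<^esub> x \<in> ?I" using yc by (simp add: S.m_comm)
        then have "m * a \<le> t * d + e" using key[OF _ x(2) yc yd] x(1) by blast
        then have "real (m * a) \<le> real (t * d + e)" by (rule of_nat_mono)
        then show "real m * real a - real t * real d \<le> real e" by simp
      qed
      then show ?thesis using a(3) d(1) by simp
    qed
    have 2: "ereal (real m) * (\<alpha> I - \<alpha> F) + \<alpha> F \<le> \<alpha> ?Y"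
    proof -
      obtain n where n: "m = Suc n" using assms(9) by (cases m) auto
      obtain bs z where z: "set bs \<subseteq> I" "S.regular_mod {?z} bs" "z \<in> carrier S"
        "\<forall>f\<in>I. z \<otimes>\<^bsub>S\<^esub> f \<in> S.adjoins {?z} bs" "z \<notin> S.above (Suc d)"
        using S.conductor_of_order_le[OF assms(4-6) _ yd] yF unfolding F_def by blast
      \<comment> \<open>With \<open>m = n + 1\<close> the bound \<open>m a - n d\<close> equals
        \<open>m (a - d) + d\<close>.\<close>
      have "ereal (real m * (real a - real d) + real d) \<le> \<alpha> ?Y"
        unfolding \<alpha>_def
      proof (rule S.initial_degree_geI)
        fix e x assume x: "x \<in> ?Y \<inter> A e" "x \<noteq> ?z"
        have xc: "x \<in> carrier S" using x S.component_closed by blast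
        have "z [^]\<^bsub>S\<^esub> n \<otimes>\<^bsub>S\<^esub> x \<in> ideal_power S I (Suc n)"
        proof (rule S.saturated_power_mult[OF I z(1-3) _ xc])
          show "z \<otimes>\<^bsub>S\<^esub> f \<in> S.adjoins {?z} bs" if "f \<in> I" for f using z(4) that by blast
          show "\<exists>u\<in>carrier S - p. u \<otimes>\<^bsub>S\<^esub> x \<in> ideal_power S I (Suc n)" if "p \<in> Ass S I" for p
            using sat[OF _ that, of x] x(1) n by blast
        qed
        then have "m * a \<le> n * d + e" using key[OF _ x(2) z(3,5)] x(1) n by blast
        then have "real (m * a) \<le> real (n * d + e)" by (rule of_nat_mono)
        then show "real m * (real a - real d) + real d \<le> real e" using n by (simp add: algebra_simps)
      qed
      then show ?thesis using a(3) d(1) by simp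
    qed
    show ?thesis using 1 2 by blast
  qed
qed

end
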